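(* Consider an $N$-player episodic Markov game (setting and algorithm described in the context). Suppose every agent runs the stage-based OFTRL algorithm described in the context for $T$ iterations with learning rate $\eta_\tau=\Theta\big(\frac{1}{N\log^4 L_\tau}\big)$ in each stage $\tau$. Then the output correlated policy $\bar\pi$ satisfies \[ \operatorname{CCE-Gap}(\bar{\pi}) = O\!\left(\frac{N H^3 \log A_{\max}\cdot \log^5 T}{T}\right). \]
   Context: Markov game: $N$ agents $\mathcal{N}=\{1,\dots,N\}$, horizon $H\in\mathbb{N}_+$, finite state space $\mathcal{S}$, finite action sets $\mathcal{A}_i$ with $A_i=|\mathcal{A}_i|$, $A_{\max}=\max_i A_i$, joint action space $\mathcal{A}_{\mathrm{all}}=\prod_i\mathcal{A}_i$, rewards $r_{h,i}:\mathcal{S}\times\mathcal{A}_{\mathrm{all}}\to[0,1]$, transitions $P_h(\cdot\mid s,\bm a)$, fixed initial state $s_1$; at each step agents observe the state, act simultaneously, receive rewards and the state transitions. $V_{h,i}^\pi(s)$ is the expected sum of agent $i$'s rewards from step $h$ to $H$ under (possibly correlated, non-Markov) policy $\pi$ given $s_h=s$. Notation: $[Q\pi_{h,-i}](s,a_i)=\sum_{\bm a_{-i}}Q(s,a_i,\bm a_{-i})\prod_{k\neq i}\pi_{h,k}(s,a_k)$, $[Q\pi_h](s)=\sum_{\bm a}Q(s,\bm a)\prod_k\pi_{h,k}(s,a_k)$, $P_h[V](s,\bm a)=\mathbb E_{s'\sim P_h(\cdot\mid s,\bm a)}V(s')$. Full information: agent $i$ can query $[Q_{h,i}\pi_{h,-i}](s,a_i)$.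 Algorithm (agent $i$; all agents run it simultaneously), with negative-entropy regularizer $\mathcal R(\bm x)=\sum_a \bm x[a]\log \bm x[a]$. Initialize $Q^1_{h,i}\equiv0$, $Q^\tau_{H+1,i}\equiv0$, $\pi^0_{h,i}(s,\cdot)$ uniform, stage index $\tau=1$, $t^{\mathrm{start}}_1=1$, $L_1=H$. For $t=1,\dots,T$: (Policy update) for all $s,h,a_i$: $\ell^t_{h,i}(s,a_i)=\sum_{t'=t^{\mathrm{start}}_\tau}^{t-1}[Q^\tau_{h,i}\pi^{t'}_{h,-i}](s,a_i)+[Q^\tau_{h,i}\pi^{t-1}_{h,-i}](s,a_i)$ and $\pi^t_{h,i}(s,\cdot)=\arg\max_{\bm x\in\Delta(\mathcal A_i)}\{\langle\bm x,\eta_\tau\ell^t_{h,i}(s,\cdot)/H\rangle-\mathcal R(\bm x)\}$. If $t-t^{\mathrm{start}}_\tau+1\ge L_\tau$: set $t^{\mathrm{end}}_\tau=t$, $t^{\mathrm{start}}_{\tau+1}=t+1$, $L_{\tau+1}=\lfloor(1+1/H)L_\tau\rfloor$; (Value update) for all $h,s,\bm a,i$: $Q^{\tau+1}_{h,i}(s,\bm a)=\frac1{L_\tau}\sum_{t'=t^{\mathrm{start}}_\tau}^{t^{\mathrm{end}}_\tau}\big(r_{h,i}(s,\bm a)+P_h[\,[Q^\tau_{h+1,i}\pi^{t'}_{h+1}]\,](s,\bm a)\big)$; then $\tau\leftarrow\tau+1$ and reset $\pi^t_{h,i}(s,\cdot)$ to uniform for all $s,h$ (this reset value is what the next iteration uses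 as $\pi^{t-1}$). Let $\tau(t)$ denote the stage containing iteration $t$. Output policy: sample $t\sim\mathrm{Unif}([T])$ and output $\bar\pi=\bar\pi_1^t$, where the correlated policy $\bar\pi^t_h$ (acting from step $h$) is: for $h'=h,\dots,H$, sample $j$ uniformly from $\{t^{\mathrm{start}}_{\tau(t)-1},\dots,t^{\mathrm{end}}_{\tau(t)-1}\}$ using randomness shared by all agents, let all agents play the product policy $\pi^j_{h'}$ at step $h'$, and set $t\leftarrow j$. Best response value: $V^{\dagger,\pi_{-i}}_{1,i}(s_1)=\sup_{\pi_i^\dagger}V^{\pi_i^\dagger,\pi_{-i}}_{1,i}(s_1)$, the supremum over all (non-Markov) policies of agent $i$ independent of the randomness of $\pi_{-i}$ (the marginal of $\pi$ on the other agents). $\operatorname{CCE-Gap}(\pi)=\max_i\big(V^{\dagger,\pi_{-i}}_{1,i}(s_1)-V^{\pi}_{1,i}(s_1)\big)$. *)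

theory Defs
  imports "HOL-Probability.Probability"
begin

text \<open>Agents are 0..<N (paper: 1..N), agent i has actions 0..<A i, steps are 1..H,
  states are natural numbers in a finite set S. A joint action is an extensional
  function in PiE {0..<N} (\<lambda>i. {0..<A i}).\<close>

record mgame =
  nag    :: nat
  nact   :: "nat \<Rightarrow> nat"
  hor    :: nat
  states :: "nat set"
  rew    :: "nat \<Rightarrow> nat \<Rightarrow> nat \<Rightarrow> (nat \<Rightarrow> nat) \<Rightarrow> real"     (* r_{h,i}(s,a) *)
  trans  :: "nat \<Rightarrow> nat \<Rightarrow> (nat \<Rightarrow> nat) \<Rightarrow> nat pmf"      (* P_h(. | s,a) *)
  init   :: nat

definition joint_actions :: "mgame \<Rightarrow> (nat \<Rightarrow> nat) set" where
  "joint_actions G = (\<Pi>\<^sub>E i\<in>{0..<nag G}. {0..<nact G i})"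

definition valid_game :: "mgame \<Rightarrow> bool" where
  "valid_game G \<longleftrightarrow> nag G \<ge> 1 \<and> hor G \<ge> 1 \<and> finite (states G) \<and> init G \<in> states G
     \<and> (\<forall>i<nag G. nact G i \<ge> 1)
     \<and> (\<forall>h\<in>{1..hor G}. \<forall>i<nag G. \<forall>s\<in>states G. \<forall>a\<in>joint_actions G.
           0 \<le> rew G h i s a \<and> rew G h i s a \<le> 1)
     \<and> (\<forall>h\<in>{1..hor G}. \<forall>s\<in>states G. \<forall>a\<in>joint_actions G. set_pmf (trans G h s a) \<subseteq> states G)"

definition Amax :: "mgame \<Rightarrow> nat" where
  "Amax G = Max (nact G ` {0..<nag G})"

type_synonym pol = "nat \<Rightarrow> nat \<Rightarrow> nat \<Rightarrow> nat \<Rightarrow> real"          (* \<pi> h i s a_i *)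
type_synonym qfun = "nat \<Rightarrow> nat \<Rightarrow> nat \<Rightarrow> (nat \<Rightarrow> nat) \<Rightarrow> real"  (* Q h i s a *)

definition act_simplex :: "mgame \<Rightarrow> nat \<Rightarrow> (nat \<Rightarrow> real) set" where
  "act_simplex G i = {x. (\<forall>a. 0 \<le> x a) \<and> (\<forall>a. nact G i \<le> a \<longrightarrow> x a = 0) \<and> (\<Sum>a<nact G i. x a) = 1}"

text \<open>Negative entropy (the term x log x is 0 at x = 0).\<close>
definition negent :: "mgame \<Rightarrow> nat \<Rightarrow> (nat \<Rightarrow> real) \<Rightarrow> real" where
  "negent G i x = (\<Sum>a<nact G i. x a * ln (x a))"

definition unif_pol :: "mgame \<Rightarrow> pol" where
  "unif_pol G = (\<lambda>h i s a. if a < nact G i then 1 / real (nact G i) else 0)"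

definition Qmix :: "mgame \<Rightarrow> qfun \<Rightarrow> pol \<Rightarrow> nat \<Rightarrow> nat \<Rightarrow> nat \<Rightarrow> nat \<Rightarrow> real" where
  "Qmix G Q p h i s ai = (\<Sum>a\<in>{a\<in>joint_actions G. a i = ai}.
      Q h i s a * (\<Prod>k\<in>{0..<nag G} - {i}. p h k s (a k)))"

definition Qval :: "mgame \<Rightarrow> qfun \<Rightarrow> pol \<Rightarrow> nat \<Rightarrow> nat \<Rightarrow> nat \<Rightarrow> real" where
  "Qval G Q p h i s = (\<Sum>a\<in>joint_actions G. Q h i s a * (\<Prod>k\<in>{0..<nag G}. p h k s (a k)))"

definition ftrl_pol :: "mgame \<Rightarrow> real \<Rightarrow> (nat \<Rightarrow> real) \<Rightarrow> nat \<Rightarrow> (nat \<Rightarrow> real)" where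
  "ftrl_pol G \<eta> loss i = (THE x. x \<in> act_simplex G i \<and>
      (\<forall>y\<in>act_simplex G i. (\<Sum>a<nact G i. y a * (\<eta> * loss a / real (hor G))) - negent G i y
                     \<le> (\<Sum>a<nact G i. x a * (\<eta> * loss a / real (hor G))) - negent G i x))"

text \<open>One OFTRL policy update, given the policies ps of the current stage so far
  (iterations t_start .. t-1) and the previous policy prev (= \<pi>^{t-1}).\<close>
definition oftrl_step :: "mgame \<Rightarrow> qfun \<Rightarrow> real \<Rightarrow> pol list \<Rightarrow> pol \<Rightarrow> pol" where
  "oftrl_step G Q \<eta> ps prev = (\<lambda>h i s. ftrl_pol G \<eta>
      (\<lambda>ai. (\<Sum>p\<leftarrow>ps. Qmix G Q p h i s ai) + Qmix G Q prev h i s ai) i)"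

primrec stage_pols :: "mgame \<Rightarrow> qfun \<Rightarrow> real \<Rightarrow> nat \<Rightarrow> pol list" where
  "stage_pols G Q \<eta> 0 = []"
| "stage_pols G Q \<eta> (Suc m) =
     (let ps = stage_pols G Q \<eta> m;
          prev = (if m = 0 then unif_pol G else last ps)
      in ps @ [oftrl_step G Q \<eta> ps prev])"

text \<open>Lg H k = L_{k+1}:  L_1 = H, L_{\<tau>+1} = floor((1+1/H) L_\<tau>).\<close>
primrec Lg :: "nat \<Rightarrow> nat \<Rightarrow> nat" where
  "Lg H 0 = H"
| "Lg H (Suc k) = nat \<lfloor>(1 + 1 / real H) * real (Lg H k)\<rfloor>"

definition stage_len :: "mgame \<Rightarrow> nat \<Rightarrow> nat" where
  "stage_len G \<tau> = Lg (hor G) (\<tau> - 1)"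

definition t_start :: "mgame \<Rightarrow> nat \<Rightarrow> nat" where
  "t_start G \<tau> = 1 + (\<Sum>k<\<tau> - 1. Lg (hor G) k)"

definition t_end :: "mgame \<Rightarrow> nat \<Rightarrow> nat" where
  "t_end G \<tau> = t_start G \<tau> + stage_len G \<tau> - 1"

text \<open>\<tau>(t) for t \<ge> 1; iteration 0 (initial uniform policy) is assigned to stage 0.\<close>
definition stage_of :: "mgame \<Rightarrow> nat \<Rightarrow> nat" where
  "stage_of G t = (if t = 0 then 0 else (LEAST \<tau>. 1 \<le> \<tau> \<and> t \<le> t_end G \<tau>))"

text \<open>Value update: Q^{\<tau>+1} from Q^\<tau> and the L_\<tau> policies of stage \<tau>;
  Q_{H+1} \<equiv> 0 is encoded by Q h = 0 for h > H.\<close>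
definition value_update :: "mgame \<Rightarrow> qfun \<Rightarrow> pol list \<Rightarrow> nat \<Rightarrow> qfun" where
  "value_update G Q ps L = (\<lambda>h i s a. if 1 \<le> h \<and> h \<le> hor G then
      (1 / real L) * (\<Sum>p\<leftarrow>ps. rew G h i s a
          + (\<Sum>s'\<in>states G. pmf (trans G h s a) s' * Qval G Q p (h + 1) i s'))
     else 0)"

text \<open>stage_data G \<eta> k = (Q^{k+1}, [policies of stage k+1]).\<close>
primrec stage_data :: "mgame \<Rightarrow> (nat \<Rightarrow> real) \<Rightarrow> nat \<Rightarrow> qfun \<times> pol list" where
  "stage_data G \<eta> 0 = ((\<lambda>_ _ _ _. 0), stage_pols G (\<lambda>_ _ _ _. 0) (\<eta> 1) (Lg (hor G) 0))"
| "stage_data G \<eta> (Suc k) =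
     (let Q' = value_update G (fst (stage_data G \<eta> k)) (snd (stage_data G \<eta> k)) (Lg (hor G) k)
      in (Q', stage_pols G Q' (\<eta> (k + 2)) (Lg (hor G) (Suc k))))"

definition iter_pol :: "mgame \<Rightarrow> (nat \<Rightarrow> real) \<Rightarrow> nat \<Rightarrow> pol" where
  "iter_pol G \<eta> t = (if t = 0 then unif_pol G
     else snd (stage_data G \<eta> (stage_of G t - 1)) ! (t - t_start G (stage_of G t)))"

text \<open>Index set sampled from at the next step of the output policy when the current
  index is t: the iterations of stage \<tau>(t)-1 (convention: {0}, i.e. the initial uniform
  policy, if \<tau>(t) \<le> 1).\<close>
definition prev_stage_iters :: "mgame \<Rightarrow> nat \<Rightarrow> nat set" where
  "prev_stage_iters G t = (let \<tau> = stage_of G t in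
     if \<tau> \<le> 1 then {0} else {t_start G (\<tau> - 1) .. t_end G (\<tau> - 1)})"

type_synonym hist = "(nat \<times> (nat \<Rightarrow> nat)) list"
text \<open>A (randomized, history-dependent, non-Markov) policy of one agent:
  \<sigma> h hist s a_i, where hist lists past (state, joint action) pairs.\<close>
type_synonym dpol = "nat \<Rightarrow> hist \<Rightarrow> nat \<Rightarrow> nat \<Rightarrow> real"

definition agent_policies :: "mgame \<Rightarrow> nat \<Rightarrow> dpol set" where
  "agent_policies G i = {\<sigma>. \<forall>h hist s. \<sigma> h hist s \<in> act_simplex G i}"

text \<open>Probability of joint action a at step h when the shared index is j; if dev = Some \<sigma>,
  agent i plays \<sigma> (which cannot see j) instead of \<pi>^j_{h,i}.\<close>
definition act_prob :: "mgame \<Rightarrow> (nat \<Rightarrow> real) \<Rightarrow> nat \<Rightarrow> dpol option \<Rightarrow> nat \<Rightarrow> nat \<Rightarrow> hist \<Rightarrow> nat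
    \<Rightarrow> (nat \<Rightarrow> nat) \<Rightarrow> real" where
  "act_prob G \<eta> i dev j h hs s a = (case dev of
      None \<Rightarrow> (\<Prod>k\<in>{0..<nag G}. iter_pol G \<eta> j h k s (a k))
    | Some \<sigma> \<Rightarrow> \<sigma> h hs s (a i) * (\<Prod>k\<in>{0..<nag G} - {i}. iter_pol G \<eta> j h k s (a k)))"

text \<open>Wv ... n hs jp s: expected sum of agent i's rewards over the last n steps
  (steps H-n+1..H), at state s, history hs, last sampled index jp.\<close>
primrec Wv :: "mgame \<Rightarrow> (nat \<Rightarrow> real) \<Rightarrow> nat \<Rightarrow> dpol option \<Rightarrow> nat \<Rightarrow> hist \<Rightarrow> nat \<Rightarrow> nat \<Rightarrow> real" where
  "Wv G \<eta> i dev 0 hs jp s = 0"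
| "Wv G \<eta> i dev (Suc n) hs jp s =
     (let h = hor G - n; J = prev_stage_iters G jp in
       (1 / real (card J)) * (\<Sum>j\<in>J. \<Sum>a\<in>joint_actions G. act_prob G \<eta> i dev j h hs s a *
          (rew G h i s a + (\<Sum>s'\<in>states G. pmf (trans G h s a) s' * Wv G \<eta> i dev n (hs @ [(s, a)]) j s'))))"

definition Vout :: "mgame \<Rightarrow> (nat \<Rightarrow> real) \<Rightarrow> nat \<Rightarrow> nat \<Rightarrow> dpol option \<Rightarrow> real" where
  "Vout G \<eta> T i dev = (1 / real T) * (\<Sum>t=1..T. Wv G \<eta> i dev (hor G) [] t (init G))"

definition br_value :: "mgame \<Rightarrow> (nat \<Rightarrow> real) \<Rightarrow> nat \<Rightarrow> nat \<Rightarrow> real" where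
  "br_value G \<eta> T i = (SUP \<sigma>\<in>agent_policies G i. Vout G \<eta> T i (Some \<sigma>))"

definition CCE_gap :: "mgame \<Rightarrow> (nat \<Rightarrow> real) \<Rightarrow> nat \<Rightarrow> real" where
  "CCE_gap G \<eta> T = Max ((\<lambda>i. br_value G \<eta> T i - Vout G \<eta> T i None) ` {0..<nag G})"

end

theory Submission
  imports Defs
begin

text \<open>
  The values of the output policy satisfy the same recursion as the \<open>Q\<close>-estimates, one stage later
  per step. The sampled index is hidden from a deviator and its law depends only on the current stage, so
  remembering the history does not help, and the gain of a deviation in stage \<open>\<tau>\<close> is at most the sum over
  the \<open>H\<close> preceding stages of the average per-state regrets. Stage lengths grow by a factor \<open>1 + 1/H\<close>, so
  these are comparable to \<open>H\<close> times the average regret of one stage, and there are \<open>O(H log T)\<close> stages.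

  Within a stage the regret of optimistic FTRL is at most
  \<open>log A / \<eta> + \<eta> (\<Sum>t. Var(l t - l (t-1)) - Var(l (t-1)) / 4)\<close>. When \<open>N \<eta> log L\<close> is small, the order-\<open>k\<close>
  differences of the utilities are at most \<open>k! (C N \<eta>)^k\<close>, proved with a submultiplicative norm
  on sequences. Summation by parts makes the energies of successive differences log-convex up to boundary
  terms and the drift of the strategies. If the first differences carried a quarter of the energy, then the
  differences of order \<open>log L\<close> would be larger than this bound allows, so the variance terms sum to
  \<open>O(log L ^ 2)\<close>.
\<close>

section \<open>Finite differences\<close>

text \<open>First-order smoothness alone is too weak: each variance of an increment is then only
  O((N \<eta>)^2), and at a rate polylogarithmic in the stage length L these sum to almost L. They
  must be cancelled by the negative terms, whose factor 1/4 fixes the energy ratio to be ruled out.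
  If that ratio were exceeded, energies would lose at most a factor of 16 per order, whereas
  differences bounded by (1/8)^k lose 64 in their squares. After K orders the gap is 4^K, which
  makes up for the L summands once L <= e^K; hence orders up to K, about log L, are needed. The
  bound (1/8)^k requires 8 * 768 * N \<eta> K <= 1, and K rounds max 1 (log L) up to at most twice
  its value: this is the origin of 1/12288. Of the factors in the result, N and log^4 T come from 1
  / \<eta> and log A from the range of the entropy. One log T and one H count stages, one H counts
  the preceding stages that a deviation pays for, and one H is the scale of the utilities. The
  initial estimate 0 is not the value of any policy, so iterations in roughly the first H stages are
  charged the trivial gain H.\<close>

primrec fdiff :: "nat \<Rightarrow> (nat \<Rightarrow> real) \<Rightarrow> nat \<Rightarrow> real" where
  "fdiff 0 f t = f t"
| "fdiff (Suc k) f t = fdiff k f (Suc t) - fdiff k f t"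

lemma fdiff_Suc_inner: "fdiff (Suc k) f t = fdiff k (\<lambda>t. f (Suc t) - f t) t"
  by (induction k arbitrary: t) auto

lemma fdiff_add: "fdiff k (\<lambda>t. f t + g t) t = fdiff k f t + fdiff k g t"
  by (induction k arbitrary: t) auto

lemma fdiff_diff: "fdiff k (\<lambda>t. f t - g t) t = fdiff k f t - fdiff k g t"
  by (induction k arbitrary: t) auto

lemma fdiff_cmult: "fdiff k (\<lambda>t. c * f t) t = c * fdiff k f t"
  by (induction k arbitrary: t) (auto simp: algebra_simps)

lemma fdiff_sum: "fdiff k (\<lambda>t. \<Sum>a\<in>I. f a t) t = (\<Sum>a\<in>I. fdiff k (f a) t)"
  by (induction k arbitrary: t) (auto simp: sum_subtractf)

lemma fdiff_shift: "fdiff k (\<lambda>j. f (m + j)) j = fdiff k f (m + j)"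
  by (induction k arbitrary: j) auto

lemma fdiff_const: "fdiff k (\<lambda>_. c) t = (if k = 0 then c else 0)"
  by (induction k arbitrary: t) auto

lemma fdiff_cong:
  assumes "\<And>j. t \<le> j \<Longrightarrow> j \<le> t + k \<Longrightarrow> f j = g j"
  shows "fdiff k f t = fdiff k g t"
  using assms
proof (induction k arbitrary: t)
  case (Suc k)
  have "fdiff k f (Suc t) = fdiff k g (Suc t)" "fdiff k f t = fdiff k g t"
    by (auto intro!: Suc.IH Suc.prems)
  then show ?case by simp
qed simp

text \<open>Discrete Leibniz rule. The shift of the first factor to \<open>t + h - k\<close> keeps
  every value that is read inside the window from \<open>t\<close> to \<open>t + h\<close>.\<close>

lemma fdiff_mult:
  "fdiff h (\<lambda>t. f t * g t) t = (\<Sum>k\<le>h. real (h choose k) * (fdiff k f (t + h - k) * fdiff (h - k) g t))"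
proof (induction h arbitrary: t)
  case (Suc h)
  let ?S = "\<lambda>k. fdiff k f (Suc t + h - k) * fdiff (Suc h - k) g t"
  have s1: "(\<Sum>k\<le>h. real (h choose k) * (fdiff (Suc k) f (t + h - k) * fdiff (h - k) g t))
     = (\<Sum>k\<le>Suc h. (if k = 0 then 0 else real (h choose (k - 1))) * ?S k)"
    by (subst sum.atMost_Suc_shift) simp
  have s2: "(\<Sum>k\<le>h. real (h choose k) * (fdiff k f (Suc t + h - k) * fdiff (Suc h - k) g t))
     = (\<Sum>k\<le>Suc h. real (h choose k) * ?S k)"
    by simp
  have "fdiff (Suc h) (\<lambda>t. f t * g t) t
     = (\<Sum>k\<le>h. real (h choose k) * (fdiff k f (Suc t + h - k) * fdiff (h - k) g (Suc t)
          - fdiff k f (t + h - k) * fdiff (h - k) g t))"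
    by (simp add: Suc.IH sum_subtractf right_diff_distrib)
  also have "\<dots> = (\<Sum>k\<le>h. real (h choose k) * (fdiff (Suc k) f (t + h - k) * fdiff (h - k) g t)
       + real (h choose k) * (fdiff k f (Suc t + h - k) * fdiff (Suc h - k) g t))"
    by (rule sum.cong) (auto simp: Suc_diff_le algebra_simps)
  also have "\<dots> = (\<Sum>k\<le>Suc h. (if k = 0 then 0 else real (h choose (k - 1))) * ?S k)
      + (\<Sum>k\<le>Suc h. real (h choose k) * ?S k)"
    unfolding sum.distrib s1 s2 ..
  also have "\<dots> = (\<Sum>k\<le>Suc h. real (Suc h choose k) * ?S k)"
    unfolding sum.distrib[symmetric] ring_distribs(2)[symmetric]
    by (rule sum.cong) (auto simp: gr0_conv_Suc split: nat.splits)
  finally show ?case by simp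
qed simp

text \<open>The factor \<open>1 / (k + 1)^2\<close> closes the weights under binomial convolution up to the constant 8, which
  the normalization in \<open>diff_bounded\<close> absorbs.\<close>

definition diff_weight :: "real \<Rightarrow> nat \<Rightarrow> real" where
  "diff_weight \<alpha> k = fact k * \<alpha> ^ k / (real k + 1)^2"

lemma diff_weight_pos: "\<alpha> > 0 \<Longrightarrow> diff_weight \<alpha> k > 0"
  by (simp add: diff_weight_def)

lemma diff_weight_0 [simp]: "diff_weight \<alpha> 0 = 1"
  by (simp add: diff_weight_def)

lemma sum_inverse_squares_le: "(\<Sum>k\<le>n. 1 / (real k + 1)^2) \<le> 2 - 1 / (real n + 1)"
proof (induction n)
  case (Suc n)
  have "1 / (real n + 2)^2 \<le> 1 / ((real n + 1) * (real n + 2))"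
    by (rule divide_left_mono) (auto simp: power2_eq_square)
  also have "\<dots> = 1 / (real n + 1) - 1 / (real n + 2)"
    by (simp add: field_simps)
  finally show ?case using Suc by (simp add: add.commute)
qed simp

text \<open>Factorials and powers of \<alpha> combine exactly, leaving a convolution of inverse
  squares. As \<open>h + 1\<close> is at most the sum of \<open>k + 1\<close> and
  \<open>h - k + 1\<close>, each term splits into two inverse squares with factor 2; each of these
  sums is below 2, hence 8 = 2 * (2 + 2).\<close>

lemma diff_weight_convolution:
  assumes "\<alpha> > 0"
  shows "(\<Sum>k\<le>h. real (h choose k) * (diff_weight \<alpha> k * diff_weight \<alpha> (h - k))) \<le> 8 * diff_weight \<alpha> h"
proof -
  have b: "(real h + 1)^2 / ((real k + 1)^2 * (real (h - k) + 1)^2)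
      \<le> 2 * (1 / (real k + 1)^2) + 2 * (1 / (real (h - k) + 1)^2)" if "k \<le> h" for k
  proof -
    define x y where "x = real k + 1" and "y = real (h - k) + 1"
    have xy: "x > 0" "y > 0" "real h + 1 \<le> x + y" using that by (auto simp: x_def y_def)
    have "(real h + 1)^2 \<le> (x + y)^2" using xy by (intro power_mono) auto
    also have "\<dots> \<le> 2 * x^2 + 2 * y^2"
      using sum_squares_bound[of x y] by (simp add: power2_sum)
    finally have "(real h + 1)^2 / (x^2 * y^2) \<le> (2 * x^2 + 2 * y^2) / (x^2 * y^2)"
      by (rule divide_right_mono) simp
    also have "\<dots> = 2 * (1 / x^2) + 2 * (1 / y^2)"
      using xy by (simp add: field_simps)
    finally show ?thesis by (simp add: x_def y_def)
  qed
  have eq: "real (h choose k) * (diff_weight \<alpha> k * diff_weight \<alpha> (h - k))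
      = diff_weight \<alpha> h * ((real h + 1)^2 / ((real k + 1)^2 * (real (h - k) + 1)^2))" if "k \<le> h" for k
  proof -
    have "real (h choose k) * (fact k * fact (h - k)) = fact h"
      using binomial_fact_lemma[OF that] by (metis mult.commute of_nat_fact of_nat_mult)
    moreover have "\<alpha> ^ k * \<alpha> ^ (h - k) = \<alpha> ^ h"
      using that by (simp flip: power_add)
    moreover have "real (h choose k) * (diff_weight \<alpha> k * diff_weight \<alpha> (h - k))
       = (real (h choose k) * (fact k * fact (h - k))) * (\<alpha> ^ k * \<alpha> ^ (h - k))
          / ((real k + 1)^2 * (real (h - k) + 1)^2)"
      by (simp add: diff_weight_def)
    ultimately show ?thesis by (simp add: diff_weight_def add_nonneg_eq_0_iff)
  qed
  have refl: "(\<Sum>k\<le>h. 1 / (real (h - k) + 1)^2) = (\<Sum>k\<le>h. 1 / (real k + 1)^2)"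
    by (rule sum.reindex_bij_witness[of _ "\<lambda>k. h - k" "\<lambda>k. h - k"]) auto
  have "(\<Sum>k\<le>h. real (h choose k) * (diff_weight \<alpha> k * diff_weight \<alpha> (h - k)))
     = diff_weight \<alpha> h * (\<Sum>k\<le>h. (real h + 1)^2 / ((real k + 1)^2 * (real (h - k) + 1)^2))"
    unfolding sum_distrib_left by (rule sum.cong) (auto simp: eq)
  also have "\<dots> \<le> diff_weight \<alpha> h * (\<Sum>k\<le>h. 2 * (1 / (real k + 1)^2) + 2 * (1 / (real (h - k) + 1)^2))"
    using diff_weight_pos[OF assms, of h] by (intro mult_left_mono sum_mono b) auto
  also have "\<dots> = diff_weight \<alpha> h * (4 * (\<Sum>k\<le>h. 1 / (real k + 1)^2))"
    by (simp only: sum.distrib sum_distrib_left[symmetric] refl) simp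
  also have "\<dots> \<le> diff_weight \<alpha> h * 8"
    using diff_weight_pos[OF assms, of h] sum_inverse_squares_le[of h]
    by (intro mult_left_mono) (auto simp: field_simps intro: order_trans[where y = "2 - 1/(real h + 1)"])
  finally show ?thesis by simp
qed

text \<open>The least such \<open>B\<close> is a norm on the values at positions 0 to
  \<open>n\<close>: the condition \<open>k + t \<le> n\<close> selects exactly the differences that
  read nothing beyond \<open>n\<close>, and the Leibniz rule stays within this family.\<close>

definition diff_bounded :: "real \<Rightarrow> nat \<Rightarrow> real \<Rightarrow> (nat \<Rightarrow> real) \<Rightarrow> bool" where
  "diff_bounded \<alpha> n B f \<longleftrightarrow> (\<forall>k t. k + t \<le> n \<longrightarrow> \<bar>fdiff k f t\<bar> \<le> B * diff_weight \<alpha> k / 8)"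

lemma diff_boundedD: "diff_bounded \<alpha> n B f \<Longrightarrow> k + t \<le> n \<Longrightarrow> \<bar>fdiff k f t\<bar> \<le> B * diff_weight \<alpha> k / 8"
  by (simp add: diff_bounded_def)

lemma diff_bounded_nonneg:
  assumes "diff_bounded \<alpha> n B f" shows "0 \<le> B"
  using diff_boundedD[OF assms, of 0 0] by simp

lemma diff_bounded_mono:
  assumes "\<alpha> > 0" "diff_bounded \<alpha> n A f" "A \<le> B" shows "diff_bounded \<alpha> n B f"
  unfolding diff_bounded_def
proof (intro allI impI)
  fix k t assume "k + t \<le> n"
  from diff_boundedD[OF assms(2) this] show "\<bar>fdiff k f t\<bar> \<le> B * diff_weight \<alpha> k / 8"
    using mult_right_mono[OF assms(3) less_imp_le[OF diff_weight_pos[OF assms(1), of k]]] by linarith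
qed

lemma diff_bounded_add:
  assumes "diff_bounded \<alpha> n A f" "diff_bounded \<alpha> n B g" shows "diff_bounded \<alpha> n (A + B) (\<lambda>t. f t + g t)"
  unfolding diff_bounded_def
proof (intro allI impI)
  fix k t assume "k + t \<le> n"
  from diff_boundedD[OF assms(1) this] diff_boundedD[OF assms(2) this]
  show "\<bar>fdiff k (\<lambda>t. f t + g t) t\<bar> \<le> (A + B) * diff_weight \<alpha> k / 8"
    by (simp add: fdiff_add algebra_simps add_divide_distrib)
qed

lemma diff_bounded_mult:
  assumes "\<alpha> > 0" "diff_bounded \<alpha> n A f" "diff_bounded \<alpha> n B g" shows "diff_bounded \<alpha> n (A * B) (\<lambda>t. f t * g t)"
  unfolding diff_bounded_def
proof (intro allI impI)
  fix h t assume ht: "h + t \<le> n"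
  have AB: "A \<ge> 0" "B \<ge> 0" using assms(2,3) by (auto dest: diff_bounded_nonneg)
  have "\<bar>fdiff h (\<lambda>t. f t * g t) t\<bar>
     \<le> (\<Sum>k\<le>h. real (h choose k) * (\<bar>fdiff k f (t + h - k)\<bar> * \<bar>fdiff (h - k) g t\<bar>))"
    unfolding fdiff_mult by (rule order_trans[OF sum_abs]) (simp add: abs_mult)
  also have "\<dots> \<le> (\<Sum>k\<le>h. real (h choose k) * ((A * diff_weight \<alpha> k / 8) * (B * diff_weight \<alpha> (h - k) / 8)))"
    using ht AB diff_weight_pos[OF assms(1)]
    by (intro sum_mono mult_left_mono mult_mono diff_boundedD[OF assms(2)] diff_boundedD[OF assms(3)])
       (auto intro!: less_imp_le[OF diff_weight_pos[OF assms(1)]] mult_nonneg_nonneg)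
  also have "\<dots> = A * B / 64 * (\<Sum>k\<le>h. real (h choose k) * (diff_weight \<alpha> k * diff_weight \<alpha> (h - k)))"
    unfolding sum_distrib_left by (rule sum.cong) auto
  also have "\<dots> \<le> A * B / 64 * (8 * diff_weight \<alpha> h)"
    using AB by (intro mult_left_mono diff_weight_convolution[OF assms(1)]) auto
  finally show "\<bar>fdiff h (\<lambda>t. f t * g t) t\<bar> \<le> A * B * diff_weight \<alpha> h / 8" by simp
qed

lemma diff_bounded_weighted_sum:
  assumes "finite I" "\<And>b. b \<in> I \<Longrightarrow> 0 \<le> c b" "\<And>b. b \<in> I \<Longrightarrow> diff_bounded \<alpha> n B (f b)"
  shows "diff_bounded \<alpha> n ((\<Sum>b\<in>I. c b) * B) (\<lambda>t. \<Sum>b\<in>I. c b * f b t)"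
  unfolding diff_bounded_def
proof (intro allI impI)
  fix k t assume kt: "k + t \<le> n"
  have "\<bar>fdiff k (\<lambda>t. \<Sum>b\<in>I. c b * f b t) t\<bar> \<le> (\<Sum>b\<in>I. \<bar>c b * fdiff k (f b) t\<bar>)"
    unfolding fdiff_sum fdiff_cmult by (rule sum_abs)
  also have "\<dots> \<le> (\<Sum>b\<in>I. c b * (B * diff_weight \<alpha> k / 8))"
  proof (rule sum_mono)
    fix b assume b: "b \<in> I"
    show "\<bar>c b * fdiff k (f b) t\<bar> \<le> c b * (B * diff_weight \<alpha> k / 8)"
      using mult_left_mono[OF diff_boundedD[OF assms(3)[OF b] kt] assms(2)[OF b]] assms(2)[OF b]
      by (simp only: abs_mult abs_of_nonneg)
  qed
  finally show "\<bar>fdiff k (\<lambda>t. \<Sum>b\<in>I. c b * f b t) t\<bar> \<le> (\<Sum>b\<in>I. c b) * B * diff_weight \<alpha> k / 8"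
    by (simp add: sum_distrib_right sum_divide_distrib mult.assoc)
qed

lemma diff_bounded_cong:
  assumes "diff_bounded \<alpha> n B f" "\<And>t. t \<le> n \<Longrightarrow> f t = g t" shows "diff_bounded \<alpha> n B g"
  unfolding diff_bounded_def
proof (intro allI impI)
  fix k t assume kt: "k + t \<le> n"
  have "fdiff k f t = fdiff k g t" using kt by (intro fdiff_cong assms(2)) auto
  with diff_boundedD[OF assms(1) kt] show "\<bar>fdiff k g t\<bar> \<le> B * diff_weight \<alpha> k / 8" by simp
qed

lemma diff_bounded_uminus: "diff_bounded \<alpha> n B f \<Longrightarrow> diff_bounded \<alpha> n B (\<lambda>t. - f t)"
  using fdiff_cmult[of _ "-1" f] by (simp add: diff_bounded_def)

lemma diff_bounded_pow:
  assumes "\<alpha> > 0" "diff_bounded \<alpha> n B f" shows "diff_bounded \<alpha> n (B ^ Suc m) (\<lambda>t. f t ^ Suc m)"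
  using assms by (induction m) (auto intro: diff_bounded_mult)

text \<open>Submultiplicativity is applied term by term to the power series. The constant term is
  split off because the constant sequence 1 has norm 8, not 1; for the same reason all later factors
  are measured by their distance from 1.\<close>

lemma diff_bounded_exp:
  assumes "\<alpha> > 0" "diff_bounded \<alpha> n B f" shows "diff_bounded \<alpha> n (exp B - 1) (\<lambda>t. exp (f t) - 1)"
  unfolding diff_bounded_def
proof (intro allI impI)
  fix k t assume kt: "k + t \<le> n"
  have e: "(\<lambda>m. x ^ Suc m / fact (Suc m)) sums (exp x - 1)" for x :: real
  proof -
    have "(\<lambda>m. x ^ m / fact m) sums exp x"
      using exp_converges[of x] by (simp add: divide_inverse mult.commute)
    from sums_split_initial_segment[OF this, of 1] show ?thesis by simp
  qed
  have s: "(\<lambda>m. fdiff k (\<lambda>t. f t ^ Suc m) t / fact (Suc m)) sums fdiff k (\<lambda>t. exp (f t) - 1) t"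
  proof (induction k arbitrary: t)
    case 0 show ?case using e[of "f t"] by simp
  next
    case (Suc k)
    from sums_diff[OF Suc[of "Suc t"] Suc[of t]] show ?case by (simp add: diff_divide_distrib)
  qed
  have b: "\<bar>fdiff k (\<lambda>t. f t ^ Suc m) t / fact (Suc m)\<bar> \<le> (B ^ Suc m / fact (Suc m)) * (diff_weight \<alpha> k / 8)" for m
    using divide_right_mono[OF diff_boundedD[OF diff_bounded_pow[OF assms, of m] kt], of "fact (Suc m)"]
    by (simp add: abs_divide mult.commute del: power_Suc fact_Suc)
  have t: "(\<lambda>m. (B ^ Suc m / fact (Suc m)) * (diff_weight \<alpha> k / 8)) sums ((exp B - 1) * (diff_weight \<alpha> k / 8))"
    by (rule sums_mult2[OF e])
  have "fdiff k (\<lambda>t. exp (f t) - 1) t \<le> (exp B - 1) * (diff_weight \<alpha> k / 8)"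
    by (rule sums_le[OF _ s t]) (use b in \<open>simp only: abs_le_iff\<close>)
  moreover have "- fdiff k (\<lambda>t. exp (f t) - 1) t \<le> (exp B - 1) * (diff_weight \<alpha> k / 8)"
    by (rule sums_le[OF _ sums_minus[OF s] t]) (use b in \<open>simp only: abs_le_iff\<close>)
  ultimately show "\<bar>fdiff k (\<lambda>t. exp (f t) - 1) t\<bar> \<le> (exp B - 1) * diff_weight \<alpha> k / 8"
    by simp
qed

text \<open>Only finitely many differences are constrained, so the norm is finite and attained. This
  allows self-bounding arguments, in which a bound is improved by feeding it into an inequality for
  itself.\<close>

lemma diff_bounded_least:
  assumes "\<alpha> > 0"
  obtains b where "diff_bounded \<alpha> n b f" "\<And>c. diff_bounded \<alpha> n c f \<Longrightarrow> b \<le> c"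
proof -
  let ?S = "(\<lambda>(k, t). 8 * \<bar>fdiff k f t\<bar> / diff_weight \<alpha> k) ` {(k, t). k + t \<le> n}"
  have "finite {(k, t). k + t \<le> n}"
    by (rule finite_subset[of _ "{..n} \<times> {..n}"]) auto
  then have fin: "finite ?S" by simp
  have ne: "?S \<noteq> {}" by (auto intro!: exI[of _ 0])
  show thesis
  proof (rule that[of "Max ?S"])
    show "diff_bounded \<alpha> n (Max ?S) f" unfolding diff_bounded_def
    proof (intro allI impI)
      fix k t assume "k + t \<le> n"
      then have "8 * \<bar>fdiff k f t\<bar> / diff_weight \<alpha> k \<le> Max ?S" using fin by (intro Max_ge) auto
      then show "\<bar>fdiff k f t\<bar> \<le> Max ?S * diff_weight \<alpha> k / 8"
        using diff_weight_pos[OF assms, of k] by (simp add: field_simps)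
    qed
    fix c assume c: "diff_bounded \<alpha> n c f"
    show "Max ?S \<le> c"
      using fin ne diff_weight_pos[OF assms] diff_boundedD[OF c] by (subst Max_le_iff) (auto simp: field_simps)
  qed
qed

lemma diff_bounded_near_one_mult:
  assumes "\<alpha> > 0" "diff_bounded \<alpha> n A (\<lambda>t. f t - 1)" "diff_bounded \<alpha> n B (\<lambda>t. g t - 1)"
  shows "diff_bounded \<alpha> n ((1 + A) * (1 + B) - 1) (\<lambda>t. f t * g t - 1)"
proof -
  have "diff_bounded \<alpha> n (A * B + (A + B)) (\<lambda>t. (f t - 1) * (g t - 1) + ((f t - 1) + (g t - 1)))"
    by (intro diff_bounded_add diff_bounded_mult assms)
  then show ?thesis by (simp add: algebra_simps)
qed

text \<open>The identity \<open>1/f - 1 = - ((f - 1) * (1/f - 1) + (f - 1))\<close> bounds the norm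
  \<open>b\<close> of the left side by \<open>B * b + B\<close>. With \<open>B \<le> 1/2\<close>
  this solves to \<open>b \<le> 2 * B\<close>, without a Neumann series.\<close>

lemma diff_bounded_near_one_inverse:
  assumes "\<alpha> > 0" "diff_bounded \<alpha> n B (\<lambda>t. f t - 1)" "B \<le> 1/2" "\<And>t. f t \<noteq> 0"
  shows "diff_bounded \<alpha> n (2 * B) (\<lambda>t. 1 / f t - 1)"
proof -
  obtain b where b: "diff_bounded \<alpha> n b (\<lambda>t. 1 / f t - 1)" "\<And>c. diff_bounded \<alpha> n c (\<lambda>t. 1 / f t - 1) \<Longrightarrow> b \<le> c"
    using diff_bounded_least[OF assms(1)] by blast
  have "diff_bounded \<alpha> n (B * b + B) (\<lambda>t. - ((f t - 1) * (1 / f t - 1) + (f t - 1)))"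
    by (intro diff_bounded_uminus diff_bounded_add diff_bounded_mult assms b)
  then have "diff_bounded \<alpha> n (B * b + B) (\<lambda>t. 1 / f t - 1)"
    by (rule diff_bounded_cong) (use assms(4) in \<open>simp add: field_simps\<close>)
  then have "b \<le> B * b + B" by (rule b(2))
  also have "B * b \<le> 1/2 * b"
    using diff_bounded_nonneg[OF b(1)] by (intro mult_right_mono assms) auto
  finally have "b \<le> 2 * B" by simp
  then show ?thesis using diff_bounded_mono[OF assms(1) b(1)] by blast
qed

lemma diff_bounded_near_one_prod:
  assumes "\<alpha> > 0" "finite I" "\<And>k. k \<in> I \<Longrightarrow> diff_bounded \<alpha> n B (\<lambda>t. f k t - 1)" "0 \<le> B"
  shows "diff_bounded \<alpha> n ((1 + B) ^ card I - 1) (\<lambda>t. (\<Prod>k\<in>I. f k t) - 1)"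
  using assms(2,3)
proof (induction I)
  case empty
  show ?case by (simp add: diff_bounded_def fdiff_const)
next
  case (insert i I)
  have "diff_bounded \<alpha> n ((1 + B) * (1 + ((1 + B) ^ card I - 1)) - 1) (\<lambda>t. f i t * (\<Prod>k\<in>I. f k t) - 1)"
    by (intro diff_bounded_near_one_mult assms insert) (use insert in auto)
  then show ?case using insert by simp
qed

text \<open>The price of one order: a difference of the potentials is \<eta> times differences of
  utilities one order lower, and this converts their weight. The 4 bounds the squared ratio of
  \<open>k + 2\<close> to \<open>k + 1\<close>.\<close>

lemma diff_weight_step: "\<alpha> > 0 \<Longrightarrow> diff_weight \<alpha> k \<le> 4 / \<alpha> * diff_weight \<alpha> (Suc k)"
proof -
  assume a: "\<alpha> > 0"
  have "4 / \<alpha> * diff_weight \<alpha> (Suc k) = fact k * \<alpha> ^ k * (4 * (real k + 1) / (real k + 2)^2)"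
    using a by (simp add: diff_weight_def field_simps)
  moreover have "1 / (real k + 1)^2 \<le> 4 * (real k + 1) / (real k + 2)^2"
  proof -
    have "(real k + 2)^2 \<le> 4 * (real k + 1)^2"
      using power_mono[of "real k + 2" "2 * (real k + 1)" 2] by (simp only: power_mult_distrib) simp
    also have "\<dots> \<le> 4 * (real k + 1)^2 * (real k + 1)" by (simp add: mult_le_cancel_left1)
    finally have "4 * (real k + 1) / (4 * (real k + 1)^2 * (real k + 1)) \<le> 4 * (real k + 1) / (real k + 2)^2"
      by (intro divide_left_mono) auto
    moreover have "4 * (real k + 1) / (4 * (real k + 1)^2 * (real k + 1)) = 1 / (real k + 1)^2"
      by (simp add: divide_simps)
    ultimately show ?thesis by simp
  qed
  ultimately show "diff_weight \<alpha> k \<le> 4 / \<alpha> * diff_weight \<alpha> (Suc k)"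
    using mult_left_mono[of "1 / (real k + 1)^2" "4 * (real k + 1) / (real k + 2)^2" "fact k * \<alpha> ^ k"] a
    unfolding diff_weight_def by simp
qed

text \<open>Up to order \<open>K\<close> the factorial growth is dominated by a geometric one, since
  \<open>k!\<close> is at most \<open>K ^ k\<close>. The energy argument needs this geometric form
  with a small ratio.\<close>

lemma diff_weight_le_power:
  assumes "\<alpha> > 0" "k \<le> K" shows "diff_weight \<alpha> k \<le> (\<alpha> * real K) ^ k"
proof -
  have "fact k \<le> real K ^ k"
    using fact_le_power[of k, where 'a = real] power_mono[of "real k" "real K" k] assms(2) by simp
  moreover have "diff_weight \<alpha> k \<le> fact k * \<alpha> ^ k"
    unfolding diff_weight_def using assms(1) divide_left_mono[of 1 "(real k + 1)^2" "fact k * \<alpha> ^ k"] by simp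
  moreover have "fact k * \<alpha> ^ k \<le> real K ^ k * \<alpha> ^ k"
    using calculation(1) assms(1) by (intro mult_right_mono) auto
  ultimately show ?thesis by (simp add: power_mult_distrib mult.commute)
qed

section \<open>Log-convexity of difference energies\<close>

lemma weighted_Cauchy_Schwarz:
  fixes w f g :: "'i \<Rightarrow> real"
  assumes "\<And>i. i \<in> I \<Longrightarrow> 0 \<le> w i"
  shows "(\<Sum>i\<in>I. w i * \<bar>f i * g i\<bar>) \<le> sqrt (\<Sum>i\<in>I. w i * (f i)^2) * sqrt (\<Sum>i\<in>I. w i * (g i)^2)"
proof -
  have "(\<Sum>i\<in>I. w i * \<bar>f i * g i\<bar>) = (\<Sum>i\<in>I. \<bar>sqrt (w i) * f i\<bar> * \<bar>sqrt (w i) * g i\<bar>)"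
    using assms by (intro sum.cong) (auto simp: abs_mult)
  also have "\<dots> \<le> L2_set (\<lambda>i. sqrt (w i) * f i) I * L2_set (\<lambda>i. sqrt (w i) * g i) I"
    by (rule L2_set_mult_ineq)
  also have "\<dots> = sqrt (\<Sum>i\<in>I. w i * (f i)^2) * sqrt (\<Sum>i\<in>I. w i * (g i)^2)"
    unfolding L2_set_def power_mult_distrib using assms by simp
  finally show ?thesis .
qed

text \<open>Summation by parts. With primes for time \<open>Suc t\<close>,
  \<open>\<omega> v^2\<close> equals the increment of \<open>\<omega> v u\<close> minus
  \<open>(\<omega>' - \<omega>) v' u'\<close> minus \<open>\<omega> w u'\<close>. The increments
  telescope to the boundary term \<open>2 * b * b'\<close>; Cauchy-Schwarz handles the other two,
  the first of them being small because the weights drift slowly.\<close>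

lemma sum_square_increments_le:
  fixes \<omega> :: "nat \<Rightarrow> 'p \<Rightarrow> real" and u v w :: "'p \<Rightarrow> nat \<Rightarrow> real"
  assumes se: "s \<le> e" and \<zeta>: "0 \<le> \<zeta>"
    and v: "\<And>p t. v p t = u p (Suc t) - u p t" and w: "\<And>p t. w p t = v p (Suc t) - v p t"
    and nn: "\<And>t p. p \<in> P \<Longrightarrow> 0 \<le> \<omega> t p"
    and drift: "\<And>t p. s \<le> t \<Longrightarrow> t < e \<Longrightarrow> p \<in> P \<Longrightarrow> \<bar>\<omega> (Suc t) p - \<omega> t p\<bar> \<le> \<zeta> * \<omega> (Suc t) p"
    and tot: "\<And>t. s \<le> t \<Longrightarrow> t \<le> e \<Longrightarrow> (\<Sum>p\<in>P. \<omega> t p) = 1"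
    and bu: "\<And>p t. p \<in> P \<Longrightarrow> s \<le> t \<Longrightarrow> t \<le> e \<Longrightarrow> \<bar>u p t\<bar> \<le> b"
    and bv: "\<And>p t. p \<in> P \<Longrightarrow> s \<le> t \<Longrightarrow> t \<le> e \<Longrightarrow> \<bar>v p t\<bar> \<le> b'"
    and b0: "0 \<le> b" "0 \<le> b'"
  defines "E \<equiv> \<lambda>f. \<Sum>t=s..<e. \<Sum>p\<in>P. \<omega> t p * (f p t)^2"
  shows "E v \<le> 2 * b * b' + \<zeta> * (sqrt (E v + b'^2) * sqrt (E u + b^2))
      + (1 + \<zeta>) * (sqrt (E w) * sqrt (E u + b^2))"
proof -
  define S :: "(nat \<Rightarrow> 'p \<Rightarrow> real) \<Rightarrow> real" where "S = (\<lambda>f. \<Sum>t=s..<e. \<Sum>p\<in>P. f t p)"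
  have S_mono: "S f \<le> S g" if "\<And>t p. s \<le> t \<Longrightarrow> t < e \<Longrightarrow> p \<in> P \<Longrightarrow> f t p \<le> g t p" for f g
    unfolding S_def using that by (intro sum_mono) auto
  have CS: "S (\<lambda>t p. c t p * \<bar>f t p * g t p\<bar>)
      \<le> sqrt (S (\<lambda>t p. c t p * (f t p)^2)) * sqrt (S (\<lambda>t p. c t p * (g t p)^2))"
    if "\<And>t p. p \<in> P \<Longrightarrow> 0 \<le> c t p" for c f g
    unfolding S_def sum.cartesian_product
    using weighted_Cauchy_Schwarz[of "{s..<e} \<times> P" "\<lambda>(t, p). c t p" "\<lambda>(t, p). f t p" "\<lambda>(t, p). g t p"] that
    by (simp add: case_prod_unfold) fastforce
  have bnd: "\<bar>\<Sum>p\<in>P. \<omega> t p * (f p * g p)\<bar> \<le> c * c'"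
    if t: "s \<le> t" "t \<le> e" and f: "\<And>p. p \<in> P \<Longrightarrow> \<bar>f p\<bar> \<le> c" and g: "\<And>p. p \<in> P \<Longrightarrow> \<bar>g p\<bar> \<le> c'"
      and c: "0 \<le> c" "0 \<le> c'" for t f g c c'
  proof -
    have "\<bar>\<Sum>p\<in>P. \<omega> t p * (f p * g p)\<bar> \<le> (\<Sum>p\<in>P. \<omega> t p * (c * c'))"
      by (rule order_trans[OF sum_abs], rule sum_mono)
         (auto simp: abs_mult nn intro!: mult_left_mono mult_mono f g c)
    then show ?thesis using tot[OF t] by (simp flip: sum_distrib_right)
  qed
  \<comment> \<open>Moving the time window by one step gains only the last term, at most
    \<open>c^2\<close>; the first term, which is lost, is nonnegative.\<close>
  have shift: "S (\<lambda>t p. \<omega> (Suc t) p * (f p (Suc t))^2) \<le> E f + c^2"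
    if f: "\<And>p t. p \<in> P \<Longrightarrow> s \<le> t \<Longrightarrow> t \<le> e \<Longrightarrow> \<bar>f p t\<bar> \<le> c" and c: "0 \<le> c" for f c
  proof -
    define F where "F = (\<lambda>t. \<Sum>p\<in>P. \<omega> t p * (f p t)^2)"
    have "S (\<lambda>t p. \<omega> (Suc t) p * (f p (Suc t))^2) - E f = (\<Sum>t=s..<e. F (Suc t) - F t)"
      unfolding S_def E_def F_def by (simp add: sum_subtractf)
    also have "\<dots> = F e - F s" by (rule sum_Suc_diff'[OF se])
    also have "\<dots> \<le> F e" unfolding F_def using nn by (simp add: sum_nonneg)
    also have "F e \<le> c * c"
      using bnd[of e "\<lambda>p. f p e" c "\<lambda>p. f p e" c] se f c by (simp add: F_def power2_eq_square)
    finally show ?thesis by (simp add: power2_eq_square)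
  qed
  define F where "F = (\<lambda>t. \<Sum>p\<in>P. \<omega> t p * (v p t * u p t))"
  have "E v = (\<Sum>t=s..<e. F (Suc t) - F t) - S (\<lambda>t p. (\<omega> (Suc t) p - \<omega> t p) * (v p (Suc t) * u p (Suc t)))
      - S (\<lambda>t p. \<omega> t p * (w p t * u p (Suc t)))"
    unfolding E_def S_def F_def sum_subtractf[symmetric]
    by (intro sum.cong refl) (simp add: v w power2_eq_square algebra_simps)
  also have "(\<Sum>t=s..<e. F (Suc t) - F t) = F e - F s" by (rule sum_Suc_diff'[OF se])
  also have "F e - F s \<le> 2 * b * b'"
  proof -
    have "\<bar>F t\<bar> \<le> b' * b" if "t \<in> {s, e}" for t
      unfolding F_def using that se b0 by (intro bnd bu bv) auto
    from this[of s] this[of e] have "F e - F s \<le> 2 * (b' * b)" by simp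
    then show ?thesis by (simp add: mult.commute mult.left_commute)
  qed
  finally have 1: "E v \<le> 2 * b * b' - S (\<lambda>t p. (\<omega> (Suc t) p - \<omega> t p) * (v p (Suc t) * u p (Suc t)))
      - S (\<lambda>t p. \<omega> t p * (w p t * u p (Suc t)))" by simp
  have "- S (\<lambda>t p. (\<omega> (Suc t) p - \<omega> t p) * (v p (Suc t) * u p (Suc t)))
      = S (\<lambda>t p. - ((\<omega> (Suc t) p - \<omega> t p) * (v p (Suc t) * u p (Suc t))))"
    by (simp add: S_def sum_negf)
  also have "\<dots> \<le> S (\<lambda>t p. \<zeta> * (\<omega> (Suc t) p * \<bar>v p (Suc t) * u p (Suc t)\<bar>))"
  proof (rule S_mono)
    fix t p assume tp: "s \<le> t" "t < e" "p \<in> P"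
    have "- ((\<omega> (Suc t) p - \<omega> t p) * (v p (Suc t) * u p (Suc t)))
       \<le> \<bar>\<omega> (Suc t) p - \<omega> t p\<bar> * \<bar>v p (Suc t) * u p (Suc t)\<bar>"
      by (metis abs_ge_minus_self abs_mult)
    also have "\<dots> \<le> \<zeta> * \<omega> (Suc t) p * \<bar>v p (Suc t) * u p (Suc t)\<bar>"
      by (rule mult_right_mono[OF drift[OF tp]]) simp
    finally show "- ((\<omega> (Suc t) p - \<omega> t p) * (v p (Suc t) * u p (Suc t)))
       \<le> \<zeta> * (\<omega> (Suc t) p * \<bar>v p (Suc t) * u p (Suc t)\<bar>)" by simp
  qed
  also have "\<dots> = \<zeta> * S (\<lambda>t p. \<omega> (Suc t) p * \<bar>v p (Suc t) * u p (Suc t)\<bar>)"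
    by (simp add: S_def sum_distrib_left)
  also have "\<dots> \<le> \<zeta> * (sqrt (S (\<lambda>t p. \<omega> (Suc t) p * (v p (Suc t))^2)) * sqrt (S (\<lambda>t p. \<omega> (Suc t) p * (u p (Suc t))^2)))"
    by (intro mult_left_mono \<zeta> CS nn)
  also have "\<dots> \<le> \<zeta> * (sqrt (E v + b'^2) * sqrt (E u + b^2))"
    using nn by (intro mult_left_mono \<zeta> mult_mono real_sqrt_le_mono shift bu bv b0)
      (auto simp: S_def sum_nonneg E_def intro!: add_nonneg_nonneg sum_nonneg)
  finally have 2: "- S (\<lambda>t p. (\<omega> (Suc t) p - \<omega> t p) * (v p (Suc t) * u p (Suc t)))
    \<le> \<zeta> * (sqrt (E v + b'^2) * sqrt (E u + b^2))" .
  have Ew0: "0 \<le> E w" unfolding E_def using nn by (auto intro!: sum_nonneg)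
  have "S (\<lambda>t p. \<omega> t p * (u p (Suc t))^2) \<le> S (\<lambda>t p. (1 + \<zeta>) * (\<omega> (Suc t) p * (u p (Suc t))^2))"
  proof (rule S_mono)
    fix t p assume tp: "s \<le> t" "t < e" "p \<in> P"
    have "\<omega> t p \<le> (1 + \<zeta>) * \<omega> (Suc t) p" using drift[OF tp] by (simp add: algebra_simps)
    from mult_right_mono[OF this, of "(u p (Suc t))^2"]
    show "\<omega> t p * (u p (Suc t))^2 \<le> (1 + \<zeta>) * (\<omega> (Suc t) p * (u p (Suc t))^2)"
      by (simp add: mult.assoc)
  qed
  also have "\<dots> = (1 + \<zeta>) * S (\<lambda>t p. \<omega> (Suc t) p * (u p (Suc t))^2)"
    by (simp add: S_def sum_distrib_left)
  also have "\<dots> \<le> (1 + \<zeta>) * (E u + b^2)"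
    using \<zeta> by (intro mult_left_mono shift bu b0) auto
  \<comment> \<open>Rounding up to a square lets the factor leave the square root below.\<close>
  also have "\<dots> \<le> (1 + \<zeta>)^2 * (E u + b^2)"
    using \<zeta> nn by (intro mult_right_mono)
      (auto simp: E_def power2_eq_square mult_le_cancel_left1 intro!: add_nonneg_nonneg sum_nonneg)
  finally have "sqrt (S (\<lambda>t p. \<omega> t p * (u p (Suc t))^2)) \<le> sqrt ((1 + \<zeta>)^2 * (E u + b^2))"
    by (rule real_sqrt_le_mono)
  also have "\<dots> = (1 + \<zeta>) * sqrt (E u + b^2)" using \<zeta> by (simp add: real_sqrt_mult)
  finally have su: "sqrt (S (\<lambda>t p. \<omega> t p * (u p (Suc t))^2)) \<le> (1 + \<zeta>) * sqrt (E u + b^2)" .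
  have "- S (\<lambda>t p. \<omega> t p * (w p t * u p (Suc t))) = S (\<lambda>t p. - (\<omega> t p * (w p t * u p (Suc t))))"
    by (simp add: S_def sum_negf)
  also have "\<dots> \<le> S (\<lambda>t p. \<omega> t p * \<bar>w p t * u p (Suc t)\<bar>)"
    by (rule S_mono) (metis abs_ge_minus_self abs_mult abs_of_nonneg nn)
  also have "\<dots> \<le> sqrt (E w) * sqrt (S (\<lambda>t p. \<omega> t p * (u p (Suc t))^2))"
    using CS[of \<omega> "\<lambda>t p. w p t" "\<lambda>t p. u p (Suc t)"] nn by (simp add: S_def E_def)
  also have "\<dots> \<le> sqrt (E w) * ((1 + \<zeta>) * sqrt (E u + b^2))"
    by (intro mult_left_mono su) (use Ew0 in simp)
  finally have 3: "- S (\<lambda>t p. \<omega> t p * (w p t * u p (Suc t))) \<le> (1 + \<zeta>) * (sqrt (E w) * sqrt (E u + b^2))"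
    by (simp add: ac_simps)
  show ?thesis using 1 2 3 by linarith
qed

text \<open>Dividing \<open>rec\<close> by \<open>a k * a (Suc k)\<close> shows that consecutive
  ratios drop by at most \<open>6 * \<zeta>\<close>. They start at 1/2 or more, and
  \<open>24 * K * \<zeta> \<le> 1\<close> limits the total loss over \<open>K\<close> orders to 1/4,
  so no ratio falls below 1/4.\<close>

lemma log_convex_ratio:
  fixes a :: "nat \<Rightarrow> real"
  assumes pos: "\<And>k. 0 < a k" and \<zeta>: "0 \<le> \<zeta>" "24 * real K * \<zeta> \<le> 1"
    and rec: "\<And>k. k + 2 \<le> K \<Longrightarrow> (a (Suc k))^2 \<le> 3 * \<zeta> * (a k * a (Suc k)) + (1 + 3 * \<zeta>) * (a k * a (k + 2))"
    and half: "a 0 / 2 \<le> a 1"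
  shows "(1 / 4) ^ K * a 0 \<le> a K"
proof -
  have r: "1 / 2 - 6 * real k * \<zeta> \<le> a (Suc k) / a k" if "Suc k \<le> K" for k
    using that
  proof (induction k)
    case 0
    show ?case using half pos[of 0] by (simp add: field_simps)
  next
    case (Suc k)
    define r r' where "r = a (Suc k) / a k" and "r' = a (k + 2) / a (Suc k)"
    have IH: "1 / 2 - 6 * real k * \<zeta> \<le> r" using Suc by (simp add: r_def)
    have "(a (Suc k))^2 / (a k * a (Suc k)) \<le> (3 * \<zeta> * (a k * a (Suc k)) + (1 + 3 * \<zeta>) * (a k * a (k + 2))) / (a k * a (Suc k))"
      using Suc pos[of k] pos[of "Suc k"] by (intro divide_right_mono rec) auto
    also have "\<dots> = 3 * \<zeta> + (1 + 3 * \<zeta>) * r'"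
      using pos[of k] pos[of "Suc k"] by (simp add: r'_def field_simps)
    also have "(a (Suc k))^2 / (a k * a (Suc k)) = r"
      using pos[of k] pos[of "Suc k"] by (simp add: r_def power2_eq_square)
    finally have main: "r \<le> 3 * \<zeta> + (1 + 3 * \<zeta>) * r'" .
    show ?case
    proof (rule ccontr)
      assume "\<not> 1 / 2 - 6 * real (Suc k) * \<zeta> \<le> a (Suc (Suc k)) / a (Suc k)"
      then have lt: "r' < 1 / 2 - 6 * real (Suc k) * \<zeta>" by (simp add: r'_def)
      have "0 \<le> real (Suc k) * \<zeta>" using \<zeta> by simp
      \<comment> \<open>Only a small \<open>r'\<close> has to be excluded, so
        \<open>r' \<le> 1\<close> is available and turns \<open>(1 + 3 * \<zeta>) * r'\<close> into
        at most \<open>r' + 3 * \<zeta>\<close>.\<close>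
      then have "r' \<le> 1" using lt unfolding mult.assoc by linarith
      then have "\<zeta> * r' \<le> \<zeta>" using \<zeta> by (simp add: mult_left_le)
      then show False using main IH lt by (simp add: algebra_simps)
    qed
  qed
  have "(1 / 4) ^ k * a 0 \<le> a k" if "k \<le> K" for k
    using that
  proof (induction k)
    case (Suc k)
    have "real k * \<zeta> \<le> real K * \<zeta>" using Suc.prems \<zeta> by (intro mult_right_mono) auto
    then have "1 / 4 \<le> a (Suc k) / a k" using r[OF Suc.prems] \<zeta> by linarith
    then have "1 / 4 * a k \<le> a (Suc k)" using pos[of k] by (simp add: field_simps)
    moreover have "(1 / 4) ^ k * a 0 \<le> a k" using Suc by simp
    ultimately show ?case by simp
  qed simp
  then show ?thesis by simp
qed

text \<open>If the bound failed, \<open>log_convex_ratio\<close> would keep the regularized energy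
  of order \<open>K\<close> above \<open>(1/16)^K\<close> times that of order 0. The difference
  bounds give at most \<open>e^K * 4 * (1/64)^K \<le> 4 * (1/16)^K\<close> for the energy itself,
  and the regularizer \<open>(g K)^2\<close> has decayed too; together they are too small. The
  additive 576 is \<open>(48)^2 / 4\<close>, left over from \<open>(g 0)^2 / 4\<close>.\<close>

lemma increment_energy_le:
  fixes \<omega> :: "nat \<Rightarrow> 'p \<Rightarrow> real" and z :: "'p \<Rightarrow> nat \<Rightarrow> real"
  assumes se: "s \<le> e" and K: "1 \<le> K" "real (e - s) \<le> exp (real K)" and \<beta>: "0 \<le> \<beta>" "\<beta> \<le> 1 / 8"
    and nn: "\<And>t p. p \<in> P \<Longrightarrow> 0 \<le> \<omega> t p"
    and drift: "\<And>t p. s \<le> t \<Longrightarrow> t < e \<Longrightarrow> p \<in> P \<Longrightarrow> \<bar>\<omega> (Suc t) p - \<omega> t p\<bar> \<le> 1 / (24 * real K) * \<omega> (Suc t) p"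
    and tot: "\<And>t. s \<le> t \<Longrightarrow> t \<le> e \<Longrightarrow> (\<Sum>p\<in>P. \<omega> t p) = 1"
    and bnd: "\<And>k p t. k \<le> K \<Longrightarrow> p \<in> P \<Longrightarrow> s \<le> t \<Longrightarrow> t \<le> e \<Longrightarrow> \<bar>fdiff k (z p) t\<bar> \<le> 2 * \<beta> ^ k"
  defines "E \<equiv> \<lambda>k. \<Sum>t=s..<e. \<Sum>p\<in>P. \<omega> t p * (fdiff k (z p) t)^2"
  shows "E 1 \<le> E 0 / 4 + 576 * (real K)^2"
proof -
  define \<zeta> where "\<zeta> = 1 / (24 * real K)"
  \<comment> \<open>The regularizer makes \<open>a\<close> positive and absorbs boundary terms:
    \<open>\<zeta> * g k = 2 * (1/8)^k\<close> is at least \<open>b k\<close>. Being geometric, it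
    satisfies \<open>g k * g (k + 2) = (g (Suc k))^2\<close>, so adding its square to the energies
    does not spoil log-convexity.\<close>
  define g where "g = (\<lambda>k::nat. 48 * real K * (1 / 8) ^ k)"
  define b where "b = (\<lambda>k. 2 * \<beta> ^ k)"
  define a where "a = (\<lambda>k. sqrt (E k + (g k)^2))"
  have \<zeta>: "0 \<le> \<zeta>" "\<zeta> \<le> 1" "24 * real K * \<zeta> \<le> 1" using K by (auto simp: \<zeta>_def)
  have g: "g k > 0" for k using K by (simp add: g_def)
  have E0: "0 \<le> E k" for k unfolding E_def using nn by (auto intro!: sum_nonneg)
  have b0: "0 \<le> b k" for k using \<beta> by (simp add: b_def)
  have b\<zeta>: "b k \<le> \<zeta> * g k" for k
    using power_mono[OF \<beta>(2,1), of k] K by (simp add: b_def g_def \<zeta>_def)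
  have bg: "b k \<le> g k" for k
    using b\<zeta>[of k] mult_right_mono[OF \<zeta>(2) less_imp_le[OF g[of k]]] by simp
  have apos: "a k > 0" for k unfolding a_def using E0[of k] g[of k] by (simp add: add_nonneg_pos)
  have asq: "(a k)^2 = E k + (g k)^2" for k unfolding a_def using E0[of k] by simp
  have ga: "g k \<le> a k" for k unfolding a_def using E0[of k] by (simp add: real_le_rsqrt)
  have Ea: "sqrt (E k) \<le> a k" for k unfolding a_def by simp
  have ba: "sqrt (E k + (b k)^2) \<le> a k" for k unfolding a_def
    using power_mono[OF bg b0] by simp
  have rec: "(a (Suc k))^2 \<le> 3 * \<zeta> * (a k * a (Suc k)) + (1 + 3 * \<zeta>) * (a k * a (k + 2))"
    if k: "k + 2 \<le> K" for k
  proof -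
    have main: "E (Suc k) \<le> 2 * b k * b (Suc k)
        + \<zeta> * (sqrt (E (Suc k) + (b (Suc k))^2) * sqrt (E k + (b k)^2))
        + (1 + \<zeta>) * (sqrt (E (k + 2)) * sqrt (E k + (b k)^2))"
      unfolding E_def
    proof (rule sum_square_increments_le[where u = "\<lambda>p. fdiff k (z p)" and v = "\<lambda>p. fdiff (Suc k) (z p)"
          and w = "\<lambda>p. fdiff (k + 2) (z p)", OF se \<zeta>(1) _ _ nn _ tot _ _ b0 b0])
      show "\<bar>fdiff k (z p) t\<bar> \<le> b k" "\<bar>fdiff (Suc k) (z p) t\<bar> \<le> b (Suc k)"
        if "p \<in> P" "s \<le> t" "t \<le> e" for p t
        using bnd[of k p t] bnd[of "Suc k" p t] that k unfolding b_def by auto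
    qed (use drift in \<open>auto simp: \<zeta>_def\<close>)
    have t1: "2 * b k * b (Suc k) \<le> 2 * (\<zeta> * a k) * a (Suc k)"
      using b\<zeta>[of k] mult_left_mono[OF ga[of k] \<zeta>(1)] bg[of "Suc k"] ga[of "Suc k"] b0 \<zeta> apos[of k]
      by (intro mult_mono) auto
    have t2: "\<zeta> * (sqrt (E (Suc k) + (b (Suc k))^2) * sqrt (E k + (b k)^2)) \<le> \<zeta> * (a (Suc k) * a k)"
      using E0 apos[of "Suc k"] by (intro mult_left_mono mult_mono ba \<zeta>) auto
    have "sqrt (E (k + 2)) * sqrt (E k + (b k)^2) \<le> sqrt (E (k + 2)) * (sqrt (E k) + b k)"
    proof (rule mult_left_mono)
      show "sqrt (E k + (b k)^2) \<le> sqrt (E k) + b k"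
        using E0[of k] b0[of k] by (intro real_le_lsqrt) (auto simp: power2_sum)
    qed (use E0 in simp)
    \<comment> \<open>Adding and subtracting \<open>g k * g (k + 2) = (g (Suc k))^2\<close> prepares
      a two-dimensional Cauchy-Schwarz inequality for the vectors of \<open>sqrt E\<close> and
      \<open>g\<close>. The subtracted square later completes \<open>E (Suc k)\<close> to
      \<open>(a (Suc k))^2\<close>.\<close>
    also have "\<dots> = (sqrt (E (k + 2)) * sqrt (E k) + g k * g (k + 2)) + sqrt (E (k + 2)) * b k - (g (Suc k))^2"
      by (simp add: g_def algebra_simps power2_eq_square)
    also have "sqrt (E (k + 2)) * sqrt (E k) + g k * g (k + 2) \<le> a k * a (k + 2)"
    proof -
      have "(sqrt (E (k + 2)) * sqrt (E k) + g k * g (k + 2))^2 \<le> (a k)^2 * (a (k + 2))^2"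
      proof -
        have "(d * c + x * y)^2 \<le> (c^2 + x^2) * (d^2 + y^2)" for c d x y :: real
          using zero_le_power2[of "c * y - d * x"] by (simp add: power2_eq_square algebra_simps)
        from this[of "sqrt (E (k + 2))" "sqrt (E k)"] show ?thesis using E0 by (simp add: asq)
      qed
      then show ?thesis
        using apos[of k] apos[of "k + 2"] by (simp flip: power_mult_distrib add: power_mono_iff abs_le_square_iff[symmetric])
    qed
    also have "sqrt (E (k + 2)) * b k \<le> a (k + 2) * (\<zeta> * a k)"
      using b\<zeta>[of k] mult_left_mono[OF ga[of k] \<zeta>(1)] E0 b0 apos[of "k + 2"]
      by (intro mult_mono Ea) auto
    finally have "sqrt (E (k + 2)) * sqrt (E k + (b k)^2) \<le> (1 + \<zeta>) * (a k * a (k + 2)) - (g (Suc k))^2"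
      by (simp add: algebra_simps)
    then have "(1 + \<zeta>) * (sqrt (E (k + 2)) * sqrt (E k + (b k)^2))
        \<le> (1 + \<zeta>) * ((1 + \<zeta>) * (a k * a (k + 2)) - (g (Suc k))^2)"
      using \<zeta> by (intro mult_left_mono) auto
    moreover have "2 * (\<zeta> * a k) * a (Suc k) + \<zeta> * (a (Suc k) * a k) = 3 * \<zeta> * (a k * a (Suc k))"
      by simp
    ultimately have "E (Suc k) \<le> 3 * \<zeta> * (a k * a (Suc k))
       + (1 + \<zeta>) * ((1 + \<zeta>) * (a k * a (k + 2)) - (g (Suc k))^2)"
      using main t1 t2 by linarith
    also have "\<dots> \<le> 3 * \<zeta> * (a k * a (Suc k)) + (1 + 3 * \<zeta>) * (a k * a (k + 2)) - (g (Suc k))^2"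
    proof -
      have "(1 + \<zeta>) * (1 + \<zeta>) \<le> 1 + 3 * \<zeta>" using \<zeta> mult_right_mono[OF \<zeta>(2,1)] by (simp add: algebra_simps)
      then have "(1 + \<zeta>) * (1 + \<zeta>) * (a k * a (k + 2)) \<le> (1 + 3 * \<zeta>) * (a k * a (k + 2))"
        using apos[of k] apos[of "k + 2"] by (intro mult_right_mono) auto
      moreover have "(g (Suc k))^2 \<le> (1 + \<zeta>) * (g (Suc k))^2" using \<zeta> by (simp add: mult_le_cancel_right1)
      ultimately show ?thesis by (simp add: right_diff_distrib mult.assoc)
    qed
    finally show ?thesis by (simp add: asq)
  qed
  have g02: "(g 0)^2 = 2304 * (real K)^2" by (simp add: g_def power_mult_distrib)
  have "a 1 \<le> a 0 / 2"
  proof (rule ccontr)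
    assume "\<not> a 1 \<le> a 0 / 2"
    then have "(1 / 4) ^ K * a 0 \<le> a K"
      by (intro log_convex_ratio[OF apos \<zeta>(1,3) rec]) auto
    then have "((1 / 4) ^ K * a 0)^2 \<le> (a K)^2"
      using apos[of 0] by (intro power_mono) auto
    then have 1: "(1 / 16) ^ K * (E 0 + (g 0)^2) \<le> E K + (g K)^2"
      by (simp add: power_mult_distrib asq power_even_eq[symmetric] power_mult[symmetric] mult.commute[of K])
         (simp add: power_mult power2_eq_square)
    have "E K \<le> (\<Sum>t=s..<e. \<Sum>p\<in>P. \<omega> t p * (2 * \<beta> ^ K)^2)"
      unfolding E_def using nn \<beta> by (intro sum_mono mult_left_mono power2_le_iff_abs_le[THEN iffD2] bnd) auto
    also have "\<dots> = real (e - s) * (2 * \<beta> ^ K)^2"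
      using tot by (simp flip: sum_distrib_right)
    also have "\<dots> \<le> 4 ^ K * (4 * (1 / 64) ^ K)"
    proof (rule mult_mono)
      have "exp (real K) = exp 1 ^ K" by (simp flip: exp_of_nat_mult)
      also have "\<dots> \<le> 4 ^ K" using exp_le by (intro power_mono) auto
      finally show "real (e - s) \<le> 4 ^ K" using K(2) by linarith
      have "(2 * \<beta> ^ K)^2 = 4 * (\<beta>^2) ^ K" by (simp add: power_mult_distrib power_mult[symmetric] mult.commute)
      also have "\<beta>^2 \<le> (1 / 8)^2" using \<beta> by (intro power_mono)
      then have "4 * (\<beta>^2) ^ K \<le> 4 * (1 / 64) ^ K" by (intro mult_left_mono power_mono) (auto simp: power2_eq_square)
      finally show "(2 * \<beta> ^ K)^2 \<le> 4 * (1 / 64) ^ K" .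
    qed auto
    also have "\<dots> = 4 * (1 / 16) ^ K" by (simp flip: power_mult_distrib)
    finally have 2: "E K \<le> 4 * (1 / 16) ^ K" .
    have "(g K)^2 = (g 0)^2 * (1 / 64) ^ K"
      by (simp add: g_def power_mult_distrib power_mult[symmetric] mult.commute[of K]) (simp add: power_mult power2_eq_square)
    also have "(1 / 64 :: real) ^ K = (1 / 16) ^ K * (1 / 4) ^ K" by (simp flip: power_mult_distrib)
    also have "(1 / 4 :: real) ^ K \<le> (1 / 4) ^ 1" using K by (intro power_decreasing) auto
    then have "(g 0)^2 * ((1 / 16) ^ K * (1 / 4) ^ K) \<le> (g 0)^2 * ((1 / 16) ^ K * (1 / 4))"
      by (intro mult_left_mono) auto
    finally have 3: "(g K)^2 \<le> (1 / 16) ^ K * ((g 0)^2 / 4)" by (simp add: mult.commute)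
    have "(1 / 16) ^ K * (g 0)^2 \<le> (1 / 16) ^ K * (E 0 + (g 0)^2)"
      using E0[of 0] by (intro mult_left_mono) auto
    then have "(1 / 16 :: real) ^ K * (g 0)^2 \<le> (1 / 16) ^ K * (4 + (g 0)^2 / 4)"
      using 1 2 3 unfolding distrib_left by linarith
    then have "(g 0)^2 \<le> 4 + (g 0)^2 / 4" by simp
    moreover have "(1::real) \<le> (real K)^2" using K by simp
    ultimately show False unfolding g02 by linarith
  qed
  then have "(a 1)^2 \<le> (a 0 / 2)^2" using apos[of 1] by (intro power_mono) auto
  then have 1: "E 1 + (g 1)^2 \<le> (E 0 + (g 0)^2) / 4" by (simp add: power_divide asq)
  have "E 1 \<le> E 1 + (g 1)^2" by simp
  also note 1
  also have "(E 0 + (g 0)^2) / 4 = E 0 / 4 + 576 * (real K)^2" unfolding g02 by simp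
  finally show ?thesis .
qed

section \<open>Exponential moments and regret of optimistic FTRL\<close>

text \<open>The Taylor remainder is \<open>exp t / 2 * y^2\<close> with \<open>t\<close> between
  -1/4 and 1/4, and there \<open>exp t\<close> lies between 3/4 and 2.\<close>

lemma exp_quadratic_bounds:
  fixes y :: real
  assumes "\<bar>y\<bar> \<le> 1 / 4"
  shows "exp y \<le> 1 + y + y^2" "1 + y + 3 / 8 * y^2 \<le> exp y"
proof -
  obtain t where t: "\<bar>t\<bar> \<le> \<bar>y\<bar>" "exp y = (\<Sum>m<2. y ^ m / fact m) + exp t / fact 2 * y ^ 2"
    using Maclaurin_exp_le by blast
  have e: "exp y = 1 + y + exp t / 2 * y^2" using t(2) by (simp add: numeral_2_eq_2)
  have "exp t \<le> exp 1" using t(1) assms by simp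
  have "3 / 4 \<le> exp t" using exp_ge_add_one_self[of t] t(1) assms by linarith
  moreover have "exp t \<le> 2"
  proof -
    have "3 / 4 \<le> exp (- t)" using exp_ge_add_one_self[of "- t"] t(1) assms by linarith
    then have "3 / 4 * exp t \<le> exp (- t) * exp t" by (intro mult_right_mono) auto
    then show ?thesis by (simp flip: exp_add)
  qed
  ultimately show "exp y \<le> 1 + y + y^2" "1 + y + 3 / 8 * y^2 \<le> exp y"
    unfolding e using mult_right_mono[of "exp t / 2" 1 "y^2"] mult_right_mono[of "3/8" "exp t / 2" "y^2"] by auto
qed

section \<open>Mean and variance under a mixed strategy\<close>

definition wmean :: "nat \<Rightarrow> (nat \<Rightarrow> real) \<Rightarrow> (nat \<Rightarrow> real) \<Rightarrow> real" where
  "wmean A x f = (\<Sum>a<A. x a * f a)"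

definition wvar :: "nat \<Rightarrow> (nat \<Rightarrow> real) \<Rightarrow> (nat \<Rightarrow> real) \<Rightarrow> real" where
  "wvar A x f = (\<Sum>a<A. x a * (f a - wmean A x f)^2)"

context
  fixes A :: nat and x :: "nat \<Rightarrow> real"
  assumes x0: "\<And>a. a < A \<Longrightarrow> 0 \<le> x a" and x1: "(\<Sum>a<A. x a) = 1"
begin

lemma wmean_bounds:
  assumes "\<And>a. a < A \<Longrightarrow> l \<le> f a" "\<And>a. a < A \<Longrightarrow> f a \<le> u"
  shows "l \<le> wmean A x f" "wmean A x f \<le> u"
proof -
  have "(\<Sum>a<A. x a * l) \<le> wmean A x f" "wmean A x f \<le> (\<Sum>a<A. x a * u)"
    unfolding wmean_def using assms x0 by (auto intro!: sum_mono mult_left_mono)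
  then show "l \<le> wmean A x f" "wmean A x f \<le> u"
    using x1 by (auto simp flip: sum_distrib_right)
qed

lemma wmean_centred: "(\<Sum>a<A. x a * (f a - wmean A x f)) = 0"
  using x1 by (simp add: right_diff_distrib sum_subtractf wmean_def[symmetric] flip: sum_distrib_right)

lemma wvar_eq: "wvar A x f = (\<Sum>a<A. x a * (f a)^2) - (wmean A x f)^2"
proof -
  have "wvar A x f = (\<Sum>a<A. x a * (f a)^2 - 2 * wmean A x f * (x a * f a) + (wmean A x f)^2 * x a)"
    unfolding wvar_def by (rule sum.cong) (auto simp: power2_eq_square algebra_simps)
  also have "\<dots> = (\<Sum>a<A. x a * (f a)^2) - 2 * wmean A x f * wmean A x f + (wmean A x f)^2 * 1"
    by (simp add: sum.distrib sum_subtractf sum_distrib_left[symmetric] x1 flip: wmean_def)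
  finally show ?thesis by (simp add: power2_eq_square)
qed

text \<open>Comparing two independently drawn actions avoids centring at the mean, which changes
  with time and would not commute with finite differences in time. In this form variances are
  energies weighted by products of strategy probabilities.\<close>

lemma wvar_pairs: "2 * wvar A x f = (\<Sum>(a, b)\<in>{..<A} \<times> {..<A}. x a * x b * (f a - f b)^2)"
proof -
  have "(\<Sum>(a, b)\<in>{..<A} \<times> {..<A}. x a * x b * (f a - f b)^2)
     = (\<Sum>a<A. \<Sum>b<A. x b * (x a * (f a)^2) + x a * (x b * (f b)^2) - 2 * ((x a * f a) * (x b * f b)))"
    unfolding sum.cartesian_product[symmetric]
    by (intro sum.cong refl) (simp add: power2_eq_square algebra_simps)
  also have "\<dots> = (\<Sum>a<A. x a * (f a)^2) + (\<Sum>a<A. x a * (f a)^2) - 2 * (wmean A x f * wmean A x f)"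
    by (simp add: sum.distrib sum_subtractf sum_distrib_left[symmetric] sum_distrib_right[symmetric] x1
        flip: wmean_def)
  finally show ?thesis by (simp add: wvar_eq power2_eq_square)
qed

lemma wvar_nonneg: "0 \<le> wvar A x f"
  unfolding wvar_def using x0 by (auto intro!: sum_nonneg)

lemma wvar_le_1:
  assumes "\<And>a. a < A \<Longrightarrow> \<bar>f a\<bar> \<le> 1" shows "wvar A x f \<le> 1"
proof -
  have "(\<Sum>a<A. x a * (f a)^2) \<le> (\<Sum>a<A. x a * 1)"
    using assms x0 by (intro sum_mono mult_left_mono) (auto simp: abs_square_le_1)
  then have "(\<Sum>a<A. x a * (f a)^2) \<le> 1" using x1 by simp
  then show ?thesis unfolding wvar_eq using zero_le_power2[of "wmean A x f"] by linarith
qed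

text \<open>After centring, the exponents are at most 1/4 in size and the linear term averages to 0,
  so only the quadratic bounds remain. The lower constant 1/4 is the energy ratio in
  \<open>increment_energy_le\<close>.\<close>

lemma log_mean_exp_bounds:
  assumes \<eta>: "0 \<le> \<eta>" "\<eta> \<le> 1 / 8" and f: "\<And>a. a < A \<Longrightarrow> \<bar>f a\<bar> \<le> 1"
  shows "ln (\<Sum>a<A. x a * exp (\<eta> * f a)) \<le> \<eta> * wmean A x f + \<eta>^2 * wvar A x f"
    and "\<eta> * wmean A x f + \<eta>^2 * wvar A x f / 4 \<le> ln (\<Sum>a<A. x a * exp (\<eta> * f a))"
proof -
  define m where "m = wmean A x f"
  define y where "y = (\<lambda>a. \<eta> * (f a - m))"
  define S where "S = (\<Sum>a<A. x a * exp (y a))"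
  have m: "\<bar>m\<bar> \<le> 1" unfolding m_def using wmean_bounds[of "-1" f 1] f by (auto simp: abs_le_iff)
  have y: "\<bar>y a\<bar> \<le> 1 / 4" if "a < A" for a
  proof -
    have "\<bar>y a\<bar> \<le> 1 / 8 * 2" unfolding y_def abs_mult
      using f[OF that] m \<eta> by (intro mult_mono) auto
    then show ?thesis by simp
  qed
  have ysum: "(\<Sum>a<A. x a * y a) = 0"
    unfolding y_def m_def using wmean_centred[of f] by (simp add: sum_distrib_left[symmetric] mult.left_commute[of _ \<eta>])
  have ysq: "(\<Sum>a<A. x a * (y a)^2) = \<eta>^2 * wvar A x f"
    unfolding y_def m_def wvar_def sum_distrib_left by (rule sum.cong) (auto simp: power_mult_distrib)
  have eq: "(\<Sum>a<A. x a * exp (\<eta> * f a)) = exp (\<eta> * m) * S"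
    unfolding S_def sum_distrib_left
    by (rule sum.cong) (auto simp: y_def exp_add[symmetric] algebra_simps)
  have "S \<le> (\<Sum>a<A. x a * (1 + y a + (y a)^2))" unfolding S_def
    using y x0 by (intro sum_mono mult_left_mono exp_quadratic_bounds) auto
  also have "\<dots> = 1 + \<eta>^2 * wvar A x f" by (simp add: distrib_left sum.distrib x1 ysum ysq)
  finally have U: "S \<le> 1 + \<eta>^2 * wvar A x f" .
  have "1 + 3 / 8 * (\<eta>^2 * wvar A x f) = (\<Sum>a<A. x a * (1 + y a + 3 / 8 * (y a)^2))"
  proof -
    have "(\<Sum>a<A. x a * (3 / 8 * (y a)^2)) = 3 / 8 * (\<eta>^2 * wvar A x f)"
      unfolding ysq[symmetric] sum_distrib_left by (rule sum.cong) auto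
    then show ?thesis by (simp add: distrib_left sum.distrib x1 ysum)
  qed
  also have "\<dots> \<le> S" unfolding S_def
    using y x0 by (intro sum_mono mult_left_mono exp_quadratic_bounds) auto
  finally have L: "1 + 3 / 8 * (\<eta>^2 * wvar A x f) \<le> S" .
  define w where "w = \<eta>^2 * wvar A x f"
  have w0: "0 \<le> w" by (simp add: w_def wvar_nonneg)
  have "\<eta>^2 * wvar A x f \<le> (1/8)^2 * 1"
    using \<eta> wvar_nonneg wvar_le_1[OF f] by (intro mult_mono power_mono) auto
  then have w1: "w \<le> 1 / 64" by (simp add: w_def power2_eq_square)
  have S: "S > 0" using L w0 unfolding w_def by linarith
  have lnS: "ln (exp (\<eta> * m) * S) = \<eta> * m + ln S" using S by (simp add: ln_mult)
  have "ln S \<le> ln (1 + w)" using U S w0 unfolding w_def by simp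
  also have "\<dots> \<le> w" using w0 by (rule ln_add_one_self_le_self)
  finally show "ln (\<Sum>a<A. x a * exp (\<eta> * f a)) \<le> \<eta> * wmean A x f + \<eta>^2 * wvar A x f"
    unfolding eq lnS by (simp add: m_def w_def)
  \<comment> \<open>There is room between 3/8 and 1/4 for the second-order loss in
    \<open>ln (1 + z) \<ge> z - z^2\<close>, because \<open>w \<le> 1/64\<close>.\<close>
  have "w / 4 \<le> 3 / 8 * w - (3 / 8 * w)^2"
    using mult_right_mono[OF w1 w0] w0 by (simp add: power2_eq_square)
  also have "\<dots> \<le> ln (1 + 3 / 8 * w)"
    using w0 w1 by (intro ln_one_plus_pos_lower_bound) auto
  also have "\<dots> \<le> ln S" using L w0 by (simp add: w_def)
  finally show "\<eta> * wmean A x f + \<eta>^2 * wvar A x f / 4 \<le> ln (\<Sum>a<A. x a * exp (\<eta> * f a))"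
    unfolding eq lnS by (simp add: m_def w_def)
qed

end

section \<open>Exponential weights: optimistic regret and the entropic maximizer\<close>

definition softmax :: "nat \<Rightarrow> (nat \<Rightarrow> real) \<Rightarrow> nat \<Rightarrow> real" where
  "softmax A c a = exp (c a) / (\<Sum>b<A. exp (c b))"

lemma sum_exp_pos: "1 \<le> (A::nat) \<Longrightarrow> 0 < (\<Sum>b<A. exp (c b :: real))"
  by (rule sum_pos) (auto simp: lessThan_empty_iff)

lemma softmax_pos: "1 \<le> A \<Longrightarrow> 0 < softmax A c a"
  by (simp add: softmax_def sum_exp_pos)

lemma softmax_sum: "1 \<le> A \<Longrightarrow> (\<Sum>a<A. softmax A c a) = 1"
  using sum_exp_pos[of A c] by (simp add: softmax_def flip: sum_divide_distrib)

lemma softmax_shift: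
  assumes "1 \<le> A"
  shows "softmax A (\<lambda>a. c a + g a) a = softmax A c a * exp (g a) / (\<Sum>b<A. softmax A c b * exp (g b))"
proof -
  have "(\<Sum>b<A. softmax A c b * exp (g b)) = (\<Sum>b<A. exp (c b + g b)) / (\<Sum>b<A. exp (c b))"
    by (simp add: softmax_def exp_add sum_divide_distrib)
  then show ?thesis
    using sum_exp_pos[OF assms, of c] by (simp add: softmax_def exp_add)
qed

text \<open>Telescoping the log-sum-exp potential splits each increment into the log-moment generating functions
  of \<open>l t - l (t - 1)\<close> and of \<open>- l (t - 1)\<close> under the played strategy.\<close>

lemma optimistic_regret_le:
  fixes l x :: "nat \<Rightarrow> nat \<Rightarrow> real"
  assumes A: "1 \<le> A" and \<eta>: "0 < \<eta>" "\<eta> \<le> 1 / 8"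
    and l: "\<And>t a. a < A \<Longrightarrow> 0 \<le> l t a" "\<And>t a. a < A \<Longrightarrow> l t a \<le> 1"
    and x: "\<And>t. 1 \<le> t \<Longrightarrow> x t = softmax A (\<lambda>a. \<eta> * ((\<Sum>s=1..<t. l s a) + l (t - 1) a))"
    and a: "a < A"
  shows "(\<Sum>t=1..n. l t a - wmean A (x t) (l t)) \<le> ln (real A) / \<eta>
    + \<eta> * (\<Sum>t=1..n. wvar A (x t) (\<lambda>a. l t a - l (t - 1) a) - wvar A (x t) (l (t - 1)) / 4)"
proof -
  define U where "U = (\<lambda>t a. \<Sum>s=1..t. l s a)"
  define \<Psi> where "\<Psi> = (\<lambda>t. ln (\<Sum>b<A. exp (\<eta> * U t b)))"
  have step: "\<Psi> t - \<Psi> (t - 1) \<le> \<eta> * wmean A (x t) (l t)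
     + \<eta>^2 * (wvar A (x t) (\<lambda>a. l t a - l (t - 1) a) - wvar A (x t) (l (t - 1)) / 4)" if t: "1 \<le> t" for t
  proof -
    define W where "W = (\<Sum>b<A. exp (\<eta> * (U (t - 1) b + l (t - 1) b)))"
    have W: "W > 0" unfolding W_def by (rule sum_exp_pos[OF A])
    have iv: "{1..<t} = {1..t - 1}" "{1..t} = insert t {1..t - 1}" using t by auto
    have xt: "x t b = exp (\<eta> * (U (t - 1) b + l (t - 1) b)) / W" for b
      using x[OF t] unfolding softmax_def W_def U_def iv by simp
    have Ut: "U t b = U (t - 1) b + l t b" for b using t unfolding U_def iv by simp
    have e1: "(\<Sum>b<A. x t b * exp (\<eta> * (l t b - l (t - 1) b))) = (\<Sum>b<A. exp (\<eta> * U t b)) / W"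
      unfolding sum_divide_distrib by (rule sum.cong) (auto simp: xt Ut algebra_simps simp flip: exp_add)
    have e2: "(\<Sum>b<A. x t b * exp (\<eta> * (- l (t - 1) b))) = (\<Sum>b<A. exp (\<eta> * U (t - 1) b)) / W"
      unfolding sum_divide_distrib by (rule sum.cong) (auto simp: xt algebra_simps simp flip: exp_add)
    have x0: "\<And>b. b < A \<Longrightarrow> 0 \<le> x t b" using W by (simp add: xt)
    have x1: "(\<Sum>b<A. x t b) = 1" using softmax_sum[OF A] by (simp add: x[OF t])
    have "\<Psi> t - \<Psi> (t - 1) = ln (\<Sum>b<A. x t b * exp (\<eta> * (l t b - l (t - 1) b)))
       - ln (\<Sum>b<A. x t b * exp (\<eta> * (- l (t - 1) b)))"
      unfolding e1 e2 \<Psi>_def using W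
        sum_exp_pos[OF A, of "\<lambda>b. \<eta> * U t b"] sum_exp_pos[OF A, of "\<lambda>b. \<eta> * U (t - 1) b"]
      by (simp add: ln_div)
    also have "\<dots> \<le> (\<eta> * wmean A (x t) (\<lambda>b. l t b - l (t - 1) b) + \<eta>^2 * wvar A (x t) (\<lambda>b. l t b - l (t - 1) b))
      - (\<eta> * wmean A (x t) (\<lambda>b. - l (t - 1) b) + \<eta>^2 * wvar A (x t) (\<lambda>b. - l (t - 1) b) / 4)"
    proof (rule diff_mono)
      show "ln (\<Sum>b<A. x t b * exp (\<eta> * (l t b - l (t - 1) b)))
         \<le> \<eta> * wmean A (x t) (\<lambda>b. l t b - l (t - 1) b) + \<eta>^2 * wvar A (x t) (\<lambda>b. l t b - l (t - 1) b)"
      proof (rule log_mean_exp_bounds(1)[OF x0 x1])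
        fix b assume "b < A"
        then show "\<bar>l t b - l (t - 1) b\<bar> \<le> 1"
          using l[of b t] l[of b "t - 1"] by (simp add: abs_le_iff)
      qed (use \<eta> in auto)
      show "\<eta> * wmean A (x t) (\<lambda>b. - l (t - 1) b) + \<eta>^2 * wvar A (x t) (\<lambda>b. - l (t - 1) b) / 4
         \<le> ln (\<Sum>b<A. x t b * exp (\<eta> * (- l (t - 1) b)))"
        by (rule log_mean_exp_bounds(2)[OF x0 x1]) (use \<eta> l[of _ "t - 1"] in auto)
    qed
    also have "\<dots> = \<eta> * wmean A (x t) (l t)
     + \<eta>^2 * (wvar A (x t) (\<lambda>a. l t a - l (t - 1) a) - wvar A (x t) (l (t - 1)) / 4)"
      by (simp add: wmean_def wvar_def sum_negf sum_subtractf right_diff_distrib power2_commute)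
    finally show ?thesis .
  qed
  have tele: "(\<Sum>t=1..n. \<Psi> t - \<Psi> (t - 1)) = \<Psi> n - \<Psi> 0"
    by (induction n) auto
  have "\<eta> * U n a = ln (exp (\<eta> * U n a))" by simp
  also have "\<dots> \<le> \<Psi> n" unfolding \<Psi>_def
    using a member_le_sum[of a "{..<A}" "\<lambda>b. exp (\<eta> * U n b)"] sum_exp_pos[OF A, of "\<lambda>b. \<eta> * U n b"]
    by (subst ln_le_cancel_iff) auto
  finally have lo: "\<eta> * U n a \<le> \<Psi> n" .
  have "\<Psi> n - ln (real A) \<le> (\<Sum>t=1..n. \<eta> * wmean A (x t) (l t)
     + \<eta>^2 * (wvar A (x t) (\<lambda>a. l t a - l (t - 1) a) - wvar A (x t) (l (t - 1)) / 4))"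
  proof -
    have "\<Psi> 0 = ln (real A)" by (simp add: \<Psi>_def U_def)
    then have "\<Psi> n - ln (real A) = (\<Sum>t=1..n. \<Psi> t - \<Psi> (t - 1))" using tele by simp
    also have "\<dots> \<le> (\<Sum>t=1..n. \<eta> * wmean A (x t) (l t)
     + \<eta>^2 * (wvar A (x t) (\<lambda>a. l t a - l (t - 1) a) - wvar A (x t) (l (t - 1)) / 4))"
      by (rule sum_mono) (use step in auto)
    finally show ?thesis .
  qed
  also have "\<dots> = \<eta> * ((\<Sum>t=1..n. wmean A (x t) (l t))
     + \<eta> * (\<Sum>t=1..n. wvar A (x t) (\<lambda>a. l t a - l (t - 1) a) - wvar A (x t) (l (t - 1)) / 4))"
    by (simp add: sum.distrib sum_distrib_left[symmetric] power2_eq_square distrib_left mult.assoc)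
  finally have "\<eta> * U n a - ln (real A) \<le> \<eta> * ((\<Sum>t=1..n. wmean A (x t) (l t))
     + \<eta> * (\<Sum>t=1..n. wvar A (x t) (\<lambda>a. l t a - l (t - 1) a) - wvar A (x t) (l (t - 1)) / 4))"
    using lo by linarith
  then have "(\<eta> * U n a - ln (real A)) / \<eta> \<le> (\<Sum>t=1..n. wmean A (x t) (l t))
     + \<eta> * (\<Sum>t=1..n. wvar A (x t) (\<lambda>a. l t a - l (t - 1) a) - wvar A (x t) (l (t - 1)) / 4)"
    using \<eta> by (simp add: pos_divide_le_eq mult.commute)
  then have "U n a - ln (real A) / \<eta> \<le> (\<Sum>t=1..n. wmean A (x t) (l t))
     + \<eta> * (\<Sum>t=1..n. wvar A (x t) (\<lambda>a. l t a - l (t - 1) a) - wvar A (x t) (l (t - 1)) / 4)"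
    using \<eta> by (simp add: diff_divide_distrib)
  then show ?thesis by (simp add: U_def sum_subtractf)
qed

text \<open>Gibbs variational principle: the gap between the two sides is the relative entropy of
  \<open>y\<close> with respect to the softmax, which vanishes only if they agree.\<close>

lemma softmax_maximizes:
  assumes A: "1 \<le> A" and y: "\<And>a. a < A \<Longrightarrow> 0 \<le> y a" "(\<Sum>a<A. y a) = 1"
  shows "(\<Sum>a<A. y a * c a) - (\<Sum>a<A. y a * ln (y a)) \<le> ln (\<Sum>b<A. exp (c b))"
    and "(\<Sum>a<A. y a * c a) - (\<Sum>a<A. y a * ln (y a)) = ln (\<Sum>b<A. exp (c b))
      \<Longrightarrow> a < A \<Longrightarrow> y a = softmax A c a"
proof -
  define x Z where "x = softmax A c" and "Z = (\<Sum>b<A. exp (c b))"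
  have Z: "Z > 0" unfolding Z_def by (rule sum_exp_pos[OF A])
  have xpos: "x a > 0" for a unfolding x_def by (rule softmax_pos[OF A])
  have xsum: "(\<Sum>a<A. x a) = 1" unfolding x_def by (rule softmax_sum[OF A])
  have lnx: "c a = ln (x a) + ln Z" for a
    using Z by (simp add: x_def softmax_def Z_def[symmetric] ln_div)
  \<comment> \<open>Summands of the relative entropy with \<open>x a - y a\<close> added. These
    corrections sum to 0 and make every single summand nonnegative, with equality only for
    \<open>y a = x a\<close>.\<close>
  define f where "f = (\<lambda>a. x a - y a - (y a * ln (x a) - y a * ln (y a)))"
  have f: "0 \<le> f a \<and> (f a = 0 \<longrightarrow> y a = x a)" if "a < A" for a
  proof (cases "y a = 0")
    case True then show ?thesis using xpos[of a] by (simp add: f_def)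
  next
    case False
    then have ya: "y a > 0" using y(1)[OF that] by simp
    define u where "u = x a / y a"
    have u: "u > 0" using ya xpos[of a] by (simp add: u_def)
    have "f a = y a * (u - 1 - ln u)"
      using ya xpos[of a] by (simp add: f_def u_def ln_div right_diff_distrib)
    moreover have "0 \<le> u - 1 - ln u" using ln_le_minus_one[OF u] by simp
    moreover have "u = 1" if "u - 1 - ln u = 0" using ln_eq_minus_one[OF u] that by simp
    ultimately show ?thesis using ya by (auto simp: u_def)
  qed
  have fs: "(\<Sum>a<A. f a) = ln Z - ((\<Sum>a<A. y a * c a) - (\<Sum>a<A. y a * ln (y a)))"
    using y(2) xsum
    by (simp add: f_def lnx sum_subtractf sum.distrib distrib_left sum_distrib_right[symmetric])
  show "(\<Sum>a<A. y a * c a) - (\<Sum>a<A. y a * ln (y a)) \<le> ln (\<Sum>b<A. exp (c b))"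
    using fs f sum_nonneg[of "{..<A}" f] by (simp add: Z_def)
  assume "(\<Sum>a<A. y a * c a) - (\<Sum>a<A. y a * ln (y a)) = ln (\<Sum>b<A. exp (c b))" "a < A"
  then have "(\<Sum>a<A. f a) = 0" using fs by (simp add: Z_def)
  then have "f a = 0" using f \<open>a < A\<close> by (subst (asm) sum_nonneg_eq_0_iff) auto
  then show "y a = softmax A c a" using f \<open>a < A\<close> by (simp add: x_def)
qed

lemma softmax_attains:
  assumes A: "1 \<le> A"
  shows "(\<Sum>a<A. softmax A c a * c a) - (\<Sum>a<A. softmax A c a * ln (softmax A c a)) = ln (\<Sum>b<A. exp (c b))"
proof -
  define Z where "Z = (\<Sum>b<A. exp (c b))"
  have Z: "Z > 0" unfolding Z_def by (rule sum_exp_pos[OF A])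
  have "ln (softmax A c a) = c a - ln Z" for a
    using Z by (simp add: softmax_def Z_def[symmetric] ln_div)
  then show ?thesis using softmax_sum[OF A, of c]
    by (simp add: right_diff_distrib sum_subtractf Z_def[symmetric] flip: sum_distrib_right)
qed

text \<open>The equality case of the Gibbs principle supplies the uniqueness that the definite
  description requires; outside the action range the simplex forces the value 0.\<close>

lemma ftrl_pol_softmax:
  assumes A: "1 \<le> nact G i"
  shows "ftrl_pol G \<eta> loss i
    = (\<lambda>a. if a < nact G i then softmax (nact G i) (\<lambda>a. \<eta> * loss a / real (hor G)) a else 0)"
proof -
  define c where "c = (\<lambda>a. \<eta> * loss a / real (hor G))"
  define X where "X = (\<lambda>a. if a < nact G i then softmax (nact G i) c a else 0)"
  have X: "X \<in> act_simplex G i"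
    using softmax_sum[OF A, of c] softmax_pos[OF A, of c] by (auto simp: X_def act_simplex_def less_imp_le)
  have Xv: "(\<Sum>a<nact G i. X a * c a) - negent G i X = ln (\<Sum>b<nact G i. exp (c b))"
    using softmax_attains[OF A, of c] by (simp add: X_def negent_def)
  show ?thesis
    unfolding ftrl_pol_def c_def[symmetric] X_def[symmetric]
  proof (rule the_equality)
    have cc: "\<eta> * loss a / real (hor G) = c a" for a by (simp add: c_def)
    show "X \<in> act_simplex G i \<and> (\<forall>y\<in>act_simplex G i. (\<Sum>a<nact G i. y a * (\<eta> * loss a / real (hor G))) - negent G i y
                     \<le> (\<Sum>a<nact G i. X a * (\<eta> * loss a / real (hor G))) - negent G i X)"
      unfolding cc Xv using softmax_maximizes(1)[OF A, of _ c] X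
      by (auto simp: act_simplex_def negent_def)
    fix x assume x: "x \<in> act_simplex G i \<and> (\<forall>y\<in>act_simplex G i. (\<Sum>a<nact G i. y a * (\<eta> * loss a / real (hor G))) - negent G i y
                     \<le> (\<Sum>a<nact G i. x a * (\<eta> * loss a / real (hor G))) - negent G i x)"
    then have s: "\<And>a. a < nact G i \<Longrightarrow> 0 \<le> x a" "(\<Sum>a<nact G i. x a) = 1" "\<And>a. nact G i \<le> a \<Longrightarrow> x a = 0"
      by (auto simp: act_simplex_def)
    have "(\<Sum>a<nact G i. x a * c a) - (\<Sum>a<nact G i. x a * ln (x a)) = ln (\<Sum>b<nact G i. exp (c b))"
      using x X Xv softmax_maximizes(1)[OF A s(1,2), of c] unfolding cc negent_def by force
    from softmax_maximizes(2)[OF A s(1,2) this]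
    show "x = X" using s(3) by (auto simp: X_def)
  qed
qed

section \<open>Smoothness of the joint dynamics\<close>

lemma finite_joint_actions [simp]: "finite (joint_actions G)"
  unfolding joint_actions_def by (rule finite_PiE) auto

lemma joint_actions_less: "a \<in> joint_actions G \<Longrightarrow> k < nag G \<Longrightarrow> a k < nact G k"
  by (auto simp: joint_actions_def)

lemma joint_actions_fiber_bij:
  assumes "i < nag G" "b < nact G i"
  shows "bij_betw (\<lambda>g. g(i := b)) (\<Pi>\<^sub>E k\<in>{0..<nag G} - {i}. {0..<nact G k}) {a \<in> joint_actions G. a i = b}"
  using assms unfolding joint_actions_def
  \<comment> \<open>The inverse restores \<open>undefined\<close> at \<open>i\<close>, the value of
    an extensional function outside its domain.\<close>
  by (intro bij_betw_byWitness[where f' = "\<lambda>a. a(i := undefined)"])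
     (auto simp: PiE_def Pi_def extensional_def fun_eq_iff)

lemma sum_prod_opponents:
  assumes "i < nag G" "b < nact G i"
  shows "(\<Sum>a\<in>{a \<in> joint_actions G. a i = b}. \<Prod>k\<in>{0..<nag G} - {i}. f k (a k))
     = (\<Prod>k\<in>{0..<nag G} - {i}. \<Sum>c<nact G k. f k c :: real)"
proof -
  have "(\<Sum>a\<in>{a \<in> joint_actions G. a i = b}. \<Prod>k\<in>{0..<nag G} - {i}. f k (a k))
     = (\<Sum>g\<in>(\<Pi>\<^sub>E k\<in>{0..<nag G} - {i}. {0..<nact G k}). \<Prod>k\<in>{0..<nag G} - {i}. f k ((g(i := b)) k))"
    by (rule sum.reindex_bij_betw[OF joint_actions_fiber_bij[OF assms], symmetric])
  also have "\<dots> = (\<Sum>g\<in>(\<Pi>\<^sub>E k\<in>{0..<nag G} - {i}. {0..<nact G k}). \<Prod>k\<in>{0..<nag G} - {i}. f k (g k))"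
    by (intro sum.cong prod.cong) auto
  also have "\<dots> = (\<Prod>k\<in>{0..<nag G} - {i}. \<Sum>c\<in>{0..<nact G k}. f k c)"
    by (rule prod_sum_PiE[symmetric]) auto
  finally show ?thesis by (simp add: lessThan_atLeast0)
qed

lemma sum_joint_actions_fibers:
  assumes "i < nag G"
  shows "(\<Sum>a\<in>joint_actions G. f a) = (\<Sum>b<nact G i. \<Sum>a\<in>{a \<in> joint_actions G. a i = b}. f a :: real)"
  by (rule sum.group[symmetric]) (use assms in \<open>auto intro: joint_actions_less\<close>)

lemma sum_joint_deviation:
  assumes "i < nag G"
  shows "(\<Sum>a\<in>joint_actions G. y (a i) * (\<Prod>k\<in>{0..<nag G} - {i}. p h k s (a k)) * Q h i s a)
    = (\<Sum>b<nact G i. y b * Qmix G Q p h i s b)"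
  unfolding sum_joint_actions_fibers[OF assms] Qmix_def sum_distrib_left
  by (intro sum.cong refl) (auto simp: ac_simps)

lemma Qval_Qmix:
  assumes "i < nag G"
  shows "Qval G Q p h i s = (\<Sum>b<nact G i. p h i s b * Qmix G Q p h i s b)"
  unfolding sum_joint_deviation[OF assms, symmetric] Qval_def
  using assms by (intro sum.cong) (auto simp: prod.remove[of "{0..<nag G}" i])

text \<open>Within a stage the estimate \<open>Q\<close> is frozen, so the updates at different
  pairs \<open>(h, s)\<close> do not interact. The locale describes one such pair: a repeated
  normal-form game on a stage-local clock, where \<open>p 0\<close> is the uniform policy after the
  reset.\<close>

locale oftrl_stage =
  fixes G :: mgame and Q :: qfun and h s :: nat and \<eta> :: real and p :: "nat \<Rightarrow> pol"
  assumes agents: "1 \<le> nag G" and actions: "\<And>i. i < nag G \<Longrightarrow> 1 \<le> nact G i" and horizon: "1 \<le> hor G"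
    and Q_bounds: "\<And>i a. i < nag G \<Longrightarrow> a \<in> joint_actions G \<Longrightarrow> 0 \<le> Q h i s a"
      "\<And>i a. i < nag G \<Longrightarrow> a \<in> joint_actions G \<Longrightarrow> Q h i s a \<le> real (hor G)"
    and p_0: "p 0 = unif_pol G"
    and p_step: "\<And>t i. 1 \<le> t \<Longrightarrow> i < nag G \<Longrightarrow> p t h i s = ftrl_pol G \<eta>
        (\<lambda>b. (\<Sum>t'=1..<t. Qmix G Q (p t') h i s b) + Qmix G Q (p (t - 1)) h i s b) i"
    and \<eta>_pos: "0 < \<eta>"
begin

text \<open>Division by the horizon brings utilities into the unit interval and takes over the
  \<open>1 / H\<close> in the policy update.\<close>

definition l :: "nat \<Rightarrow> nat \<Rightarrow> nat \<Rightarrow> real" where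
  "l t i b = Qmix G Q (p t) h i s b / real (hor G)"

definition F :: "nat \<Rightarrow> nat \<Rightarrow> nat \<Rightarrow> real" where
  "F t i b = \<eta> * ((\<Sum>t'=1..<t. l t' i b) + l (t - 1) i b)"

definition x :: "nat \<Rightarrow> nat \<Rightarrow> nat \<Rightarrow> real" where
  "x t i = (if t = 0 then (\<lambda>_. 1 / real (nact G i)) else softmax (nact G i) (F t i))"

lemma x_eq:
  assumes "i < nag G" "b < nact G i" shows "p t h i s b = x t i b"
proof (cases "t = 0")
  case True then show ?thesis using assms by (simp add: p_0 x_def unif_pol_def)
next
  case False
  then have "p t h i s = ftrl_pol G \<eta> (\<lambda>b. (\<Sum>t'=1..<t. Qmix G Q (p t') h i s b) + Qmix G Q (p (t - 1)) h i s b) i"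
    using p_step[of t i] assms by simp
  moreover have "(\<lambda>b. \<eta> * ((\<Sum>t'=1..<t. Qmix G Q (p t') h i s b) + Qmix G Q (p (t - 1)) h i s b) / real (hor G)) = F t i"
    by (simp add: F_def l_def fun_eq_iff flip: add_divide_distrib sum_divide_distrib)
  ultimately show ?thesis
    using assms ftrl_pol_softmax[OF actions[OF assms(1)]] False by (simp add: x_def)
qed

lemma x_pos: "i < nag G \<Longrightarrow> 0 < x t i b"
  using actions[of i] softmax_pos[of "nact G i" "F t i" b] by (simp add: x_def)

lemma x_sum: "i < nag G \<Longrightarrow> (\<Sum>b<nact G i. x t i b) = 1"
  using actions[of i] softmax_sum[of "nact G i" "F t i"] by (simp add: x_def)

lemma l_eq:
  assumes "i < nag G"
  shows "l t i b = (\<Sum>a\<in>{a \<in> joint_actions G. a i = b}.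
     Q h i s a / real (hor G) * (\<Prod>k\<in>{0..<nag G} - {i}. x t k (a k)))"
  unfolding l_def Qmix_def sum_divide_distrib
  by (intro sum.cong refl) (auto simp: x_eq joint_actions_less)

lemma weights_nonneg:
  "i < nag G \<Longrightarrow> a \<in> joint_actions G \<Longrightarrow> 0 \<le> Q h i s a / real (hor G) * (\<Prod>k\<in>{0..<nag G} - {i}. x t k (a k))"
  using Q_bounds(1)[of i a]
  by (intro mult_nonneg_nonneg divide_nonneg_nonneg prod_nonneg ballI less_imp_le[OF x_pos]) auto

lemma l_nonneg: "i < nag G \<Longrightarrow> 0 \<le> l t i b"
  unfolding l_eq by (rule sum_nonneg) (use weights_nonneg in auto)

lemma l_le_1:
  assumes "i < nag G" "b < nact G i" shows "l t i b \<le> 1"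
proof -
  have "l t i b \<le> (\<Sum>a\<in>{a \<in> joint_actions G. a i = b}. 1 * (\<Prod>k\<in>{0..<nag G} - {i}. x t k (a k)))"
    unfolding l_eq[OF assms(1)] using Q_bounds(2)[of i] assms horizon
    by (intro sum_mono mult_right_mono prod_nonneg) (auto intro: less_imp_le[OF x_pos])
  also have "\<dots> = 1" using assms by (simp add: sum_prod_opponents x_sum)
  finally show ?thesis .
qed

lemma F_step: "1 \<le> t \<Longrightarrow> F (Suc t) i b - F t i b = \<eta> * (2 * l t i b - l (t - 1) i b)"
  by (simp add: F_def algebra_simps)

text \<open>Along a window starting at \<open>t\<close> the strategies equal \<open>x t\<close> times factors close to 1 in the
  submultiplicative sense of \<open>diff_bounded\<close>. The order-\<open>n\<close> differences of these factors only involve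
  differences of \<open>l\<close> of order below \<open>n\<close>, which drives the induction.\<close>

lemma fdiff_l_bound:
  assumes K: "192 * real (nag G) * \<eta> * real K \<le> 1"
  defines "\<alpha> \<equiv> 768 * real (nag G) * \<eta>"
  shows "n \<le> K \<Longrightarrow> n \<le> t \<Longrightarrow> i < nag G \<Longrightarrow> b < nact G i \<Longrightarrow> \<bar>fdiff n (\<lambda>t. l t i b) t\<bar> \<le> diff_weight \<alpha> n"
proof (induction n arbitrary: t i b rule: less_induct)
  case (less n)
  show ?case
  proof (cases "n = 0")
    case True
    then show ?thesis using l_nonneg[OF less.prems(3)] l_le_1[OF less.prems(3,4)] by simp
  next
    case n: False
    then have t: "1 \<le> t" using less.prems by simp
    \<comment> \<open>The product over at most N opponents of factors within
      \<open>7 * \<epsilon>\<close> of 1 must stay bounded: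
      \<open>(1 + 7 * \<epsilon>) ^ N \<le> exp (7/8) \<le> 3\<close>.\<close>
    define \<epsilon> where "\<epsilon> = 1 / (8 * real (nag G))"
    have N: "real (nag G) \<ge> 1" using agents by simp
    have \<alpha>: "\<alpha> > 0" using N \<eta>_pos by (simp add: \<alpha>_def)
    have \<epsilon>: "0 < \<epsilon>" "\<epsilon> \<le> 1 / 8" using N by (auto simp: \<epsilon>_def field_simps)
    \<comment> \<open>This fixes 768 = 8 * 96: below, 3 from the optimistic step and 4 from
      \<open>diff_weight_step\<close> give 12, and 12 / 96 is the 1/8 in
      \<open>diff_bounded\<close>.\<close>
    have x1: "1 / \<alpha> * \<eta> = \<epsilon> / 96" using N \<eta>_pos by (simp add: \<alpha>_def \<epsilon>_def field_simps)
    define g where "g = (\<lambda>k c j. F (t + j) k c - F t k c)"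
    have g_step: "g k c (Suc j) - g k c j = \<eta> * (2 * l (t + j) k c - l (t - 1 + j) k c)" for k c j
      using F_step[of "t + j" k c] t by (simp add: g_def)
    have sm_g: "diff_bounded \<alpha> n \<epsilon> (g k c)" if kc: "k < nag G" "c < nact G k" for k c
      unfolding diff_bounded_def
    proof (intro allI impI)
      fix m j assume mj: "m + j \<le> n"
      show "\<bar>fdiff m (g k c) j\<bar> \<le> \<epsilon> * diff_weight \<alpha> m / 8"
      proof (cases m)
        \<comment> \<open>Order 0 is not covered by the induction. Potentials move by at most
          \<open>3 * \<eta>\<close> per step over at most \<open>K\<close> steps, and the required
          \<open>\<epsilon> / 8 = 1 / (64 N)\<close> explains 192 = 3 * 64.\<close>
        case 0
        have "\<bar>g k c j\<bar> \<le> 3 * \<eta> * real j"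
        proof (induction j)
          case 0 show ?case by (simp add: g_def)
        next
          case (Suc j)
          have "\<bar>2 * l (t + j) k c - l (t - 1 + j) k c\<bar> \<le> 3"
            using l_nonneg[OF kc(1), of "t + j" c] l_le_1[OF kc, of "t + j"]
              l_nonneg[OF kc(1), of "t - 1 + j" c] l_le_1[OF kc, of "t - 1 + j"] by linarith
          then have "\<bar>\<eta> * (2 * l (t + j) k c - l (t - 1 + j) k c)\<bar> \<le> \<eta> * 3"
            unfolding abs_mult using \<eta>_pos by (simp add: mult_left_mono)
          then have "\<bar>g k c (Suc j) - g k c j\<bar> \<le> \<eta> * 3" unfolding g_step .
          then show ?case using Suc by (simp add: algebra_simps)
        qed
        also have "\<dots> \<le> 3 * \<eta> * real K" using mj less.prems(1) \<eta>_pos by (intro mult_left_mono) auto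
        also have "\<dots> \<le> \<epsilon> / 8" using K N by (simp add: \<epsilon>_def field_simps)
        finally show ?thesis using 0 by simp
      next
        case (Suc m')
        have "fdiff m (g k c) j = fdiff m' (\<lambda>j. \<eta> * (2 * l (t + j) k c - l (t - 1 + j) k c)) j"
          unfolding Suc fdiff_Suc_inner g_step ..
        also have "\<dots> = \<eta> * (2 * fdiff m' (\<lambda>t. l t k c) (t + j) - fdiff m' (\<lambda>t. l t k c) (t - 1 + j))"
          unfolding fdiff_cmult fdiff_diff
          using fdiff_shift[of m' "\<lambda>t. l t k c" t j] fdiff_shift[of m' "\<lambda>t. l t k c" "t - 1" j] by simp
        finally have e: "fdiff m (g k c) j = \<eta> * (2 * fdiff m' (\<lambda>t. l t k c) (t + j) - fdiff m' (\<lambda>t. l t k c) (t - 1 + j))" .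
        \<comment> \<open>The optimistic term looks back to \<open>t - 1\<close>. Since
          \<open>m = Suc m'\<close> is at most \<open>n \<le> t\<close>, the lower order satisfies
          \<open>m' \<le> t - 1\<close>, so the induction hypothesis still applies there.\<close>
        have "\<bar>fdiff m' (\<lambda>t. l t k c) (t + j)\<bar> \<le> diff_weight \<alpha> m'" "\<bar>fdiff m' (\<lambda>t. l t k c) (t - 1 + j)\<bar> \<le> diff_weight \<alpha> m'"
          using mj Suc less.prems kc by (auto intro!: less.IH)
        then have "\<bar>2 * fdiff m' (\<lambda>t. l t k c) (t + j) - fdiff m' (\<lambda>t. l t k c) (t - 1 + j)\<bar> \<le> 3 * diff_weight \<alpha> m'"
          by linarith
        also have "\<dots> \<le> 3 * (4 / \<alpha> * diff_weight \<alpha> m)"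
          unfolding Suc by (intro mult_left_mono diff_weight_step \<alpha>) auto
        finally have "\<bar>fdiff m (g k c) j\<bar> \<le> \<eta> * (3 * (4 / \<alpha> * diff_weight \<alpha> m))"
          unfolding e abs_mult abs_of_pos[OF \<eta>_pos] using \<eta>_pos by (intro mult_left_mono) auto
        also have "\<dots> = 12 * (1 / \<alpha> * \<eta>) * diff_weight \<alpha> m" by simp
        also have "\<dots> = \<epsilon> * diff_weight \<alpha> m / 8" unfolding x1 by simp
        finally show ?thesis .
      qed
    qed
    have exp\<epsilon>: "exp \<epsilon> - 1 \<le> 2 * \<epsilon>"
    proof -
      have "exp \<epsilon> \<le> 1 + \<epsilon> + \<epsilon>^2" using \<epsilon> by (intro exp_bound) auto
      moreover have "\<epsilon>^2 \<le> \<epsilon>" using \<epsilon> by (simp add: power2_eq_square mult_le_cancel_left1)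
      ultimately show ?thesis by simp
    qed
    have sm_e: "diff_bounded \<alpha> n (2 * \<epsilon>) (\<lambda>j. exp (g k c j) - 1)" if "k < nag G" "c < nact G k" for k c
      by (rule diff_bounded_mono[OF \<alpha> diff_bounded_exp[OF \<alpha> sm_g[OF that]] exp\<epsilon>])
    define Z where "Z = (\<lambda>k j. \<Sum>c<nact G k. x t k c * exp (g k c j))"
    have Zpos: "Z k j > 0" if "k < nag G" for k j
      unfolding Z_def using actions[OF that] x_pos[OF that] by (intro sum_pos) (auto simp: lessThan_empty_iff)
    have sm_Z: "diff_bounded \<alpha> n (2 * \<epsilon>) (\<lambda>j. Z k j - 1)" if k: "k < nag G" for k
    proof -
      have "diff_bounded \<alpha> n ((\<Sum>c<nact G k. x t k c) * (2 * \<epsilon>)) (\<lambda>j. \<Sum>c<nact G k. x t k c * (exp (g k c j) - 1))"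
        by (rule diff_bounded_weighted_sum) (use k x_pos[OF k] sm_e in \<open>auto intro: less_imp_le\<close>)
      then show ?thesis by (simp add: x_sum[OF k] Z_def right_diff_distrib sum_subtractf)
    qed
    define y where "y = (\<lambda>k c j. exp (g k c j) * (1 / Z k j))"
    have sm_y: "diff_bounded \<alpha> n (7 * \<epsilon>) (\<lambda>j. y k c j - 1)" if kc: "k < nag G" "c < nact G k" for k c
    proof -
      have "diff_bounded \<alpha> n (2 * (2 * \<epsilon>)) (\<lambda>j. 1 / Z k j - 1)"
        using \<epsilon> Zpos[OF kc(1)] by (intro diff_bounded_near_one_inverse[OF \<alpha> sm_Z[OF kc(1)]]) (auto simp: less_imp_neq[symmetric])
      from diff_bounded_near_one_mult[OF \<alpha> sm_e[OF kc] this]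
      have "diff_bounded \<alpha> n ((1 + 2 * \<epsilon>) * (1 + 2 * (2 * \<epsilon>)) - 1) (\<lambda>j. y k c j - 1)" by (simp add: y_def)
      moreover have "(1 + 2 * \<epsilon>) * (1 + 2 * (2 * \<epsilon>)) - 1 \<le> 7 * \<epsilon>"
        using mult_left_mono[OF \<epsilon>(2), of \<epsilon>] \<epsilon>(1) by (simp add: algebra_simps)
      ultimately show ?thesis using diff_bounded_mono[OF \<alpha>] by blast
    qed
    have xy: "x (t + j) k c = x t k c * y k c j" if kc: "k < nag G" for k c j
    proof -
      have "x (t + j) k c = softmax (nact G k) (\<lambda>c. F t k c + g k c j) c"
        using t by (simp add: x_def g_def)
      also have "\<dots> = softmax (nact G k) (F t k) c * exp (g k c j) / (\<Sum>b<nact G k. softmax (nact G k) (F t k) b * exp (g k b j))"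
        by (rule softmax_shift[OF actions[OF kc]])
      also have "\<dots> = x t k c * y k c j" using t by (simp add: x_def y_def Z_def)
      finally show ?thesis .
    qed
    define I where "I = {0..<nag G} - {i}"
    \<comment> \<open>These weights are frozen at the start of the window and sum to
      \<open>l t i b \<le> 1\<close>, so averaging over joint actions does not increase the norm and
      the number of actions does not enter.\<close>
    define w where "w = (\<lambda>a. Q h i s a / real (hor G) * (\<Prod>k\<in>I. x t k (a k)))"
    define J where "J = {a \<in> joint_actions G. a i = b}"
    have lj: "l (t + j) i b - l t i b = (\<Sum>a\<in>J. w a * ((\<Prod>k\<in>I. y k (a k) j) - 1))" for j
    proof -
      have "(\<Prod>k\<in>I. x (t + j) k (a k)) = (\<Prod>k\<in>I. x t k (a k)) * (\<Prod>k\<in>I. y k (a k) j)" for a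
        unfolding prod.distrib[symmetric] by (intro prod.cong) (auto simp: xy I_def)
      then show ?thesis
        unfolding l_eq[OF less.prems(3)] sum_subtractf[symmetric] J_def[symmetric] I_def[symmetric]
        by (simp add: w_def right_diff_distrib mult.assoc)
    qed
    have cardI: "card I \<le> nag G" unfolding I_def by (rule order_trans[OF card_mono[of "{0..<nag G}"]]) auto
    have pw: "(1 + 7 * \<epsilon>) ^ card I - 1 \<le> 2"
    proof -
      have "(1 + 7 * \<epsilon>) ^ card I \<le> (1 + 7 * \<epsilon>) ^ nag G"
        using \<epsilon> cardI by (intro power_increasing) auto
      also have "\<dots> \<le> exp (7 * \<epsilon>) ^ nag G"
        using \<epsilon> exp_ge_add_one_self[of "7 * \<epsilon>"] by (intro power_mono) auto
      also have "\<dots> = exp (7 / 8)" using N by (simp add: \<epsilon>_def flip: exp_of_nat_mult)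
      also have "\<dots> \<le> exp 1" by simp
      also have "\<dots> \<le> 3" by (rule exp_le)
      finally show ?thesis by simp
    qed
    have sm_l: "diff_bounded \<alpha> n ((\<Sum>a\<in>J. w a) * 2) (\<lambda>j. l (t + j) i b - l t i b)"
      unfolding lj
    proof (rule diff_bounded_weighted_sum)
      fix a assume a: "a \<in> J"
      then have aj: "a \<in> joint_actions G" by (simp add: J_def)
      show "0 \<le> w a" unfolding w_def I_def by (rule weights_nonneg[OF less.prems(3) aj])
      have "diff_bounded \<alpha> n ((1 + 7 * \<epsilon>) ^ card I - 1) (\<lambda>j. (\<Prod>k\<in>I. y k (a k) j) - 1)"
        using \<epsilon> by (intro diff_bounded_near_one_prod[OF \<alpha>] sm_y) (auto simp: I_def joint_actions_less[OF aj])
      then show "diff_bounded \<alpha> n 2 (\<lambda>j. (\<Prod>k\<in>I. y k (a k) j) - 1)" by (rule diff_bounded_mono[OF \<alpha> _ pw])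
    qed (simp add: J_def)
    have "(\<Sum>a\<in>J. w a) = l t i b" unfolding l_eq[OF less.prems(3)] J_def w_def I_def ..
    then have w1: "(\<Sum>a\<in>J. w a) \<le> 1" using l_le_1[OF less.prems(3,4)] by simp
    have "fdiff n (\<lambda>t. l t i b) t = fdiff n (\<lambda>j. l (t + j) i b - l t i b) 0"
      unfolding fdiff_diff fdiff_const using n fdiff_shift[of n "\<lambda>t. l t i b" t 0] by simp
    also have "\<bar>\<dots>\<bar> \<le> (\<Sum>a\<in>J. w a) * 2 * diff_weight \<alpha> n / 8" by (rule diff_boundedD[OF sm_l]) simp
    also have "\<dots> \<le> diff_weight \<alpha> n"
      using mult_right_mono[OF w1 less_imp_le[OF diff_weight_pos[OF \<alpha>, of n]]] diff_weight_pos[OF \<alpha>, of n] by linarith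
    finally show ?thesis .
  qed
qed

text \<open>Potentials change by between \<open>- \<eta>\<close> and \<open>2 * \<eta>\<close> in
  one step. Two numerators and two normalizers change a product of two probabilities by a factor
  within \<open>exp (6 * \<eta>)\<close> and its inverse. Such products weight the pairs in
  \<open>wvar_pairs\<close>.\<close>

lemma x_product_drift:
  assumes t: "1 \<le> t" and i: "i < nag G" and ab: "a < nact G i" "b < nact G i" and \<eta>: "6 * \<eta> \<le> 1"
  shows "\<bar>x (Suc t) i a * x (Suc t) i b - x t i a * x t i b\<bar> \<le> 12 * \<eta> * (x (Suc t) i a * x (Suc t) i b)"
proof -
  define d where "d = (\<lambda>c. F (Suc t) i c - F t i c)"
  define W where "W = (\<Sum>c<nact G i. exp (F (Suc t) i c))"
  define W' where "W' = (\<Sum>c<nact G i. exp (F t i c))"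
  have W: "W > 0" "W' > 0" unfolding W_def W'_def by (auto intro: sum_exp_pos actions[OF i])
  have d: "- \<eta> \<le> d c" "d c \<le> 2 * \<eta>" if c: "c < nact G i" for c
  proof -
    have "- 1 \<le> 2 * l t i c - l (t - 1) i c" "2 * l t i c - l (t - 1) i c \<le> 2"
      using l_nonneg[OF i, of t c] l_nonneg[OF i, of "t - 1" c] l_le_1[OF i c, of t] l_le_1[OF i c, of "t - 1"]
      by linarith+
    from mult_left_mono[OF this(1), of \<eta>] mult_left_mono[OF this(2), of \<eta>]
    show "- \<eta> \<le> d c" "d c \<le> 2 * \<eta>" using \<eta>_pos by (auto simp: d_def F_step[OF t])
  qed
  have WW: "exp (- \<eta>) * W' \<le> W" "W \<le> exp (2 * \<eta>) * W'"
  proof -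
    have e: "exp (F (Suc t) i c) = exp (d c) * exp (F t i c)" for c by (simp add: d_def flip: exp_add)
    show "exp (- \<eta>) * W' \<le> W" "W \<le> exp (2 * \<eta>) * W'"
      unfolding W_def W'_def sum_distrib_left e using d by (auto intro!: sum_mono mult_right_mono)
  qed
  define r where "r = exp (- d a) * exp (- d b) * (W / W')^2"
  have xr: "x t i a * x t i b = r * (x (Suc t) i a * x (Suc t) i b)"
  proof -
    have xt: "x t i c = exp (- d c) * (W / W') * x (Suc t) i c" for c
      using t W by (simp add: x_def softmax_def W_def[symmetric] W'_def[symmetric] d_def exp_diff exp_minus field_simps)
    show ?thesis unfolding xt[of a] xt[of b] r_def by (simp add: power2_eq_square)
  qed
  have q: "exp (- \<eta>) \<le> W / W'" "W / W' \<le> exp (2 * \<eta>)"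
    using WW W by (auto simp: field_simps)
  have "r \<le> exp \<eta> * exp \<eta> * (exp (2 * \<eta>))^2" unfolding r_def
    using d[OF ab(1)] d[OF ab(2)] q W by (intro mult_mono power_mono) auto
  also have "\<dots> = exp (6 * \<eta>)" by (simp flip: exp_add exp_of_nat_mult add: power2_eq_square)
  also have "\<dots> \<le> 1 + 6 * \<eta> + (6 * \<eta>)^2" using \<eta> \<eta>_pos by (intro exp_bound) auto
  also have "(6 * \<eta>)^2 \<le> 6 * \<eta>" using \<eta> \<eta>_pos by (simp add: power2_eq_square mult_le_cancel_left1)
  finally have r1: "r \<le> 1 + 12 * \<eta>" by simp
  have "exp (- (2 * \<eta>)) * exp (- (2 * \<eta>)) * (exp (- \<eta>))^2 \<le> r" unfolding r_def
    using d[OF ab(1)] d[OF ab(2)] q by (intro mult_mono power_mono) auto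
  moreover have "exp (- (2 * \<eta>)) * exp (- (2 * \<eta>)) * (exp (- \<eta>))^2 = exp (- (6 * \<eta>))"
    by (simp flip: exp_add exp_of_nat_mult add: power2_eq_square)
  ultimately have r2: "1 - 12 * \<eta> \<le> r" using exp_ge_add_one_self[of "- (6 * \<eta>)"] \<eta>_pos by linarith
  define X where "X = x (Suc t) i a * x (Suc t) i b"
  have X: "0 \<le> X" unfolding X_def using x_pos[OF i] by (simp add: less_imp_le)
  have "X - r * X = (1 - r) * X" by (simp add: algebra_simps)
  then have "\<bar>X - r * X\<bar> = \<bar>1 - r\<bar> * X" using X by (simp add: abs_mult)
  also have "\<dots> \<le> 12 * \<eta> * X" using r1 r2 X by (intro mult_right_mono) auto
  finally show ?thesis unfolding xr X_def .
qed

theorem regret_le: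
  assumes K: "1 \<le> K" "real L \<le> exp (real K)" and \<eta>: "6144 * real (nag G) * \<eta> * real K \<le> 1"
    and i: "i < nag G" and a: "a < nact G i"
  shows "(\<Sum>t=1..L. Qmix G Q (p t) h i s a - Qval G Q (p t) h i s)
     \<le> real (hor G) * (ln (real (nact G i)) / \<eta> + real K)"
proof -
  define A where "A = nact G i"
  define \<alpha> where "\<alpha> = 768 * real (nag G) * \<eta>"
  have N: "1 \<le> real (nag G)" using agents by simp
  have K1: "1 \<le> real K" using K by simp
  have \<alpha>: "0 < \<alpha>" using N \<eta>_pos by (simp add: \<alpha>_def)
  have \<eta>K: "6144 * (\<eta> * real K) \<le> 1"
  proof -
    have "1 * (\<eta> * real K) \<le> real (nag G) * (\<eta> * real K)" using N \<eta>_pos by (intro mult_right_mono) auto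
    then show ?thesis using \<eta> by (simp add: mult.assoc)
  qed
  have \<eta>1: "6144 * \<eta> \<le> 1"
  proof -
    have "\<eta> * 1 \<le> \<eta> * real K" using K1 \<eta>_pos by (intro mult_left_mono) auto
    then show ?thesis using \<eta>K by linarith
  qed
  have x0: "\<And>t b. b < A \<Longrightarrow> 0 \<le> x t i b" using x_pos[OF i] by (simp add: less_imp_le)
  have x1: "\<And>t. (\<Sum>b<A. x t i b) = 1" using x_sum[OF i] by (simp add: A_def)
  define dv where "dv = (\<lambda>t. wvar A (x t i) (\<lambda>b. l t i b - l (t - 1) i b))"
  define pv where "pv = (\<lambda>t. wvar A (x t i) (l (t - 1) i))"
  have dv1: "dv t \<le> 1" for t unfolding dv_def
  proof (rule wvar_le_1[OF x0 x1])
    fix b assume "b < A"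
    then show "\<bar>l t i b - l (t - 1) i b\<bar> \<le> 1"
      using l_nonneg[OF i, of t b] l_nonneg[OF i, of "t - 1" b] l_le_1[OF i, of b t] l_le_1[OF i, of b "t - 1"]
      by (auto simp: A_def abs_le_iff)
  qed
  have pv0: "0 \<le> pv t" for t unfolding pv_def by (rule wvar_nonneg[OF x0 x1])
  \<comment> \<open>The first \<open>K\<close> iterations are charged 1 each, because differences of
    order \<open>k\<close> are controlled only from time \<open>k\<close> on. The energy comparison
    covers the rest.\<close>
  have V: "(\<Sum>t=1..L. dv t - pv t / 4) \<le> real K + 288 * (real K)^2"
  proof (cases "K \<le> L")
    case False
    have "(\<Sum>t=1..L. dv t - pv t / 4) \<le> (\<Sum>t=1..L. 1)"
      using dv1 pv0 by (intro sum_mono) (smt (verit) divide_nonneg_nonneg)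
    also have "\<dots> = real L" by simp
    also have "\<dots> \<le> real K + 288 * (real K)^2" using False by (simp add: add_increasing2)
    finally show ?thesis .
  next
    case True
    \<comment> \<open>Utilities are taken one step back so that order 0 gives the variance of
      \<open>l (t - 1)\<close> and order 1 that of the increment \<open>l t - l (t - 1)\<close>. The
      sums therefore start at \<open>K + 1\<close>.\<close>
    define z where "z = (\<lambda>(b, c) t. l (t - 1) i b - l (t - 1) i c)"
    define \<omega> where "\<omega> = (\<lambda>t (b, c). x t i b * x t i c)"
    define P where "P = {..<A} \<times> {..<A}"
    define E where "E = (\<lambda>k. \<Sum>t=K+1..<L+1. \<Sum>q\<in>P. \<omega> t q * (fdiff k (z q) t)^2)"
    have "E 1 \<le> E 0 / 4 + 576 * (real K)^2"
      unfolding E_def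
    proof (rule increment_energy_le[where \<beta> = "\<alpha> * real K"])
      show "K + 1 \<le> L + 1" "1 \<le> K" using True K by auto
      show "real (L + 1 - (K + 1)) \<le> exp (real K)" using K(2) by (rule order_trans[rotated]) simp
      show "0 \<le> \<alpha> * real K" using \<alpha> by simp
      show "\<alpha> * real K \<le> 1 / 8" using \<eta> by (simp add: \<alpha>_def)
      show "0 \<le> \<omega> t q" if "q \<in> P" for t q using that x0 by (auto simp: \<omega>_def P_def)
      show "\<bar>\<omega> (Suc t) q - \<omega> t q\<bar> \<le> 1 / (24 * real K) * \<omega> (Suc t) q"
        if t: "K + 1 \<le> t" and q: "q \<in> P" for t q
      proof -
        obtain b c where bc: "q = (b, c)" "b < A" "c < A" using q by (auto simp: P_def)
        have "\<bar>\<omega> (Suc t) q - \<omega> t q\<bar> \<le> 12 * \<eta> * \<omega> (Suc t) q"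
          using x_product_drift[of t i b c] t i bc \<eta>1 by (simp add: \<omega>_def A_def)
        also have "\<dots> \<le> 1 / (24 * real K) * \<omega> (Suc t) q"
          using \<eta>K K1 x0[OF bc(2)] x0[OF bc(3)] by (intro mult_right_mono) (auto simp: field_simps \<omega>_def bc)
        finally show ?thesis .
      qed
      show "(\<Sum>q\<in>P. \<omega> t q) = 1" for t
        unfolding P_def \<omega>_def sum.cartesian_product[symmetric]
        by (simp add: x1 flip: sum_distrib_left)
      show "\<bar>fdiff k (z q) t\<bar> \<le> 2 * (\<alpha> * real K) ^ k"
        if k: "k \<le> K" and q: "q \<in> P" and t: "K + 1 \<le> t" for k q t
      proof -
        obtain b c where bc: "q = (b, c)" "b < A" "c < A" using q by (auto simp: P_def)
        obtain t' where t': "t = Suc t'" "K \<le> t'" using t by (cases t) auto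
        have sh: "fdiff k (\<lambda>t. l (t - 1) i b) t = fdiff k (\<lambda>t. l t i b) t'" for b
          using fdiff_shift[of k "\<lambda>t. l (t - 1) i b" 1 t'] t' by simp
        have B: "\<bar>fdiff k (\<lambda>t. l t i b) t'\<bar> \<le> (\<alpha> * real K) ^ k" if "b < A" for b
        proof -
          have "\<bar>fdiff k (\<lambda>t. l t i b) t'\<bar> \<le> diff_weight \<alpha> k" unfolding \<alpha>_def
            using k t' i that \<eta> by (intro fdiff_l_bound[of K]) (auto simp: A_def)
          also have "\<dots> \<le> (\<alpha> * real K) ^ k" by (rule diff_weight_le_power[OF \<alpha> k])
          finally show ?thesis .
        qed
        have "fdiff k (z q) t = fdiff k (\<lambda>t. l t i b) t' - fdiff k (\<lambda>t. l t i c) t'"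
          unfolding sh[symmetric] by (simp add: z_def bc fdiff_diff)
        then show ?thesis using B[OF bc(2)] B[OF bc(3)] by linarith
      qed
    qed
    moreover have "(\<Sum>q\<in>P. \<omega> t q * (fdiff 1 (z q) t)^2) = 2 * dv t"
      "(\<Sum>q\<in>P. \<omega> t q * (fdiff 0 (z q) t)^2) = 2 * pv t" for t
    proof -
      note pairs = wvar_pairs[of A "x t i", OF x0 x1]
      show "(\<Sum>q\<in>P. \<omega> t q * (fdiff 1 (z q) t)^2) = 2 * dv t"
        unfolding dv_def by (subst pairs) (auto intro!: sum.cong simp: P_def \<omega>_def z_def algebra_simps)
      show "(\<Sum>q\<in>P. \<omega> t q * (fdiff 0 (z q) t)^2) = 2 * pv t"
        unfolding pv_def by (subst pairs) (auto intro!: sum.cong simp: P_def \<omega>_def z_def)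
    qed
    then have "E 1 = (\<Sum>t=K+1..<L+1. 2 * dv t)" "E 0 = (\<Sum>t=K+1..<L+1. 2 * pv t)"
      unfolding E_def by simp_all
    ultimately have 1: "(\<Sum>t=K+1..<L+1. dv t) \<le> (\<Sum>t=K+1..<L+1. pv t) / 4 + 288 * (real K)^2"
      by (simp flip: sum_distrib_left)
    have "{1..L} = {1..K} \<union> {K+1..<L+1}" using True by auto
    then have "(\<Sum>t=1..L. dv t - pv t / 4) = (\<Sum>t=1..K. dv t - pv t / 4) + (\<Sum>t=K+1..<L+1. dv t - pv t / 4)"
      by (simp only:) (rule sum.union_disjoint, auto)
    also have "(\<Sum>t=1..K. dv t - pv t / 4) \<le> (\<Sum>t=1..K. 1)"
      using dv1 pv0 by (intro sum_mono) (smt (verit) divide_nonneg_nonneg)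
    also have "(\<Sum>t=K+1..<L+1. dv t - pv t / 4) \<le> 288 * (real K)^2"
      using 1 unfolding sum_subtractf sum_divide_distrib[symmetric] by linarith
    finally show ?thesis by simp
  qed
  have "(\<Sum>t=1..L. l t i a - wmean A (x t i) (l t i)) \<le> ln (real A) / \<eta> + \<eta> * (\<Sum>t=1..L. dv t - pv t / 4)"
    unfolding dv_def pv_def
  proof (rule optimistic_regret_le)
    show "x t i = softmax A (\<lambda>a. \<eta> * ((\<Sum>s = 1..<t. l s i a) + l (t - 1) i a))" if "1 \<le> t" for t
      using that by (simp add: x_def A_def F_def[abs_def])
  qed (use a i actions[OF i] \<eta>_pos \<eta>1 l_nonneg[OF i] l_le_1[OF i] in \<open>auto simp: A_def\<close>)
  also have "\<eta> * (\<Sum>t=1..L. dv t - pv t / 4) \<le> \<eta> * (real K + 288 * (real K)^2)"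
    using \<eta>_pos V by (intro mult_left_mono) auto
  \<comment> \<open>One factor \<eta> cancels one factor \<open>K\<close> of the quadratic bound, so
    the variance part costs only \<open>K\<close>.\<close>
  also have "\<dots> = (\<eta> * real K) * (1 + 288 * real K)" by (simp add: algebra_simps power2_eq_square)
  also have "\<dots> \<le> (1 / 6144) * (1 + 288 * real K)" using \<eta>K by (intro mult_right_mono) auto
  also have "\<dots> \<le> real K" using K1 by simp
  finally have R: "(\<Sum>t=1..L. l t i a - wmean A (x t i) (l t i)) \<le> ln (real A) / \<eta> + real K" by simp
  have "Qmix G Q (p t) h i s a - Qval G Q (p t) h i s = real (hor G) * (l t i a - wmean A (x t i) (l t i))" for t
  proof -
    have H: "real (hor G) > 0" using horizon by simp
    have q: "Qmix G Q (p t) h i s b = real (hor G) * l t i b" for b using H by (simp add: l_def)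
    show ?thesis unfolding Qval_Qmix[OF i] q wmean_def A_def right_diff_distrib sum_distrib_left
      by (auto intro!: sum.cong simp: x_eq[OF i])
  qed
  then have "(\<Sum>t=1..L. Qmix G Q (p t) h i s a - Qval G Q (p t) h i s)
     = real (hor G) * (\<Sum>t=1..L. l t i a - wmean A (x t i) (l t i))"
    by (simp add: sum_distrib_left)
  also have "\<dots> \<le> real (hor G) * (ln (real A) / \<eta> + real K)" by (intro mult_left_mono R) simp
  finally show ?thesis by (simp add: A_def)
qed

end

section \<open>Stages and the certified policy\<close>

text \<open>Stage-local clock. Index 0 stands for the uniform policy of the reset, so the first
  update follows the same formula as all others.\<close>

definition stage_iterate :: "mgame \<Rightarrow> qfun \<Rightarrow> real \<Rightarrow> nat \<Rightarrow> pol" where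
  "stage_iterate G Q \<eta> t = (if t = 0 then unif_pol G else last (stage_pols G Q \<eta> t))"

lemma stage_iterate_Suc:
  "stage_iterate G Q \<eta> (Suc m) = oftrl_step G Q \<eta> (stage_pols G Q \<eta> m) (stage_iterate G Q \<eta> m)"
  by (simp add: stage_iterate_def Let_def)

lemma stage_pols_eq: "stage_pols G Q \<eta> m = map (stage_iterate G Q \<eta>) [1..<Suc m]"
proof (induction m)
  case (Suc m)
  have "stage_pols G Q \<eta> (Suc m) = stage_pols G Q \<eta> m @ [stage_iterate G Q \<eta> (Suc m)]"
    by (simp add: stage_iterate_def Let_def)
  then show ?case using Suc by simp
qed simp

lemma stage_iterate_step:
  assumes "1 \<le> t"
  shows "stage_iterate G Q \<eta> t h i s = ftrl_pol G \<eta>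
    (\<lambda>b. (\<Sum>t'=1..<t. Qmix G Q (stage_iterate G Q \<eta> t') h i s b) + Qmix G Q (stage_iterate G Q \<eta> (t - 1)) h i s b) i"
proof -
  obtain m where m: "t = Suc m" using assms by (cases t) auto
  show ?thesis
    unfolding m stage_iterate_Suc oftrl_step_def stage_pols_eq
    by (simp add: comp_def interv_sum_list_conv_sum_set_nat del: upt_Suc)
qed

lemma ftrl_pol_act_simplex: "1 \<le> nact G i \<Longrightarrow> ftrl_pol G \<eta> loss i \<in> act_simplex G i"
  by (auto simp: ftrl_pol_softmax act_simplex_def softmax_sum intro: less_imp_le[OF softmax_pos])

lemma unif_pol_act_simplex: "1 \<le> nact G i \<Longrightarrow> unif_pol G h i s \<in> act_simplex G i"
  by (auto simp: unif_pol_def act_simplex_def)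

lemma stage_iterate_act_simplex: "1 \<le> nact G i \<Longrightarrow> stage_iterate G Q \<eta> t h i s \<in> act_simplex G i"
  by (cases "t = 0") (auto simp: stage_iterate_step ftrl_pol_act_simplex unif_pol_act_simplex stage_iterate_def[of _ _ _ 0])

section \<open>Growth of the stage lengths\<close>

lemma Lg_ge: "1 \<le> H \<Longrightarrow> H \<le> Lg H k"
proof (induction k)
  case (Suc k)
  have "real (Lg H k) \<le> (1 + 1 / real H) * real (Lg H k)" by (simp add: mult_le_cancel_right1)
  then have "Lg H k \<le> Lg H (Suc k)" by (simp add: le_nat_floor)
  then show ?case using Suc by simp
qed simp

lemma Lg_pos: "1 \<le> H \<Longrightarrow> 1 \<le> Lg H k"
  using Lg_ge[of H k] by simp

lemma Lg_Suc_le: "real (Lg H (Suc k)) \<le> (1 + 1 / real H) * real (Lg H k)"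
  by simp

text \<open>The floor is handled in integer units: once the length is at least \<open>m * H\<close>,
  each stage adds at least \<open>m\<close>. Hence \<open>H\<close> stages turn \<open>m * H\<close>
  into at least \<open>2 * m * H\<close>, which gives the doubling in
  \<open>Lg_exponential_growth\<close>.\<close>

lemma Lg_Suc_ge:
  assumes H: "1 \<le> H" and m: "m * H \<le> Lg H k" shows "Lg H k + m \<le> Lg H (Suc k)"
proof -
  have "real m * real H \<le> real (Lg H k)" using m by (metis of_nat_le_iff of_nat_mult)
  then have "real m \<le> real (Lg H k) / real H" using H by (simp add: field_simps)
  then have "real (Lg H k + m) \<le> (1 + 1 / real H) * real (Lg H k)" by (simp add: algebra_simps)
  then show ?thesis by (simp add: le_nat_floor del: of_nat_add)
qed

lemma Lg_add_ge:
  assumes H: "1 \<le> H" and m: "m * H \<le> Lg H k" shows "m * H + d * m \<le> Lg H (k + d)"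
proof (induction d)
  case (Suc d)
  then have "m * H \<le> Lg H (k + d)" by simp
  from Lg_Suc_ge[OF H this] Suc show ?case by simp
qed (use m in simp)

lemma Lg_exponential_growth: "1 \<le> H \<Longrightarrow> 2 ^ j * H \<le> Lg H (j * H)"
proof (induction j)
  case (Suc j)
  from Lg_add_ge[OF Suc.prems Suc.IH[OF Suc.prems], of H] show ?case by (simp add: algebra_simps)
qed simp

text \<open>Rounding down only helps, and \<open>(1 + 1 / H) ^ d\<close> is at most
  \<open>exp 1\<close>. Lengths within \<open>H\<close> stages of each other are thus
  comparable.\<close>

lemma Lg_add_le:
  assumes H: "1 \<le> H" and d: "d \<le> H" shows "real (Lg H (k + d)) \<le> 3 * real (Lg H k)"
proof -
  have "real (Lg H (k + d)) \<le> (1 + 1 / real H) ^ d * real (Lg H k)" for d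
  proof (induction d)
    case (Suc d)
    have "real (Lg H (k + Suc d)) \<le> (1 + 1 / real H) * real (Lg H (k + d))"
      using Lg_Suc_le[of H "k + d"] by simp
    also have "\<dots> \<le> (1 + 1 / real H) * ((1 + 1 / real H) ^ d * real (Lg H k))"
      by (intro mult_left_mono Suc) auto
    finally show ?case by (simp add: mult.assoc)
  qed simp
  also have "(1 + 1 / real H) ^ d \<le> exp (1 / real H) ^ d"
    using exp_ge_add_one_self[of "1 / real H"] by (intro power_mono) auto
  also have "\<dots> = exp (real d / real H)" by (simp flip: exp_of_nat_mult)
  also have "\<dots> \<le> exp 1" using H d by simp
  also have "\<dots> \<le> 3" by (rule exp_le)
  finally show ?thesis by (simp add: mult_right_mono)
qed

section \<open>Zero-based stages and their iterations\<close>

locale markov_game =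
  fixes G :: mgame and \<eta> :: "nat \<Rightarrow> real"
  assumes valid: "valid_game G"
begin

abbreviation "H \<equiv> hor G"
abbreviation "L \<equiv> Lg H"

text \<open>Stages are counted from 0: stage \<open>k\<close> occupies iterations
  \<open>T0 k + 1\<close> to \<open>T0 (Suc k)\<close>, where \<open>stage_of\<close> is
  \<open>k + 1\<close>. \<open>Qs k\<close>, \<open>ps k\<close> and \<open>V k\<close> are the
  estimate, the iterates and the averaged value of that stage.\<close>

definition T0 :: "nat \<Rightarrow> nat" where "T0 k = (\<Sum>k'<k. L k')"
definition Qs :: "nat \<Rightarrow> qfun" where "Qs k = fst (stage_data G \<eta> k)"
definition ps :: "nat \<Rightarrow> nat \<Rightarrow> pol" where "ps k = stage_iterate G (Qs k) (\<eta> (k + 1))"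
definition V :: "nat \<Rightarrow> nat \<Rightarrow> nat \<Rightarrow> nat \<Rightarrow> real" where
  "V k h i s = (\<Sum>j=1..L k. Qval G (Qs k) (ps k j) h i s) / real (L k)"

lemma H1: "1 \<le> H" and N1: "1 \<le> nag G" and act1: "i < nag G \<Longrightarrow> 1 \<le> nact G i"
  using valid by (auto simp: valid_game_def)

lemma finite_states [simp]: "finite (states G)" and init_state: "init G \<in> states G"
  using valid by (auto simp: valid_game_def)

lemma rew_bounds:
  assumes "h \<in> {1..H}" "i < nag G" "s \<in> states G" "a \<in> joint_actions G"
  shows "0 \<le> rew G h i s a" "rew G h i s a \<le> 1"
  using valid assms by (auto simp: valid_game_def)

lemma sum_trans:
  assumes "h \<in> {1..H}" "s \<in> states G" "a \<in> joint_actions G"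
  shows "(\<Sum>s'\<in>states G. pmf (trans G h s a) s') = 1"
  using valid assms by (intro sum_pmf_eq_1) (auto simp: valid_game_def)

lemma trans_mean_le:
  assumes "h \<in> {1..H}" "s \<in> states G" "a \<in> joint_actions G" "\<And>s'. s' \<in> states G \<Longrightarrow> f s' \<le> g s' + c"
  shows "(\<Sum>s'\<in>states G. pmf (trans G h s a) s' * f s') \<le> (\<Sum>s'\<in>states G. pmf (trans G h s a) s' * g s') + c"
proof -
  have "(\<Sum>s'\<in>states G. pmf (trans G h s a) s' * f s')
     \<le> (\<Sum>s'\<in>states G. pmf (trans G h s a) s' * (g s' + c))"
    using assms(4) by (intro sum_mono mult_left_mono) auto
  also have "\<dots> = (\<Sum>s'\<in>states G. pmf (trans G h s a) s' * g s') + c"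
    using sum_trans[OF assms(1-3)] by (simp add: distrib_left sum.distrib flip: sum_distrib_right)
  finally show ?thesis .
qed

lemma trans_mean_bounds:
  assumes "h \<in> {1..H}" "s \<in> states G" "a \<in> joint_actions G"
    "\<And>s'. s' \<in> states G \<Longrightarrow> 0 \<le> f s'" "\<And>s'. s' \<in> states G \<Longrightarrow> f s' \<le> c"
  shows "0 \<le> (\<Sum>s'\<in>states G. pmf (trans G h s a) s' * f s')"
    "(\<Sum>s'\<in>states G. pmf (trans G h s a) s' * f s') \<le> c"
proof -
  show "0 \<le> (\<Sum>s'\<in>states G. pmf (trans G h s a) s' * f s')" using assms(4) by (intro sum_nonneg) auto
  show "(\<Sum>s'\<in>states G. pmf (trans G h s a) s' * f s') \<le> c"
    using trans_mean_le[OF assms(1-3), of f "\<lambda>_. 0" c] assms(5) by simp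
qed

lemma L_pos: "1 \<le> L k" by (rule Lg_pos[OF H1])

lemma T0_Suc: "T0 (Suc k) = T0 k + L k" by (simp add: T0_def)

lemma T0_mono: "j \<le> k \<Longrightarrow> T0 j \<le> T0 k"
  unfolding T0_def by (rule sum_mono2) auto

lemma T0_ge: "k \<le> T0 k"
proof (induction k)
  case (Suc k) then show ?case using L_pos[of k] by (simp add: T0_Suc)
qed simp

lemma t_end_eq: "1 \<le> \<tau> \<Longrightarrow> t_end G \<tau> = T0 \<tau>"
  by (cases \<tau>) (auto simp: t_end_def t_start_def stage_len_def T0_Suc T0_def)

lemma t_start_eq: "t_start G \<tau> = Suc (T0 (\<tau> - 1))"
  by (simp add: t_start_def T0_def)

lemma stage_of_eq:
  assumes "T0 k < t" "t \<le> T0 (Suc k)" shows "stage_of G t = Suc k"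
proof -
  have "(LEAST \<tau>. 1 \<le> \<tau> \<and> t \<le> t_end G \<tau>) = Suc k"
  proof (rule Least_equality)
    show "1 \<le> Suc k \<and> t \<le> t_end G (Suc k)" using assms by (simp add: t_end_eq)
    fix \<tau> assume \<tau>: "1 \<le> \<tau> \<and> t \<le> t_end G \<tau>"
    then have "T0 k < T0 \<tau>" using assms t_end_eq[of \<tau>] by linarith
    then show "Suc k \<le> \<tau>" using T0_mono[of \<tau> k] by (meson not_less not_less_eq_eq)
  qed
  then show ?thesis using assms by (simp add: stage_of_def)
qed

lemma stage_exists:
  assumes "1 \<le> t" obtains k where "T0 k < t" "t \<le> T0 (Suc k)"
proof -
  define k where "k = (LEAST k. t \<le> T0 (Suc k))"
  have ex: "t \<le> T0 (Suc t)" using T0_ge[of "Suc t"] by simp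
  have 1: "t \<le> T0 (Suc k)" unfolding k_def by (rule LeastI[of _ t]) (rule ex)
  have "T0 k < t"
  proof (cases k)
    case 0 then show ?thesis using assms by (simp add: T0_def)
  next
    case (Suc k') then show ?thesis using not_less_Least[of k' "\<lambda>k. t \<le> T0 (Suc k)"] by (simp add: k_def)
  qed
  with 1 show ?thesis using that by blast
qed

lemma stage_data_pols: "snd (stage_data G \<eta> k) = map (ps k) [1..<Suc (L k)]"
  by (cases k) (auto simp: ps_def Qs_def stage_pols_eq Let_def simp del: upt_Suc Lg.simps)

lemma iter_pol_eq:
  assumes "1 \<le> j" "j \<le> L k" shows "iter_pol G \<eta> (T0 k + j) = ps k j"
proof -
  have "stage_of G (T0 k + j) = Suc k" using assms by (intro stage_of_eq) (auto simp: T0_Suc)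
  then show ?thesis using assms
    by (simp add: iter_pol_def t_start_eq stage_data_pols del: upt_Suc)
qed

lemma iter_pol_act_simplex: "i < nag G \<Longrightarrow> iter_pol G \<eta> t h i s \<in> act_simplex G i"
proof (cases "t = 0")
  case True
  then show "i < nag G \<Longrightarrow> iter_pol G \<eta> t h i s \<in> act_simplex G i"
    by (simp add: iter_pol_def unif_pol_act_simplex[OF act1])
next
  case False
  then obtain k where k: "T0 k < t" "t \<le> T0 (Suc k)" using stage_exists[of t] by auto
  then have "iter_pol G \<eta> t = ps k (t - T0 k)" using iter_pol_eq[of "t - T0 k" k] by (simp add: T0_Suc)
  then show "i < nag G \<Longrightarrow> iter_pol G \<eta> t h i s \<in> act_simplex G i"
    by (simp add: ps_def stage_iterate_act_simplex[OF act1])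
qed

lemma prev_stage_iters_eq:
  assumes "stage_of G t = k + 2"
  shows "prev_stage_iters G t = (\<lambda>j. T0 k + j) ` {1..L k}"
  using assms image_add_atLeastAtMost[of "T0 k" 1 "L k"]
  by (simp add: prev_stage_iters_def t_start_eq t_end_eq T0_Suc add.commute)

lemma stage_of_prev: "1 \<le> j \<Longrightarrow> j \<le> L k \<Longrightarrow> stage_of G (T0 k + j) = k + 1"
  using stage_of_eq[of k "T0 k + j"] by (simp add: T0_Suc)

lemma finite_prev_stage_iters: "finite (prev_stage_iters G t)"
  by (simp add: prev_stage_iters_def Let_def)

lemma prev_stage_iters_nonempty: "prev_stage_iters G t \<noteq> {}"
proof (cases "stage_of G t \<le> 1")
  case True then show ?thesis by (simp add: prev_stage_iters_def)
next
  case False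
  then obtain k where "stage_of G t = k + 2" by (metis add.commute le_add_diff_inverse not_le Suc_leI one_add_one plus_1_eq_Suc)
  then show ?thesis using L_pos[of k] by (simp add: prev_stage_iters_eq)
qed

section \<open>Action distributions and the range of values, with or without a deviation\<close>

definition player_mix :: "nat \<Rightarrow> dpol option \<Rightarrow> nat \<Rightarrow> nat \<Rightarrow> hist \<Rightarrow> nat \<Rightarrow> nat \<Rightarrow> real" where
  "player_mix i dev j h hs s = (case dev of None \<Rightarrow> iter_pol G \<eta> j h i s | Some \<sigma> \<Rightarrow> \<sigma> h hs s)"

lemma act_prob_eq:
  assumes "i < nag G"
  shows "act_prob G \<eta> i dev j h hs s a
     = player_mix i dev j h hs s (a i) * (\<Prod>k\<in>{0..<nag G} - {i}. iter_pol G \<eta> j h k s (a k))"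
  using assms by (cases dev) (auto simp: act_prob_def player_mix_def prod.remove[of "{0..<nag G}" i])

definition valid_dev :: "nat \<Rightarrow> dpol option \<Rightarrow> bool" where
  "valid_dev i dev \<longleftrightarrow> (case dev of None \<Rightarrow> True | Some \<sigma> \<Rightarrow> \<sigma> \<in> agent_policies G i)"

lemma player_mix_act_simplex: "i < nag G \<Longrightarrow> valid_dev i dev \<Longrightarrow> player_mix i dev j h hs s \<in> act_simplex G i"
  by (cases dev) (auto simp: valid_dev_def player_mix_def agent_policies_def iter_pol_act_simplex)

lemma act_prob_nonneg:
  assumes "i < nag G" "valid_dev i dev"
  shows "0 \<le> act_prob G \<eta> i dev j h hs s a"
  unfolding act_prob_eq[OF assms(1)]
  using player_mix_act_simplex[OF assms, of j h hs s] iter_pol_act_simplex[of _ j h s]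
  by (intro mult_nonneg_nonneg prod_nonneg) (auto simp: act_simplex_def)

lemma sum_act_prob:
  assumes "i < nag G" "valid_dev i dev"
  shows "(\<Sum>a\<in>joint_actions G. act_prob G \<eta> i dev j h hs s a) = 1"
proof -
  have "(\<Sum>a\<in>joint_actions G. act_prob G \<eta> i dev j h hs s a)
     = (\<Sum>b<nact G i. player_mix i dev j h hs s b * (\<Sum>a\<in>{a \<in> joint_actions G. a i = b}.
          \<Prod>k\<in>{0..<nag G} - {i}. iter_pol G \<eta> j h k s (a k)))"
    unfolding act_prob_eq[OF assms(1)] sum_joint_actions_fibers[OF assms(1)] sum_distrib_left
    by (intro sum.cong refl) auto
  also have "\<dots> = (\<Sum>b<nact G i. player_mix i dev j h hs s b)"
  proof (intro sum.cong refl)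
    fix b assume "b \<in> {..<nact G i}"
    then have "(\<Sum>a\<in>{a \<in> joint_actions G. a i = b}. \<Prod>k\<in>{0..<nag G} - {i}. iter_pol G \<eta> j h k s (a k))
        = (\<Prod>k\<in>{0..<nag G} - {i}. \<Sum>c<nact G k. iter_pol G \<eta> j h k s c)"
      by (intro sum_prod_opponents[OF assms(1)]) simp
    also have "\<dots> = 1" using iter_pol_act_simplex[of _ j h s] by (intro prod.neutral) (auto simp: act_simplex_def)
    finally show "player_mix i dev j h hs s b * (\<Sum>a\<in>{a \<in> joint_actions G. a i = b}.
          \<Prod>k\<in>{0..<nag G} - {i}. iter_pol G \<eta> j h k s (a k)) = player_mix i dev j h hs s b" by simp
  qed
  also have "\<dots> = 1" using player_mix_act_simplex[OF assms] by (simp add: act_simplex_def)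
  finally show ?thesis .
qed

lemma Wv_bounds:
  assumes "i < nag G" "valid_dev i dev"
  shows "n \<le> H \<Longrightarrow> s \<in> states G \<Longrightarrow> 0 \<le> Wv G \<eta> i dev n hs t s \<and> Wv G \<eta> i dev n hs t s \<le> real n"
proof (induction n arbitrary: hs t s)
  case (Suc n)
  define h where "h = H - n"
  have h: "h \<in> {1..H}" using Suc.prems by (auto simp: h_def)
  define J where "J = prev_stage_iters G t"
  define f where "f = (\<lambda>j a. rew G h i s a + (\<Sum>s'\<in>states G. pmf (trans G h s a) s' * Wv G \<eta> i dev n (hs @ [(s, a)]) j s'))"
  have f: "0 \<le> f j a \<and> f j a \<le> real (Suc n)" if a: "a \<in> joint_actions G" for j a
    using rew_bounds[OF h assms(1) Suc.prems(2) a]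
      trans_mean_bounds[OF h Suc.prems(2) a, of "Wv G \<eta> i dev n (hs @ [(s, a)]) j" "real n"] Suc
    unfolding f_def by force
  have J: "card J > 0" unfolding J_def
    by (simp add: card_gt_0_iff finite_prev_stage_iters prev_stage_iters_nonempty)
  have W: "Wv G \<eta> i dev (Suc n) hs t s
      = (1 / real (card J)) * (\<Sum>j\<in>J. \<Sum>a\<in>joint_actions G. act_prob G \<eta> i dev j h hs s a * f j a)"
    by (simp add: Let_def J_def h_def f_def)
  have m: "0 \<le> (\<Sum>a\<in>joint_actions G. act_prob G \<eta> i dev j h hs s a * f j a)"
    "(\<Sum>a\<in>joint_actions G. act_prob G \<eta> i dev j h hs s a * f j a) \<le> real (Suc n)" for j
  proof -
    show "0 \<le> (\<Sum>a\<in>joint_actions G. act_prob G \<eta> i dev j h hs s a * f j a)"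
      using f act_prob_nonneg[OF assms] by (intro sum_nonneg mult_nonneg_nonneg) auto
    have "(\<Sum>a\<in>joint_actions G. act_prob G \<eta> i dev j h hs s a * f j a)
       \<le> (\<Sum>a\<in>joint_actions G. act_prob G \<eta> i dev j h hs s a * real (Suc n))"
      using f act_prob_nonneg[OF assms] by (intro sum_mono mult_left_mono) auto
    also have "\<dots> = real (Suc n)" by (simp add: sum_act_prob[OF assms] flip: sum_distrib_right)
    finally show "(\<Sum>a\<in>joint_actions G. act_prob G \<eta> i dev j h hs s a * f j a) \<le> real (Suc n)" .
  qed
  have "(\<Sum>j\<in>J. \<Sum>a\<in>joint_actions G. act_prob G \<eta> i dev j h hs s a * f j a) \<le> (\<Sum>j\<in>J. real (Suc n))"
    by (intro sum_mono m)
  then have "(\<Sum>j\<in>J. \<Sum>a\<in>joint_actions G. act_prob G \<eta> i dev j h hs s a * f j a) \<le> real (card J) * real (Suc n)"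
    by simp
  then have "Wv G \<eta> i dev (Suc n) hs t s \<le> real (Suc n)"
    unfolding W using J by (simp add: field_simps)
  moreover have "0 \<le> Wv G \<eta> i dev (Suc n) hs t s"
    unfolding W by (intro mult_nonneg_nonneg sum_nonneg[of J] m(1)) simp
  ultimately show ?case by blast
qed simp

lemma Wv_Suc:
  assumes t: "stage_of G t = k + 2"
  shows "Wv G \<eta> i dev (Suc n) hs t s = (\<Sum>j=1..L k. \<Sum>a\<in>joint_actions G.
     act_prob G \<eta> i dev (T0 k + j) (H - n) hs s a * (rew G (H - n) i s a
       + (\<Sum>s'\<in>states G. pmf (trans G (H - n) s a) s' * Wv G \<eta> i dev n (hs @ [(s, a)]) (T0 k + j) s'))) / real (L k)"
proof -
  have inj: "inj_on (\<lambda>j. T0 k + j) {1..L k}" by simp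
  show ?thesis
    unfolding Wv.simps Let_def prev_stage_iters_eq[OF t] card_image[OF inj]
    by (subst sum.reindex[OF inj]) simp
qed

section \<open>Bellman recursion for estimates, values and deviation gains\<close>

lemma Qs_0: "Qs 0 h i s a = 0" by (simp add: Qs_def)

lemma Qs_beyond: "H < h \<Longrightarrow> Qs k h i s a = 0"
  by (cases k) (auto simp: Qs_def value_update_def Let_def)

lemma V_beyond: "H < h \<Longrightarrow> V k h i s = 0"
  by (simp add: V_def Qval_def Qs_beyond)

text \<open>By linearity the average over a stage moves inside the transition mean, so a value
  update is one Bellman backup of the averaged value \<open>V k\<close>.\<close>

lemma Qs_Suc:
  assumes "h \<in> {1..H}"
  shows "Qs (Suc k) h i s a = rew G h i s a + (\<Sum>s'\<in>states G. pmf (trans G h s a) s' * V k (h + 1) i s')"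
proof -
  have L: "real (L k) > 0" using L_pos[of k] by simp
  have "Qs (Suc k) h i s a = (1 / real (L k)) * (\<Sum>j=1..L k. rew G h i s a
      + (\<Sum>s'\<in>states G. pmf (trans G h s a) s' * Qval G (Qs k) (ps k j) (h + 1) i s'))"
    using assms by (simp add: Qs_def Let_def value_update_def stage_data_pols comp_def
        interv_sum_list_conv_sum_set_nat atLeastLessThanSuc_atLeastAtMost del: upt_Suc)
  also have "\<dots> = rew G h i s a + (1 / real (L k)) * (\<Sum>j=1..L k.
      \<Sum>s'\<in>states G. pmf (trans G h s a) s' * Qval G (Qs k) (ps k j) (h + 1) i s')"
    using L by (simp add: sum.distrib distrib_left)
  also have "(\<Sum>j=1..L k. \<Sum>s'\<in>states G. pmf (trans G h s a) s' * Qval G (Qs k) (ps k j) (h + 1) i s')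
     = (\<Sum>s'\<in>states G. \<Sum>j=1..L k. pmf (trans G h s a) s' * Qval G (Qs k) (ps k j) (h + 1) i s')"
    by (rule sum.swap)
  also have "(1 / real (L k)) * \<dots> = (\<Sum>s'\<in>states G. pmf (trans G h s a) s' * V k (h + 1) i s')"
    by (simp add: V_def sum_distrib_left sum_divide_distrib)
  finally show ?thesis .
qed

lemma Qval_bounds:
  assumes i: "i < nag G" and Q: "\<And>a. a \<in> joint_actions G \<Longrightarrow> 0 \<le> Q h i s a \<and> Q h i s a \<le> c"
  shows "0 \<le> Qval G Q (ps k j) h i s" "Qval G Q (ps k j) h i s \<le> c"
proof -
  define p where "p = (\<lambda>a. \<Prod>m\<in>{0..<nag G}. ps k j h m s (a m))"
  have simplex: "ps k j h m s \<in> act_simplex G m" if "m < nag G" for m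
    unfolding ps_def by (rule stage_iterate_act_simplex[OF act1[OF that]])
  have p0: "0 \<le> p a" for a unfolding p_def using simplex by (intro prod_nonneg) (auto simp: act_simplex_def)
  have "(\<Sum>a\<in>joint_actions G. p a) = (\<Prod>m\<in>{0..<nag G}. \<Sum>b\<in>{0..<nact G m}. ps k j h m s b)"
    unfolding p_def joint_actions_def by (rule prod_sum_PiE[symmetric]) auto
  also have "\<dots> = 1" using simplex by (simp add: act_simplex_def lessThan_atLeast0)
  finally have p1: "(\<Sum>a\<in>joint_actions G. p a) = 1" .
  have Qv: "Qval G Q (ps k j) h i s = (\<Sum>a\<in>joint_actions G. Q h i s a * p a)"
    by (simp add: Qval_def p_def)
  show "0 \<le> Qval G Q (ps k j) h i s"
    unfolding Qv using Q p0 by (intro sum_nonneg) auto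
  have "Qval G Q (ps k j) h i s \<le> (\<Sum>a\<in>joint_actions G. c * p a)"
    unfolding Qv using Q p0 by (intro sum_mono mult_right_mono) auto
  then show "Qval G Q (ps k j) h i s \<le> c" by (simp add: p1 flip: sum_distrib_left)
qed

lemma Qs_bounds:
  assumes "i < nag G"
  shows "h \<in> {1..H} \<Longrightarrow> s \<in> states G \<Longrightarrow> a \<in> joint_actions G \<Longrightarrow> 0 \<le> Qs k h i s a \<and> Qs k h i s a \<le> real (H + 1 - h)"
proof (induction k arbitrary: h s a)
  case 0 then show ?case by (simp add: Qs_0)
next
  case (Suc k)
  have V: "0 \<le> V k (h + 1) i s' \<and> V k (h + 1) i s' \<le> real (H - h)" if s': "s' \<in> states G" for s'
  proof (cases "h = H")
    case True then show ?thesis by (simp add: V_beyond)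
  next
    case False
    then have h: "h + 1 \<in> {1..H}" using Suc.prems by auto
    have q: "0 \<le> Qval G (Qs k) (ps k j) (h + 1) i s'" "Qval G (Qs k) (ps k j) (h + 1) i s' \<le> real (H - h)" for j
      using Suc.IH[OF h s'] by (auto intro!: Qval_bounds[OF assms])
    have "(\<Sum>j=1..L k. Qval G (Qs k) (ps k j) (h + 1) i s') \<le> (\<Sum>j=1..L k. real (H - h))"
      by (intro sum_mono q)
    then have "V k (h + 1) i s' \<le> real (H - h)"
      unfolding V_def using L_pos[of k] by (simp add: divide_le_eq mult.commute)
    moreover have "0 \<le> V k (h + 1) i s'" unfolding V_def using q by (intro divide_nonneg_nonneg sum_nonneg) auto
    ultimately show ?thesis by blast
  qed
  have "real (H + 1 - h) = 1 + real (H - h)" using Suc.prems by (simp add: of_nat_diff)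
  then show ?case
    using rew_bounds[OF Suc.prems(1) assms Suc.prems(2,3)] V
      trans_mean_bounds[OF Suc.prems, of "\<lambda>s'. V k (h + 1) i s'" "real (H - h)"]
    unfolding Qs_Suc[OF Suc.prems(1)] by force
qed

text \<open>Each step of the output policy moves one stage back, just as \<open>Qs (Suc k)\<close>
  is built from \<open>V k\<close>. The condition \<open>n \<le> k\<close> keeps the initial
  estimate \<open>Qs 0\<close>, which is no policy's value, out of the recursion.\<close>

lemma Wv_None_eq_V:
  "n \<le> H \<Longrightarrow> n \<le> k \<Longrightarrow> stage_of G t = k + 2 \<Longrightarrow> Wv G \<eta> i None n hs t s = V k (H + 1 - n) i s"
proof (induction n arbitrary: k t hs s)
  case 0 then show ?case by (simp add: V_beyond)
next
  case (Suc n)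
  obtain k' where k: "k = Suc k'" using Suc.prems by (cases k) auto
  have h: "H - n \<in> {1..H}" and h1: "H - n + 1 = H + 1 - n" "H + 1 - Suc n = H - n"
    using Suc.prems by auto
  have "Wv G \<eta> i None (Suc n) hs t s = (\<Sum>j=1..L k. Qval G (Qs k) (ps k j) (H - n) i s) / real (L k)"
    unfolding Wv_Suc[OF Suc.prems(3)]
  proof (intro arg_cong2[where f = "(/)"] sum.cong refl)
    fix j assume j: "j \<in> {1..L k}"
    have next_stage: "stage_of G (T0 k + j) = k' + 2" using j stage_of_prev[of j k] by (simp add: k)
    have "Wv G \<eta> i None n hs' (T0 k + j) s' = V k' (H - n + 1) i s'" for hs' s'
      unfolding h1 using Suc.prems by (intro Suc.IH next_stage) (auto simp: k)
    then show "(\<Sum>a\<in>joint_actions G. act_prob G \<eta> i None (T0 k + j) (H - n) hs s a *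
         (rew G (H - n) i s a + (\<Sum>s'\<in>states G. pmf (trans G (H - n) s a) s' * Wv G \<eta> i None n (hs @ [(s, a)]) (T0 k + j) s')))
       = Qval G (Qs k) (ps k j) (H - n) i s"
      using j iter_pol_eq[of j k] unfolding Qval_def k Qs_Suc[OF h]
      by (simp add: act_prob_def mult.commute)
  qed
  then show ?case by (simp add: V_def h1)
qed

text \<open>The bound on the future gain is uniform in the history and in the index sampled within a
  stage. It is therefore a constant \<open>D\<close> that passes through all averages, and each step
  adds only the regret of its own stage.\<close>

lemma deviation_gain_le:
  assumes i: "i < nag G" and dev: "\<sigma> \<in> agent_policies G i"
    and R: "\<And>k h s b. k \<le> k0 \<Longrightarrow> h \<in> {1..H} \<Longrightarrow> s \<in> states G \<Longrightarrow> b < nact G i \<Longrightarrow>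
      (\<Sum>j=1..L k. Qmix G (Qs k) (ps k j) h i s b - Qval G (Qs k) (ps k j) h i s) \<le> real (L k) * R k"
  shows "n \<le> H \<Longrightarrow> n \<le> k \<Longrightarrow> k \<le> k0 \<Longrightarrow> stage_of G t = k + 2 \<Longrightarrow> s \<in> states G \<Longrightarrow>
    Wv G \<eta> i (Some \<sigma>) n hs t s \<le> V k (H + 1 - n) i s + (\<Sum>m<n. R (k - m))"
proof (induction n arbitrary: k t hs s)
  case 0 then show ?case by (simp add: V_beyond)
next
  case (Suc n)
  obtain k' where k: "k = Suc k'" using Suc.prems by (cases k) auto
  define h where "h = H - n"
  have h: "h \<in> {1..H}" and h1: "h + 1 = H + 1 - n" "H + 1 - Suc n = h"
    using Suc.prems by (auto simp: h_def)
  define D where "D = (\<Sum>m<n. R (k' - m))"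
  have vd: "valid_dev i (Some \<sigma>)" using dev by (simp add: valid_dev_def)
  have L: "real (L k) > 0" using L_pos[of k] by simp
  have sigma: "\<sigma> h hs s \<in> act_simplex G i" using dev by (simp add: agent_policies_def)
  have step: "(\<Sum>a\<in>joint_actions G. act_prob G \<eta> i (Some \<sigma>) (T0 k + j) h hs s a *
         (rew G h i s a + (\<Sum>s'\<in>states G. pmf (trans G h s a) s' * Wv G \<eta> i (Some \<sigma>) n (hs @ [(s, a)]) (T0 k + j) s')))
       \<le> (\<Sum>b<nact G i. \<sigma> h hs s b * Qmix G (Qs k) (ps k j) h i s b) + D" if j: "j \<in> {1..L k}" for j
  proof -
    have next_stage: "stage_of G (T0 k + j) = k' + 2" using j stage_of_prev[of j k] by (simp add: k)
    have IH: "Wv G \<eta> i (Some \<sigma>) n hs' (T0 k + j) s' \<le> V k' (h + 1) i s' + D" if "s' \<in> states G" for hs' s'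
      unfolding h1 D_def using Suc.prems that by (intro Suc.IH next_stage) (auto simp: k)
    have "(\<Sum>a\<in>joint_actions G. act_prob G \<eta> i (Some \<sigma>) (T0 k + j) h hs s a *
         (rew G h i s a + (\<Sum>s'\<in>states G. pmf (trans G h s a) s' * Wv G \<eta> i (Some \<sigma>) n (hs @ [(s, a)]) (T0 k + j) s')))
      \<le> (\<Sum>a\<in>joint_actions G. act_prob G \<eta> i (Some \<sigma>) (T0 k + j) h hs s a * (Qs k h i s a + D))"
    proof (intro sum_mono mult_left_mono act_prob_nonneg[OF i vd])
      fix a assume a: "a \<in> joint_actions G"
      show "rew G h i s a + (\<Sum>s'\<in>states G. pmf (trans G h s a) s' * Wv G \<eta> i (Some \<sigma>) n (hs @ [(s, a)]) (T0 k + j) s')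
        \<le> Qs k h i s a + D"
        unfolding k Qs_Suc[OF h]
        using trans_mean_le[OF h Suc.prems(5) a IH[where hs' = "hs @ [(s, a)]"]] by (simp add: k)
    qed
    also have "\<dots> = (\<Sum>a\<in>joint_actions G. act_prob G \<eta> i (Some \<sigma>) (T0 k + j) h hs s a * Qs k h i s a) + D"
      using sum_act_prob[OF i vd] by (simp add: distrib_left sum.distrib flip: sum_distrib_right)
    also have "(\<Sum>a\<in>joint_actions G. act_prob G \<eta> i (Some \<sigma>) (T0 k + j) h hs s a * Qs k h i s a)
      = (\<Sum>b<nact G i. \<sigma> h hs s b * Qmix G (Qs k) (ps k j) h i s b)"
      using sum_joint_deviation[OF i, of "\<sigma> h hs s" "ps k j" h s "Qs k"] j iter_pol_eq[of j k]
      by (simp add: act_prob_def)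
    finally show ?thesis .
  qed
  \<comment> \<open>The mixture of the deviator does not depend on \<open>j\<close>, so it can be
    pulled out of the average over the stage. Regret against each fixed action then
    suffices.\<close>
  have "(\<Sum>j=1..L k. \<Sum>b<nact G i. \<sigma> h hs s b * Qmix G (Qs k) (ps k j) h i s b)
     = (\<Sum>b<nact G i. \<sigma> h hs s b * (\<Sum>j=1..L k. Qmix G (Qs k) (ps k j) h i s b))"
    by (subst sum.swap) (simp add: sum_distrib_left)
  also have "\<dots> \<le> (\<Sum>b<nact G i. \<sigma> h hs s b * (real (L k) * (V k h i s + R k)))"
  proof (intro sum_mono mult_left_mono)
    fix b assume "b \<in> {..<nact G i}"
    then show "(\<Sum>j=1..L k. Qmix G (Qs k) (ps k j) h i s b) \<le> real (L k) * (V k h i s + R k)"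
      using R[OF Suc.prems(3) h Suc.prems(5), of b] L by (simp add: V_def sum_subtractf distrib_left)
    show "0 \<le> \<sigma> h hs s b" using sigma by (simp add: act_simplex_def)
  qed
  also have "\<dots> = real (L k) * (V k h i s + R k)"
    using sigma by (simp add: act_simplex_def flip: sum_distrib_right)
  finally have mix: "(\<Sum>j=1..L k. \<Sum>b<nact G i. \<sigma> h hs s b * Qmix G (Qs k) (ps k j) h i s b)
     \<le> real (L k) * (V k h i s + R k)" .
  have "Wv G \<eta> i (Some \<sigma>) (Suc n) hs t s
     \<le> (\<Sum>j=1..L k. (\<Sum>b<nact G i. \<sigma> h hs s b * Qmix G (Qs k) (ps k j) h i s b) + D) / real (L k)"
    unfolding Wv_Suc[OF Suc.prems(4)] h_def[symmetric] using step by (intro divide_right_mono sum_mono) auto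
  also have "\<dots> \<le> (real (L k) * (V k h i s + R k) + real (L k) * D) / real (L k)"
    using mix by (intro divide_right_mono) (auto simp: sum.distrib)
  also have "\<dots> = V k h i s + (R k + D)" using L by (simp add: field_simps)
  also have "R k + D = (\<Sum>m<Suc n. R (k - m))"
    unfolding sum.lessThan_Suc_shift by (simp add: D_def k)
  finally show ?case unfolding h1(2) .
qed

lemma stage_regret_le:
  assumes i: "i < nag G" and h: "h \<in> {1..H}" and s: "s \<in> states G" and b: "b < nact G i"
    and \<eta>: "0 < \<eta> (k + 1)" "6144 * real (nag G) * \<eta> (k + 1) * real K \<le> 1"
    and K: "1 \<le> K" "real (L k) \<le> exp (real K)"
  shows "(\<Sum>j=1..L k. Qmix G (Qs k) (ps k j) h i s b - Qval G (Qs k) (ps k j) h i s)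
    \<le> real H * (ln (real (nact G i)) / \<eta> (k + 1) + real K)"
proof -
  have "oftrl_stage G (Qs k) h s (\<eta> (k + 1)) (ps k)"
  proof
    show "0 \<le> Qs k h j s a" "Qs k h j s a \<le> real H" if "j < nag G" "a \<in> joint_actions G" for j a
      using Qs_bounds[OF that(1) h s that(2), of k] h by (auto simp: of_nat_diff)
    show "ps k 0 = unif_pol G" by (simp add: ps_def stage_iterate_def)
    show "ps k t h j s = ftrl_pol G (\<eta> (k + 1)) (\<lambda>b. (\<Sum>t'=1..<t. Qmix G (Qs k) (ps k t') h j s b)
        + Qmix G (Qs k) (ps k (t - 1)) h j s b) j" if "1 \<le> t" for t j
      unfolding ps_def by (rule stage_iterate_step[OF that])
  qed (use N1 act1 H1 \<eta> in auto)
  then show ?thesis by (rule oftrl_stage.regret_le[OF _ K \<eta>(2) i b])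
qed

section \<open>Counting stages and summing the gains\<close>

lemma nact_le_Amax: "i < nag G \<Longrightarrow> nact G i \<le> Amax G"
  unfolding Amax_def by (rule Max_ge) auto

lemma L_le_T0: "k < m \<Longrightarrow> L k \<le> T0 m"
  using T0_mono[of "Suc k" m] by (simp add: T0_Suc)

text \<open>A stage of length \<open>L k\<close> contains at most \<open>L k\<close> of the
  iterations, so each stage that is met contributes at most 1.\<close>

lemma sum_inverse_stage_length_le:
  "(\<Sum>t=1..T. 1 / real (L (stage_of G t - 1))) \<le> real (card ((\<lambda>t. stage_of G t - 1) ` {1..T}))"
proof -
  let ?q = "\<lambda>t. stage_of G t - 1"
  have "(\<Sum>t=1..T. 1 / real (L (?q t))) = (\<Sum>k\<in>?q ` {1..T}. \<Sum>t\<in>{t \<in> {1..T}. ?q t = k}. 1 / real (L (?q t)))"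
    by (rule sum.group[symmetric]) auto
  also have "\<dots> \<le> (\<Sum>k\<in>?q ` {1..T}. 1)"
  proof (rule sum_mono)
    fix k
    have "{t \<in> {1..T}. ?q t = k} \<subseteq> {T0 k<..T0 (Suc k)}"
    proof safe
      fix t assume "t \<in> {1..T}" and k: "k = ?q t"
      then obtain k' where "T0 k' < t" "t \<le> T0 (Suc k')" using stage_exists[of t] by auto
      moreover from this have "?q t = k'" by (simp add: stage_of_eq)
      ultimately show "t \<in> {T0 (?q t)<..T0 (Suc (?q t))}" by simp
    qed
    then have "card {t \<in> {1..T}. ?q t = k} \<le> card {T0 k<..T0 (Suc k)}" by (intro card_mono) auto
    then have c: "card {t \<in> {1..T}. ?q t = k} \<le> L k" by (simp add: T0_Suc)
    have "(\<Sum>t\<in>{t \<in> {1..T}. ?q t = k}. 1 / real (L (?q t))) = real (card {t \<in> {1..T}. ?q t = k}) / real (L k)"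
      by simp
    also have "\<dots> \<le> 1" using c L_pos[of k] by (simp add: divide_le_eq)
    finally show "(\<Sum>t\<in>{t \<in> {1..T}. ?q t = k}. 1 / real (L (?q t))) \<le> 1" .
  qed
  finally show ?thesis by simp
qed

text \<open>Lengths double every \<open>H\<close> stages, and every stage before the current one is
  complete and hence no longer than \<open>T\<close>. This bounds the number of doublings by the
  binary logarithm of \<open>T\<close>; the rounding is absorbed since that logarithm is at least
  1.\<close>

lemma stage_count_le:
  assumes T: "2 \<le> T"
  shows "real (card ((\<lambda>t. stage_of G t - 1) ` {1..T})) \<le> 3 * real H * (ln (real T) / ln 2)"
proof -
  let ?q = "\<lambda>t. stage_of G t - 1"
  define lg where "lg = ln (real T) / ln 2"
  have lg1: "1 \<le> lg" using T by (simp add: lg_def)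
  have H: "1 \<le> real H" using H1 by simp
  have q: "real (?q t) \<le> real H * (lg + 1)" if t: "t \<in> {1..T}" for t
  proof -
    obtain k where k: "T0 k < t" "t \<le> T0 (Suc k)" using stage_exists[of t] t by auto
    then have qt: "?q t = k" by (simp add: stage_of_eq)
    show ?thesis
    proof (cases k)
      case 0 then show ?thesis using lg1 unfolding qt by simp
    next
      case (Suc k')
      define j where "j = k' div H"
      have "2 ^ j * H \<le> Lg H (j * H)" by (rule Lg_exponential_growth[OF H1])
      also have "\<dots> \<le> T0 k" by (rule L_le_T0) (simp add: Suc j_def less_Suc_eq_le)
      also have "\<dots> \<le> T" using k t by simp
      finally have "2 ^ j * 1 \<le> T" using H1 by (meson le_trans mult_le_mono2)
      then have "real (2 ^ j) \<le> real T" by (simp only: of_nat_le_iff mult_1_right)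
      then have "ln (2 ^ j) \<le> ln (real T)" by (subst ln_le_cancel_iff) (use T in auto)
      then have "real j * ln 2 \<le> ln (real T)" by (simp add: ln_realpow)
      then have j: "real j \<le> lg" by (simp add: lg_def field_simps)
      have "k' mod H < H" using H1 by simp
      then have "k \<le> j * H + H" using div_mult_mod_eq[of k' H] unfolding Suc j_def by linarith
      then have "real k \<le> real (j * H + H)" by (rule of_nat_mono)
      also have "\<dots> = real H * (real j + 1)" by (simp add: algebra_simps)
      also have "\<dots> \<le> real H * (lg + 1)" using j by (intro mult_left_mono) auto
      finally show ?thesis unfolding qt .
    qed
  qed
  define M where "M = Max (?q ` {1..T})"
  have "M \<in> ?q ` {1..T}" unfolding M_def using T by (intro Max_in) auto
  then have M: "real M \<le> real H * (lg + 1)" using q by auto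
  have "?q ` {1..T} \<subseteq> {..M}" unfolding M_def using Max_ge[of "?q ` {1..T}"] by auto
  then have "card (?q ` {1..T}) \<le> card {..M}" by (rule card_mono[rotated]) simp
  then have "real (card (?q ` {1..T})) \<le> real M + 1" by simp
  also have "\<dots> \<le> real H * (lg + 1) + real H * 1" using M H by simp
  also have "\<dots> = real H * (lg + 2)" by (simp add: algebra_simps)
  also have "\<dots> \<le> real H * (3 * lg)" using lg1 by (intro mult_left_mono) auto
  finally show ?thesis unfolding lg_def by (simp only: mult.assoc mult.left_commute)
qed

lemma T0_early: "T0 (Suc H) \<le> 6 * H^2"
proof -
  have "real (T0 (Suc H)) = (\<Sum>k\<le>H. real (L k))" by (simp add: T0_def lessThan_Suc_atMost)
  also have "\<dots> \<le> (\<Sum>k\<le>H. 3 * real H)" using Lg_add_le[OF H1, of _ 0] by (intro sum_mono) auto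
  also have "\<dots> = 3 * (real H + 1) * real H" by simp
  also have "\<dots> \<le> 3 * (real H + real H) * real H" using H1 by (intro mult_right_mono mult_left_mono) auto
  also have "\<dots> = real (6 * H^2)" by (simp add: power2_eq_square)
  finally show ?thesis by (simp only: of_nat_le_iff)
qed

lemma deviation_gain_sum_le:
  assumes T: "2 \<le> T" and i: "i < nag G" and \<sigma>: "\<sigma> \<in> agent_policies G i" and B: "0 \<le> B"
    and R: "\<And>k h s b. L k \<le> T \<Longrightarrow> h \<in> {1..H} \<Longrightarrow> s \<in> states G \<Longrightarrow> b < nact G i \<Longrightarrow>
      (\<Sum>j=1..L k. Qmix G (Qs k) (ps k j) h i s b - Qval G (Qs k) (ps k j) h i s) \<le> B"
  shows "Vout G \<eta> T i (Some \<sigma>) - Vout G \<eta> T i None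
    \<le> (6 * real H ^ 3 + 9 * real H ^ 2 * B * (ln (real T) / ln 2)) / real T"
proof -
  let ?q = "\<lambda>t. stage_of G t - 1"
  define g where "g = (\<lambda>t. Wv G \<eta> i (Some \<sigma>) H [] t (init G) - Wv G \<eta> i None H [] t (init G))"
  \<comment> \<open>The recursion needs \<open>H\<close> stages of valid estimates behind it.
    Iterations before that get the trivial bound \<open>H\<close>; there are at most
    \<open>6 * H^2\<close> of them, which yields the term \<open>6 * H^3\<close>.\<close>
  have g: "g t \<le> (if ?q t \<le> H then real H else 0) + 3 * real H * B * (1 / real (L (?q t)))" if t: "t \<in> {1..T}" for t
  proof (cases "?q t \<le> H")
    case True
    have "g t \<le> real H"
      using Wv_bounds[OF i, of "Some \<sigma>" H "init G" "[]" t] Wv_bounds[OF i, of None H "init G" "[]" t] \<sigma>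
      by (simp add: g_def valid_dev_def init_state)
    then show ?thesis using True B by (simp add: add_increasing2)
  next
    case False
    define k where "k = ?q t - 1"
    have k: "?q t = k + 1" "H \<le> k" using False by (auto simp: k_def)
    then have st: "stage_of G t = k + 2" by simp
    obtain k' where k': "T0 k' < t" "t \<le> T0 (Suc k')" using stage_exists[of t] t by auto
    have T0t: "T0 (k + 1) < t" using k' st stage_of_eq[OF k'] by simp
    \<comment> \<open>Every stage that enters the recursion is complete before \<open>t\<close>, so
      its length is at most \<open>T\<close> and the regret hypothesis covers it.\<close>
    have LT: "L m \<le> T" if "m \<le> k" for m using L_le_T0[of m "k + 1"] that T0t t by simp
    have "Wv G \<eta> i (Some \<sigma>) H [] t (init G) \<le> V k (H + 1 - H) i (init G) + (\<Sum>m<H. B / real (L (k - m)))"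
    proof (rule deviation_gain_le[OF i \<sigma> _ order_refl k(2) order_refl st init_state])
      fix m h s b assume m: "m \<le> k" and a: "h \<in> {1..H}" "s \<in> states G" "b < nact G i"
      show "(\<Sum>j=1..L m. Qmix G (Qs m) (ps m j) h i s b - Qval G (Qs m) (ps m j) h i s)
          \<le> real (L m) * (B / real (L m))"
        using R[OF LT[OF m] a] L_pos[of m] by simp
    qed
    then have "g t \<le> (\<Sum>m<H. B / real (L (k - m)))"
      by (simp add: g_def Wv_None_eq_V[OF order_refl k(2) st])
    also have "\<dots> \<le> (\<Sum>m<H. 3 * B / real (L (k + 1)))"
    proof (rule sum_mono)
      fix m assume m: "m \<in> {..<H}"
      have "real (L (k - m + (m + 1))) \<le> 3 * real (L (k - m))" using m by (intro Lg_add_le[OF H1]) auto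
      then have "real (L (k + 1)) \<le> 3 * real (L (k - m))" using m k(2) by simp
      then have "B * real (L (k + 1)) \<le> B * (3 * real (L (k - m)))" using B by (intro mult_left_mono)
      moreover have pos: "real (L n) > 0" for n using L_pos[of n] by simp
      ultimately show "B / real (L (k - m)) \<le> 3 * B / real (L (k + 1))"
        using pos[of "k + 1"] pos[of "k - m"]
        by (simp add: pos_divide_le_eq pos_le_divide_eq mult.commute mult.left_commute del: Lg.simps)
    qed
    also have "\<dots> = 3 * real H * B * (1 / real (L (k + 1)))" by simp
    finally show ?thesis using False unfolding k(1) by simp
  qed
  have early: "(\<Sum>t=1..T. if ?q t \<le> H then real H else 0) \<le> 6 * real H ^ 3"
  proof -
    have "{t \<in> {1..T}. ?q t \<le> H} \<subseteq> {1..T0 (Suc H)}"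
    proof safe
      fix t assume t: "t \<in> {1..T}" "?q t \<le> H"
      then obtain k where k: "T0 k < t" "t \<le> T0 (Suc k)" using stage_exists[of t] by auto
      then have "k \<le> H" using t by (simp add: stage_of_eq)
      then show "t \<in> {1..T0 (Suc H)}" using k t T0_mono[of "Suc k" "Suc H"] by simp
    qed
    then have "card {t \<in> {1..T}. ?q t \<le> H} \<le> card {1..T0 (Suc H)}" by (rule card_mono[rotated]) simp
    also have "\<dots> \<le> 6 * H^2" using T0_early by simp
    finally have "real (card {t \<in> {1..T}. ?q t \<le> H}) \<le> real (6 * H^2)" by (rule of_nat_mono)
    then have "real (card {t \<in> {1..T}. ?q t \<le> H}) * real H \<le> real (6 * H^2) * real H" by (rule mult_right_mono) simp
    moreover have "(\<Sum>t=1..T. if ?q t \<le> H then real H else 0) = real (card {t \<in> {1..T}. ?q t \<le> H}) * real H"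
      by (subst sum.inter_filter[symmetric]) auto
    ultimately show ?thesis by (simp add: power2_eq_square power3_eq_cube)
  qed
  have "(\<Sum>t=1..T. g t) \<le> (\<Sum>t=1..T. (if ?q t \<le> H then real H else 0) + 3 * real H * B * (1 / real (L (?q t))))"
    by (intro sum_mono g)
  also have "\<dots> = (\<Sum>t=1..T. if ?q t \<le> H then real H else 0) + 3 * real H * B * (\<Sum>t=1..T. 1 / real (L (?q t)))"
    by (simp only: sum.distrib sum_distrib_left)
  also have "\<dots> \<le> 6 * real H ^ 3 + 3 * real H * B * (3 * real H * (ln (real T) / ln 2))"
    using B by (intro add_mono early mult_left_mono order_trans[OF sum_inverse_stage_length_le stage_count_le[OF T]]) auto
  also have "\<dots> = 6 * real H ^ 3 + 9 * real H ^ 2 * B * (ln (real T) / ln 2)"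
    by (simp add: power2_eq_square)
  finally have "(\<Sum>t=1..T. g t) / real T \<le> (6 * real H ^ 3 + 9 * real H ^ 2 * B * (ln (real T) / ln 2)) / real T"
    by (rule divide_right_mono) simp
  moreover have "Vout G \<eta> T i (Some \<sigma>) - Vout G \<eta> T i None = (\<Sum>t=1..T. g t) / real T"
    by (simp add: Vout_def g_def sum_subtractf diff_divide_distrib)
  ultimately show ?thesis by simp
qed

text \<open>For \<open>Amax G = 1\<close> the claimed bound is 0 because of the factor
  \<open>ln (Amax G)\<close>, so the charge for early stages could not be absorbed. The gain of a
  deviation must vanish exactly.\<close>

lemma single_action_deviation:
  assumes i: "i < nag G" and A: "nact G i = 1" and \<sigma>: "\<sigma> \<in> agent_policies G i"
  shows "Wv G \<eta> i (Some \<sigma>) n hs t s = Wv G \<eta> i None n hs t s"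
proof (induction n arbitrary: hs t s)
  case (Suc n)
  have "act_prob G \<eta> i (Some \<sigma>) j h hs s a = act_prob G \<eta> i None j h hs s a"
    if "a \<in> joint_actions G" for j h hs s a
  proof -
    have one: "y (a i) = 1" if y: "y \<in> act_simplex G i" for y
    proof -
      have "a i = 0" using joint_actions_less[OF \<open>a \<in> joint_actions G\<close> i] A by simp
      then show ?thesis using y A by (simp add: act_simplex_def)
    qed
    have "\<sigma> h hs s \<in> act_simplex G i" using \<sigma> by (simp add: agent_policies_def)
    then show ?thesis
      unfolding act_prob_eq[OF i] player_mix_def
      using one[of "\<sigma> h hs s"] one[OF iter_pol_act_simplex[OF i, of j h s]] by simp
  qed
  then show ?case by (simp add: Let_def Suc cong: sum.cong)
qed simp

lemma CCE_gap_leI: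
  assumes "\<And>i \<sigma>. i < nag G \<Longrightarrow> \<sigma> \<in> agent_policies G i \<Longrightarrow> Vout G \<eta> T i (Some \<sigma>) - Vout G \<eta> T i None \<le> B"
  shows "CCE_gap G \<eta> T \<le> B"
  unfolding CCE_gap_def
proof (subst Max_le_iff)
  show "(\<lambda>i. br_value G \<eta> T i - Vout G \<eta> T i None) ` {0..<nag G} \<noteq> {}" using N1 by auto
  show "\<forall>x\<in>(\<lambda>i. br_value G \<eta> T i - Vout G \<eta> T i None) ` {0..<nag G}. x \<le> B"
  proof safe
    fix i assume "i \<in> {0..<nag G}"
    then have i: "i < nag G" by simp
    have ne: "(\<lambda>_ _ _. unif_pol G 0 i 0) \<in> agent_policies G i"
      by (simp add: agent_policies_def unif_pol_act_simplex[OF act1[OF i]])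
    have "br_value G \<eta> T i \<le> B + Vout G \<eta> T i None"
      unfolding br_value_def
    proof (rule cSUP_least)
      show "agent_policies G i \<noteq> {}" using ne by blast
      show "Vout G \<eta> T i (Some \<sigma>) \<le> B + Vout G \<eta> T i None" if "\<sigma> \<in> agent_policies G i" for \<sigma>
        using assms[OF i that] by simp
    qed
    then show "br_value G \<eta> T i - Vout G \<eta> T i None \<le> B" by simp
  qed
qed simp

text \<open>The entropy term is bounded through the lower bound on the rate, which gives \<Lambda>^4
  / c, and the remaining \<open>K \<le> 2 * \<Lambda>\<close> is absorbed using
  \<open>ln 2 \<le> ln (Amax G)\<close>. The upper bound on the rate makes 6144 * N \<eta> K at most
  1, as 12288 = 2 * 6144.\<close>

lemma stage_regret_le_uniform:
  assumes A2: "2 \<le> Amax G" and c: "0 < c"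
    and \<eta>: "c / (real (nag G) * (max 1 (ln (real (L k)))) ^ 4) \<le> \<eta> (k + 1)"
      "\<eta> (k + 1) \<le> (1 / 12288) / (real (nag G) * (max 1 (ln (real (L k)))) ^ 4)"
    and LT: "L k \<le> T"
    and i: "i < nag G" and h: "h \<in> {1..H}" and s: "s \<in> states G" and b: "b < nact G i"
  shows "(\<Sum>j=1..L k. Qmix G (Qs k) (ps k j) h i s b - Qval G (Qs k) (ps k j) h i s)
    \<le> real H * (real (nag G) * ln (real (Amax G)) * (max 1 (ln (real T))) ^ 4 * (1 / c + 2 / ln 2))"
proof -
  define \<Lambda> where "\<Lambda> = max 1 (ln (real (L k)))"
  define N where "N = real (nag G)"
  define a where "a = ln (real (Amax G))"
  define K where "K = nat \<lceil>\<Lambda>\<rceil>"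
  have \<Lambda>1: "1 \<le> \<Lambda>" by (simp add: \<Lambda>_def)
  have N: "1 \<le> N" using N1 by (simp add: N_def)
  have a: "ln 2 \<le> a" using A2 by (simp add: a_def)
  have a0: "0 < a" using a by (rule less_le_trans[rotated]) simp
  have K: "\<Lambda> \<le> real K" "real K \<le> 2 * \<Lambda>" using \<Lambda>1 unfolding K_def by linarith+
  have K1: "1 \<le> K" using K(1) \<Lambda>1 by linarith
  have "real (L k) = exp (ln (real (L k)))" using L_pos[of k] by simp
  also have "\<dots> \<le> exp (real K)" using K(1) by (simp add: \<Lambda>_def)
  finally have LK: "real (L k) \<le> exp (real K)" .
  have \<Lambda>T: "\<Lambda> \<le> max 1 (ln (real T))" using LT L_pos[of k] unfolding \<Lambda>_def by (intro max.mono) auto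
  have D: "0 < N * \<Lambda> ^ 4" using N \<Lambda>1 by simp
  have \<eta>': "c / (N * \<Lambda> ^ 4) \<le> \<eta> (k + 1)" "\<eta> (k + 1) \<le> (1 / 12288) / (N * \<Lambda> ^ 4)"
    using \<eta> by (simp_all add: N_def \<Lambda>_def)
  have \<eta>pos: "0 < \<eta> (k + 1)" using \<eta>'(1) c D by (meson divide_pos_pos less_le_trans)
  have "6144 * N * \<eta> (k + 1) * real K \<le> 6144 * N * ((1 / 12288) / (N * \<Lambda> ^ 4)) * (2 * \<Lambda>)"
    using \<eta>'(2) N \<eta>pos K \<Lambda>1 D by (intro mult_mono mult_left_mono) auto
  also have "\<dots> = \<Lambda> / \<Lambda> ^ 4" using N by simp
  also have "\<dots> \<le> 1" using \<Lambda>1 power_increasing[of 1 4 \<Lambda>] by (simp add: divide_le_eq)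
  finally have small: "6144 * real (nag G) * \<eta> (k + 1) * real K \<le> 1" by (simp add: N_def)
  have "ln (real (nact G i)) \<le> a" using nact_le_Amax[OF i] act1[OF i] by (simp add: a_def)
  then have "ln (real (nact G i)) / \<eta> (k + 1) \<le> a / \<eta> (k + 1)" using \<eta>pos by (intro divide_right_mono) auto
  also have "\<dots> \<le> a / (c / (N * \<Lambda> ^ 4))"
    using \<eta>'(1) c D a0 N \<Lambda>1 by (intro divide_left_mono mult_pos_pos \<eta>pos divide_pos_pos) auto
  also have "\<dots> = N * a * \<Lambda> ^ 4 * (1 / c)" using c by simp
  finally have 1: "ln (real (nact G i)) / \<eta> (k + 1) \<le> N * a * \<Lambda> ^ 4 * (1 / c)" .
  have "0 \<le> N * a / ln 2" using N a0 by simp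
  then have "1 * 1 * \<Lambda> ^ 1 \<le> N * (a / ln 2) * \<Lambda> ^ 4"
    using N a \<Lambda>1 by (intro mult_mono power_increasing) auto
  then have "real K \<le> 2 * (N * (a / ln 2) * \<Lambda> ^ 4)" using K(2) unfolding power_one_right by linarith
  then have 2: "real K \<le> N * a * \<Lambda> ^ 4 * (2 / ln 2)" by (simp add: mult.commute mult.left_commute)
  have "(\<Sum>j=1..L k. Qmix G (Qs k) (ps k j) h i s b - Qval G (Qs k) (ps k j) h i s)
      \<le> real H * (ln (real (nact G i)) / \<eta> (k + 1) + real K)"
    by (rule stage_regret_le[OF i h s b \<eta>pos small K1 LK])
  also have "\<dots> \<le> real H * (N * a * \<Lambda> ^ 4 * (1 / c + 2 / ln 2))"
    unfolding distrib_left[of _ "1 / c"] using 1 2 by (intro mult_left_mono add_mono) auto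
  also have "\<dots> \<le> real H * (N * a * (max 1 (ln (real T))) ^ 4 * (1 / c + 2 / ln 2))"
    using N c a0 \<Lambda>1 \<Lambda>T by (intro mult_left_mono mult_right_mono power_mono) (auto simp del: max.bounded_iff)
  finally show ?thesis by (simp add: N_def a_def)
qed

lemma CCE_gap_le:
  assumes T: "2 \<le> T" and c: "0 < c"
    and \<eta>: "\<And>k. c / (real (nag G) * (max 1 (ln (real (L k)))) ^ 4) \<le> \<eta> (k + 1)"
      "\<And>k. \<eta> (k + 1) \<le> (1 / 12288) / (real (nag G) * (max 1 (ln (real (L k)))) ^ 4)"
  shows "CCE_gap G \<eta> T \<le> ((6 / ln 2 + 9 * (1 / c + 2 / ln 2)) / ln 2 ^ 5)
    * (real (nag G) * real H ^ 3 * ln (real (Amax G)) * (ln (real T)) ^ 5 / real T)"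
proof (rule CCE_gap_leI)
  fix i \<sigma> assume i: "i < nag G" and \<sigma>: "\<sigma> \<in> agent_policies G i"
  have Ai: "nact G i \<le> Amax G" "1 \<le> nact G i" using nact_le_Amax[OF i] act1[OF i] by auto
  show "Vout G \<eta> T i (Some \<sigma>) - Vout G \<eta> T i None \<le> ((6 / ln 2 + 9 * (1 / c + 2 / ln 2)) / ln 2 ^ 5)
    * (real (nag G) * real H ^ 3 * ln (real (Amax G)) * (ln (real T)) ^ 5 / real T)"
  proof (cases "Amax G = 1")
    case True
    then have "nact G i = 1" using Ai by simp
    from single_action_deviation[OF i this \<sigma>] show ?thesis using True by (simp add: Vout_def)
  next
    case False
    then have A2: "2 \<le> Amax G" using Ai by simp
    \<comment> \<open>With the binary logarithm \<open>x\<close>, \<open>T \<ge> 2\<close> gives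
      \<open>x \<ge> 1\<close>, and \<open>x\<close> also dominates \<open>max 1 (ln T)\<close>. The
      early charge is thus absorbed through \<open>1 \<le> N * (a / ln 2) * x ^ 5\<close>.\<close>
    define N a h x c1 where "N = real (nag G)" and "a = ln (real (Amax G))" and "h = real H"
      and "x = ln (real T) / ln 2" and "c1 = 1 / c + 2 / ln 2"
    define B where "B = h * (N * a * (max 1 (ln (real T))) ^ 4 * c1)"
    have ln2: "0 < ln (2::real)" "ln (2::real) < 1" using ln_2_less_1 by auto
    have N: "1 \<le> N" using N1 by (simp add: N_def)
    have a: "ln 2 \<le> a" using A2 by (simp add: a_def)
    have x1: "1 \<le> x" using T by (simp add: x_def)
    have h0: "0 \<le> h" by (simp add: h_def)
    have c1: "0 < c1" using c ln2 by (simp add: c1_def add_pos_pos)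
    have a0: "0 < a" using a ln2 by linarith
    have "ln (real T) * ln 2 \<le> ln (real T) * 1" using T ln2 by (intro mult_left_mono) auto
    then have "ln (real T) \<le> x" using ln2 by (simp add: x_def field_simps)
    then have mx: "max 1 (ln (real T)) \<le> x" using x1 by simp
    have "Vout G \<eta> T i (Some \<sigma>) - Vout G \<eta> T i None \<le> (6 * h ^ 3 + 9 * h ^ 2 * B * x) / real T"
      unfolding h_def x_def
    proof (rule deviation_gain_sum_le[OF T i \<sigma>])
      show "0 \<le> B" unfolding B_def using h0 N a0 c1 by (intro mult_nonneg_nonneg) auto
      show "(\<Sum>j=1..L k. Qmix G (Qs k) (ps k j) h' i s b - Qval G (Qs k) (ps k j) h' i s) \<le> B"
        if "L k \<le> T" "h' \<in> {1..H}" "s \<in> states G" "b < nact G i" for k h' s b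
        using stage_regret_le_uniform[OF A2 c \<eta> that(1) i that(2-4)]
        unfolding B_def N_def a_def c1_def h_def .
    qed
    also have "\<dots> \<le> (6 * (h ^ 3 * (N * (a / ln 2) * x ^ 5)) + 9 * c1 * (h ^ 3 * (N * a * x ^ 5))) / real T"
    proof (intro divide_right_mono add_mono)
      have "1 * 1 \<le> N * (a / ln 2)" using N a ln2 by (intro mult_mono) auto
      then have "1 * 1 \<le> N * (a / ln 2) * x ^ 5"
        using one_le_power[OF x1, of 5] by (intro mult_mono) linarith+
      then have "h ^ 3 * 1 \<le> h ^ 3 * (N * (a / ln 2) * x ^ 5)" using h0 by (intro mult_left_mono) auto
      then show "6 * h ^ 3 \<le> 6 * (h ^ 3 * (N * (a / ln 2) * x ^ 5))" by simp
      have "B \<le> h * (N * a * x ^ 4 * c1)" unfolding B_def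
        using h0 N a0 c1 mx by (intro mult_left_mono mult_right_mono power_mono) auto
      then have "9 * h ^ 2 * B * x \<le> 9 * h ^ 2 * (h * (N * a * x ^ 4 * c1)) * x"
        using h0 x1 by (intro mult_right_mono mult_left_mono) auto
      also have "\<dots> = 9 * c1 * (h ^ 3 * (N * a * x ^ 5))"
        by (simp add: power2_eq_square power3_eq_cube power_numeral_reduce)
      finally show "9 * h ^ 2 * B * x \<le> 9 * c1 * (h ^ 3 * (N * a * x ^ 5))" .
    qed simp
    also have "\<dots> = (6 / ln 2 + 9 * c1) * (N * h ^ 3 * a * x ^ 5 / real T)"
      using T ln2 by (simp add: field_simps)
    also have "\<dots> = ((6 / ln 2 + 9 * c1) / ln 2 ^ 5) * (N * h ^ 3 * a * (ln (real T)) ^ 5 / real T)"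
      by (simp add: x_def power_divide)
    finally show ?thesis by (simp add: N_def h_def a_def c1_def)
  qed
qed

end

text \<open>The upper constant of the rate has to be small in absolute terms for the smoothness
  argument, whereas the lower one may be arbitrary and enters \<open>C\<close> through its inverse;
  \<open>C\<close> depends on nothing else. The \<open>max 1\<close> covers stages so short that
  their logarithm is below 1, such as a first stage of length 1.\<close>

theorem theorem2:
  "\<exists>c_hi>0. \<forall>c_lo. 0 < c_lo \<and> c_lo \<le> c_hi \<longrightarrow>
     (\<exists>C. \<forall>G \<eta> (T::nat).
        valid_game G \<and> 2 \<le> T \<and>
        (\<forall>\<tau>\<ge>1. c_lo / (real (nag G) * (max 1 (ln (real (stage_len G \<tau>)))) ^ 4) \<le> \<eta> \<tau>
              \<and> \<eta> \<tau> \<le> c_hi / (real (nag G) * (max 1 (ln (real (stage_len G \<tau>)))) ^ 4))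
        \<longrightarrow> CCE_gap G \<eta> T
              \<le> C * (real (nag G) * real (hor G) ^ 3 * ln (real (Amax G)) * (ln (real T)) ^ 5 / real T))"
proof (rule exI[of _ "1 / 12288"], intro conjI allI impI)
  fix c :: real assume c: "0 < c \<and> c \<le> 1 / 12288"
  show "\<exists>C. \<forall>G \<eta> (T::nat).
        valid_game G \<and> 2 \<le> T \<and>
        (\<forall>\<tau>\<ge>1. c / (real (nag G) * (max 1 (ln (real (stage_len G \<tau>)))) ^ 4) \<le> \<eta> \<tau>
              \<and> \<eta> \<tau> \<le> 1 / 12288 / (real (nag G) * (max 1 (ln (real (stage_len G \<tau>)))) ^ 4))
        \<longrightarrow> CCE_gap G \<eta> T
              \<le> C * (real (nag G) * real (hor G) ^ 3 * ln (real (Amax G)) * (ln (real T)) ^ 5 / real T)"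
  proof (intro exI[of _ "(6 / ln 2 + 9 * (1 / c + 2 / ln 2)) / ln 2 ^ 5"] allI impI, elim conjE)
    fix G \<eta> and T :: nat
    assume G: "valid_game G" and T: "2 \<le> T"
      and \<eta>: "\<forall>\<tau>\<ge>1. c / (real (nag G) * (max 1 (ln (real (stage_len G \<tau>)))) ^ 4) \<le> \<eta> \<tau>
              \<and> \<eta> \<tau> \<le> 1 / 12288 / (real (nag G) * (max 1 (ln (real (stage_len G \<tau>)))) ^ 4)"
    have "stage_len G (k + 1) = Lg (hor G) k" for k by (simp add: stage_len_def)
    then have \<eta>': "c / (real (nag G) * (max 1 (ln (real (Lg (hor G) k)))) ^ 4) \<le> \<eta> (k + 1)"
      "\<eta> (k + 1) \<le> 1 / 12288 / (real (nag G) * (max 1 (ln (real (Lg (hor G) k)))) ^ 4)" for k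
      using \<eta>[rule_format, of "k + 1"] by auto
    show "CCE_gap G \<eta> T \<le> (6 / ln 2 + 9 * (1 / c + 2 / ln 2)) / ln 2 ^ 5
       * (real (nag G) * real (hor G) ^ 3 * ln (real (Amax G)) * (ln (real T)) ^ 5 / real T)"
      using c by (intro markov_game.CCE_gap_le markov_game.intro G T \<eta>') auto
  qed
qed simp

end
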